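(* Let $X=\int_Z^\oplus X(\zeta)\,d\omega(\zeta)$ be a bounded, normal, decomposable operator on the direct integral Hilbert space $\mathcal{H}=\int_Z^\oplus\mathcal{H}(\zeta)\,d\omega(\zeta)$, where (by redefining $X(\zeta)$ for $\zeta$ in a null set, if necessary) $X(\zeta)$ is supposed to be normal and to have spectrum contained in the spectrum $\sigma(X)$ of $X$ for all $\zeta$. Suppose $f:\sigma(X)\to\mathbb{C}$ is a bounded Borel function. Then taking the Borel functional calculus, we have $$f(X)=\int_Z^\oplus f(X(\zeta))\,d\omega(\zeta).$$
   Context: Direct integrals. $Z$ is a standard Borel space (a Polish space with its Borel $\sigma$-algebra) and $\omega$ is a $\sigma$-finite positive measure on it. A measurable field of Hilbert spaces is a map $\zeta\mapsto\mathcal{H}(\zeta)$, each $\mathcal{H}(\zeta)$ a Hilbert space, with a set $S$ of vector fields $\zeta\mapsto x(\zeta)\in\mathcal{H}(\zeta)$ (called measurable) such that (i) $\zeta\mapsto\langle x(\zeta),y(\zeta)\rangle$ is measurable for all $x,y\in S$; (ii) if $v$ is a vector field with $\zeta\mapsto\langle x(\zeta),v(\zeta)\rangle$ measurable for every $x\in S$, then $v\in S$; (iii) there is a sequence $(x_n)$ in $S$ such that $\{x_n(\zeta)\}_n$ has dense linear span in $\mathcal{H}(\zeta)$ for every $\zeta$. The direct integral $\mathcal{H}=\int_Z^\oplus\mathcal{H}(\zeta)\,d\omega(\zeta)$ is the Hilbert space of all $x\in S$ (modulo a.e. equality) with $\int_Z\|x(\zeta)\|^2d\omega<\infty$ and inner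 product $\int_Z\langle x(\zeta),y(\zeta)\rangle\,d\omega(\zeta)$. Decomposable operators. A field of bounded operators $T(\zeta)\in B(\mathcal{H}(\zeta))$ is measurable if $\zeta\mapsto T(\zeta)x(\zeta)$ is in $S$ for all $x\in S$. If moreover $\zeta\mapsto\|T(\zeta)\|$ is essentially bounded, it defines a bounded operator $T=\int_Z^\oplus T(\zeta)\,d\omega(\zeta)$ on $\mathcal{H}$ by $(Tx)(\zeta)=T(\zeta)x(\zeta)$; such operators are called decomposable. Fields agreeing almost everywhere define the same operator. An equality $R=\int_Z^\oplus R(\zeta)\,d\omega(\zeta)$ asserts that the field $R(\zeta)$ is measurable and that $R$ is the associated decomposable operator. It is known that a bounded decomposable operator $X$ is normal if and only if $X(\zeta)$ is normal for almost every $\zeta$, and that $\sigma(X(\zeta))\subseteq\sigma(X)$ for almost every $\zeta$; this is why the supposition on $X(\zeta)$ for all $\zeta$ can always be arranged by changing the field on a null set. *)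

theory Defs
  imports "HOL-Analysis.Analysis"
begin

section \<open>Complex Hilbert spaces\<close>

text \<open>Hilbert spaces are records with an explicit carrier, so that a field of Hilbert spaces is a
  function into one record type whose values may have different dimensions, and so that a quotient
  modulo almost everywhere equality is again such a record. The inner product is linear in its
  first argument.\<close>

record 'a hspace =
  hcarrier :: "'a set"
  hzero :: 'a
  hadd :: "'a \<Rightarrow> 'a \<Rightarrow> 'a"
  hscale :: "complex \<Rightarrow> 'a \<Rightarrow> 'a"
  hinner :: "'a \<Rightarrow> 'a \<Rightarrow> complex"

definition hdiff :: "'a hspace \<Rightarrow> 'a \<Rightarrow> 'a \<Rightarrow> 'a" where
  "hdiff H x y = hadd H x (hscale H (- 1) y)"

definition hnorm :: "'a hspace \<Rightarrow> 'a \<Rightarrow> real" where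
  "hnorm H x = sqrt (Re (hinner H x x))"

locale hilbert_space =
  fixes H :: "'a hspace"
  assumes zero_closed: "hzero H \<in> hcarrier H"
    and add_closed: "\<lbrakk>x \<in> hcarrier H; y \<in> hcarrier H\<rbrakk> \<Longrightarrow> hadd H x y \<in> hcarrier H"
    and scale_closed: "x \<in> hcarrier H \<Longrightarrow> hscale H c x \<in> hcarrier H"
    and add_assoc: "\<lbrakk>x \<in> hcarrier H; y \<in> hcarrier H; z \<in> hcarrier H\<rbrakk>
          \<Longrightarrow> hadd H (hadd H x y) z = hadd H x (hadd H y z)"
    and add_commute: "\<lbrakk>x \<in> hcarrier H; y \<in> hcarrier H\<rbrakk> \<Longrightarrow> hadd H x y = hadd H y x"
    and add_zero: "x \<in> hcarrier H \<Longrightarrow> hadd H x (hzero H) = x"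
    and add_minus: "x \<in> hcarrier H \<Longrightarrow> hdiff H x x = hzero H"
    and scale_one: "x \<in> hcarrier H \<Longrightarrow> hscale H 1 x = x"
    and scale_scale: "x \<in> hcarrier H \<Longrightarrow> hscale H a (hscale H b x) = hscale H (a * b) x"
    and scale_add_left: "x \<in> hcarrier H
          \<Longrightarrow> hscale H (a + b) x = hadd H (hscale H a x) (hscale H b x)"
    and scale_add_right: "\<lbrakk>x \<in> hcarrier H; y \<in> hcarrier H\<rbrakk>
          \<Longrightarrow> hscale H a (hadd H x y) = hadd H (hscale H a x) (hscale H a y)"
    and inner_commute: "\<lbrakk>x \<in> hcarrier H; y \<in> hcarrier H\<rbrakk> \<Longrightarrow> hinner H y x = cnj (hinner H x y)"
    and inner_add: "\<lbrakk>x \<in> hcarrier H; y \<in> hcarrier H; z \<in> hcarrier H\<rbrakk>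
          \<Longrightarrow> hinner H (hadd H x y) z = hinner H x z + hinner H y z"
    and inner_scale: "\<lbrakk>x \<in> hcarrier H; y \<in> hcarrier H\<rbrakk>
          \<Longrightarrow> hinner H (hscale H c x) y = c * hinner H x y"
    and inner_nonneg: "x \<in> hcarrier H \<Longrightarrow> 0 \<le> Re (hinner H x x)"
    and inner_definite: "\<lbrakk>x \<in> hcarrier H; hinner H x x = 0\<rbrakk> \<Longrightarrow> x = hzero H"
    and complete: "\<lbrakk>\<And>n. s n \<in> hcarrier H;
          \<And>e. 0 < e \<Longrightarrow> \<exists>N. \<forall>m\<ge>N. \<forall>n\<ge>N. hnorm H (hdiff H (s m) (s n)) < e\<rbrakk>
          \<Longrightarrow> \<exists>l\<in>hcarrier H. (\<lambda>n. hnorm H (hdiff H (s n) l)) \<longlonglongrightarrow> 0"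

definition hsubspace :: "'a hspace \<Rightarrow> 'a set \<Rightarrow> bool" where
  "hsubspace H V \<longleftrightarrow> V \<subseteq> hcarrier H \<and> hzero H \<in> V \<and>
     (\<forall>x\<in>V. \<forall>y\<in>V. hadd H x y \<in> V) \<and> (\<forall>c. \<forall>x\<in>V. hscale H c x \<in> V)"

definition hspan :: "'a hspace \<Rightarrow> 'a set \<Rightarrow> 'a set" where
  "hspan H A = \<Inter> {V. hsubspace H V \<and> A \<subseteq> V}"

definition hdense :: "'a hspace \<Rightarrow> 'a set \<Rightarrow> bool" where
  "hdense H A \<longleftrightarrow> (\<forall>x\<in>hcarrier H. \<forall>e>0. \<exists>y\<in>A. hnorm H (hdiff H x y) < e)"


section \<open>Bounded operators\<close>

text \<open>Operators are extensional functions (\<^term>\<open>undefined\<close> off the carrier), so that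
  equality of operators is equality on the carrier and definite descriptions are meaningful.\<close>

definition bounded_ops :: "'a hspace \<Rightarrow> ('a \<Rightarrow> 'a) set" where
  "bounded_ops H = {T \<in> hcarrier H \<rightarrow>\<^sub>E hcarrier H.
     (\<forall>x\<in>hcarrier H. \<forall>y\<in>hcarrier H. T (hadd H x y) = hadd H (T x) (T y)) \<and>
     (\<forall>c. \<forall>x\<in>hcarrier H. T (hscale H c x) = hscale H c (T x)) \<and>
     (\<exists>K. \<forall>x\<in>hcarrier H. hnorm H (T x) \<le> K * hnorm H x)}"

definition op_norm :: "'a hspace \<Rightarrow> ('a \<Rightarrow> 'a) \<Rightarrow> real" where
  "op_norm H T = (SUP x\<in>{x \<in> hcarrier H. hnorm H x \<le> 1}. hnorm H (T x))"

definition id_op :: "'a hspace \<Rightarrow> 'a \<Rightarrow> 'a" where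
  "id_op H = (\<lambda>x\<in>hcarrier H. x)"

definition comp_op :: "'a hspace \<Rightarrow> ('a \<Rightarrow> 'a) \<Rightarrow> ('a \<Rightarrow> 'a) \<Rightarrow> 'a \<Rightarrow> 'a" where
  "comp_op H = compose (hcarrier H)"

definition adjoint_op :: "'a hspace \<Rightarrow> ('a \<Rightarrow> 'a) \<Rightarrow> 'a \<Rightarrow> 'a" where
  "adjoint_op H T = (THE T'. T' \<in> bounded_ops H \<and>
     (\<forall>x\<in>hcarrier H. \<forall>y\<in>hcarrier H. hinner H (T x) y = hinner H x (T' y)))"

definition normal_op :: "'a hspace \<Rightarrow> ('a \<Rightarrow> 'a) \<Rightarrow> bool" where
  "normal_op H T \<longleftrightarrow> T \<in> bounded_ops H \<and>
     comp_op H T (adjoint_op H T) = comp_op H (adjoint_op H T) T"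

definition spectrum :: "'a hspace \<Rightarrow> ('a \<Rightarrow> 'a) \<Rightarrow> complex set" where
  "spectrum H T = {l. \<not> (\<exists>B\<in>bounded_ops H.
     comp_op H (\<lambda>x\<in>hcarrier H. hdiff H (T x) (hscale H l x)) B = id_op H \<and>
     comp_op H B (\<lambda>x\<in>hcarrier H. hdiff H (T x) (hscale H l x)) = id_op H)}"

definition orth_projection :: "'a hspace \<Rightarrow> ('a \<Rightarrow> 'a) \<Rightarrow> bool" where
  "orth_projection H P \<longleftrightarrow> P \<in> bounded_ops H \<and> comp_op H P P = P \<and> adjoint_op H P = P"


section \<open>Borel functional calculus\<close>

definition proj_valued_measure ::
  "'a hspace \<Rightarrow> 'b measure \<Rightarrow> ('b set \<Rightarrow> 'a \<Rightarrow> 'a) \<Rightarrow> bool" where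
  "proj_valued_measure H M E \<longleftrightarrow>
     E \<in> extensional (sets M) \<and>
     (\<forall>A\<in>sets M. orth_projection H (E A)) \<and>
     E {} = (\<lambda>x\<in>hcarrier H. hzero H) \<and> E (space M) = id_op H \<and>
     (\<forall>A\<in>sets M. \<forall>B\<in>sets M. E (A \<inter> B) = comp_op H (E A) (E B)) \<and>
     (\<forall>A. range A \<subseteq> sets M \<longrightarrow> disjoint_family A \<longrightarrow>
        (\<forall>x\<in>hcarrier H. \<forall>y\<in>hcarrier H.
           (\<lambda>n. hinner H (E (A n) x) y) sums hinner H (E (\<Union>n. A n) x) y))"

text \<open>The positive measure \<open>A \<mapsto> \<langle>E(A)x, x\<rangle>\<close>.\<close>

definition scalar_measure ::
  "'a hspace \<Rightarrow> 'b measure \<Rightarrow> ('b set \<Rightarrow> 'a \<Rightarrow> 'a) \<Rightarrow> 'a \<Rightarrow> 'b measure" where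
  "scalar_measure H M E x =
     measure_of (space M) (sets M) (\<lambda>A. ennreal (Re (hinner H (E A x) x)))"

text \<open>\<open>\<integral> f dE\<close>: the operator \<open>R\<close> with \<open>\<langle>Rx, x\<rangle> = \<integral> f d\<langle>E(\<cdot>)x, x\<rangle>\<close> for all \<open>x\<close>; on a complex
  Hilbert space the diagonal values determine \<open>R\<close> by polarization.\<close>

definition pvm_integral ::
  "'a hspace \<Rightarrow> 'b measure \<Rightarrow> ('b set \<Rightarrow> 'a \<Rightarrow> 'a) \<Rightarrow> ('b \<Rightarrow> complex) \<Rightarrow> 'a \<Rightarrow> 'a" where
  "pvm_integral H M E f = (THE R. R \<in> bounded_ops H \<and>
     (\<forall>x\<in>hcarrier H. hinner H (R x) x = (\<integral>l. f l \<partial>scalar_measure H M E x)))"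

abbreviation spectrum_borel :: "'a hspace \<Rightarrow> ('a \<Rightarrow> 'a) \<Rightarrow> complex measure" where
  "spectrum_borel H T \<equiv> restrict_space borel (spectrum H T)"

text \<open>The spectral measure of a normal operator \<open>T\<close>, on the Borel subsets of \<open>\<sigma>(T)\<close>; existence
  and uniqueness are the spectral theorem.\<close>

definition spectral_measure :: "'a hspace \<Rightarrow> ('a \<Rightarrow> 'a) \<Rightarrow> complex set \<Rightarrow> 'a \<Rightarrow> 'a" where
  "spectral_measure H T = (THE E. proj_valued_measure H (spectrum_borel H T) E \<and>
     pvm_integral H (spectrum_borel H T) E (\<lambda>l. l) = T)"

text \<open>\<open>f(T)\<close> for a bounded Borel function \<open>f\<close> on \<open>\<sigma>(T)\<close>. Only the values of \<open>f\<close> on \<open>\<sigma>(T)\<close>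
  matter, so a function on a larger set is implicitly restricted.\<close>

definition borel_calculus ::
  "'a hspace \<Rightarrow> (complex \<Rightarrow> complex) \<Rightarrow> ('a \<Rightarrow> 'a) \<Rightarrow> 'a \<Rightarrow> 'a" where
  "borel_calculus H f T = pvm_integral H (spectrum_borel H T) (spectral_measure H T) f"


section \<open>Direct integrals\<close>

definition vector_fields :: "('z \<Rightarrow> 'h hspace) \<Rightarrow> ('z \<Rightarrow> 'h) set" where
  "vector_fields H = {x. \<forall>z. x z \<in> hcarrier (H z)}"

locale measurable_hilbert_field =
  fixes M :: "'z measure"
    and H :: "'z \<Rightarrow> 'h hspace"
    and S :: "('z \<Rightarrow> 'h) set"
  assumes fibre_hilbert: "hilbert_space (H z)"
    and fields_subset: "S \<subseteq> vector_fields H"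
    and inner_measurable: "\<lbrakk>x \<in> S; y \<in> S\<rbrakk>
          \<Longrightarrow> (\<lambda>z. hinner (H z) (x z) (y z)) \<in> borel_measurable M"
    and fields_maximal: "\<lbrakk>v \<in> vector_fields H;
          \<And>x. x \<in> S \<Longrightarrow> (\<lambda>z. hinner (H z) (x z) (v z)) \<in> borel_measurable M\<rbrakk> \<Longrightarrow> v \<in> S"
    and fundamental_sequence: "\<exists>x :: nat \<Rightarrow> 'z \<Rightarrow> 'h. range x \<subseteq> S \<and>
          (\<forall>z. hdense (H z) (hspan (H z) (range (\<lambda>n. x n z))))"

definition sq_integrable_fields ::
  "'z measure \<Rightarrow> ('z \<Rightarrow> 'h hspace) \<Rightarrow> ('z \<Rightarrow> 'h) set \<Rightarrow> ('z \<Rightarrow> 'h) set" where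
  "sq_integrable_fields M H S = {x \<in> S. integrable M (\<lambda>z. (hnorm (H z) (x z))\<^sup>2)}"

definition ae_equal ::
  "'z measure \<Rightarrow> ('z \<Rightarrow> 'h hspace) \<Rightarrow> ('z \<Rightarrow> 'h) set \<Rightarrow> (('z \<Rightarrow> 'h) \<times> ('z \<Rightarrow> 'h)) set" where
  "ae_equal M H S = {(x, y). x \<in> sq_integrable_fields M H S \<and> y \<in> sq_integrable_fields M H S \<and>
     (AE z in M. x z = y z)}"

abbreviation ae_class ::
  "'z measure \<Rightarrow> ('z \<Rightarrow> 'h hspace) \<Rightarrow> ('z \<Rightarrow> 'h) set \<Rightarrow> ('z \<Rightarrow> 'h) \<Rightarrow> ('z \<Rightarrow> 'h) set" where
  "ae_class M H S x \<equiv> ae_equal M H S `` {x}"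

definition representative :: "('z \<Rightarrow> 'h) set \<Rightarrow> 'z \<Rightarrow> 'h" where
  "representative A = (SOME x. x \<in> A)"

definition direct_integral ::
  "'z measure \<Rightarrow> ('z \<Rightarrow> 'h hspace) \<Rightarrow> ('z \<Rightarrow> 'h) set \<Rightarrow> ('z \<Rightarrow> 'h) set hspace" where
  "direct_integral M H S = \<lparr>
     hcarrier = sq_integrable_fields M H S // ae_equal M H S,
     hzero = ae_class M H S (\<lambda>z. hzero (H z)),
     hadd = (\<lambda>A B. ae_class M H S (\<lambda>z. hadd (H z) (representative A z) (representative B z))),
     hscale = (\<lambda>c A. ae_class M H S (\<lambda>z. hscale (H z) c (representative A z))),
     hinner = (\<lambda>A B. \<integral>z. hinner (H z) (representative A z) (representative B z) \<partial>M)\<rparr>"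

definition decomposable_field ::
  "'z measure \<Rightarrow> ('z \<Rightarrow> 'h hspace) \<Rightarrow> ('z \<Rightarrow> 'h) set \<Rightarrow> ('z \<Rightarrow> 'h \<Rightarrow> 'h) \<Rightarrow> bool" where
  "decomposable_field M H S T \<longleftrightarrow>
     (\<forall>z. T z \<in> bounded_ops (H z)) \<and>
     (\<forall>x\<in>S. (\<lambda>z. T z (x z)) \<in> S) \<and>
     (\<exists>K. AE z in M. op_norm (H z) (T z) \<le> K)"

definition direct_integral_op ::
  "'z measure \<Rightarrow> ('z \<Rightarrow> 'h hspace) \<Rightarrow> ('z \<Rightarrow> 'h) set \<Rightarrow> ('z \<Rightarrow> 'h \<Rightarrow> 'h)
     \<Rightarrow> ('z \<Rightarrow> 'h) set \<Rightarrow> ('z \<Rightarrow> 'h) set" where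
  "direct_integral_op M H S T =
     (\<lambda>A\<in>hcarrier (direct_integral M H S). ae_class M H S (\<lambda>z. T z (representative A z)))"

text \<open>The assertion \<open>R = \<integral>\<^sup>\<oplus> R(z) dM(z)\<close>, which includes that the field is measurable and
  essentially bounded.\<close>

definition is_direct_integral_op ::
  "'z measure \<Rightarrow> ('z \<Rightarrow> 'h hspace) \<Rightarrow> ('z \<Rightarrow> 'h) set
     \<Rightarrow> (('z \<Rightarrow> 'h) set \<Rightarrow> ('z \<Rightarrow> 'h) set) \<Rightarrow> ('z \<Rightarrow> 'h \<Rightarrow> 'h) \<Rightarrow> bool" where
  "is_direct_integral_op M H S R T \<longleftrightarrow>
     decomposable_field M H S T \<and> R = direct_integral_op M H S T"

end

theory Submission
  imports Defs
begin

text \<open>Why the theorem holds. Say that a bounded Borel function \<open>f\<close> on the spectrum of \<open>X\<close> decomposes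
  if \<open>f(X)\<close> is the direct integral of the operators \<open>f(X(z))\<close>, tested by inner products. The
  constant 1 decomposes. Sums and scalar multiples of decomposing functions decompose. If \<open>f\<close>
  decomposes, so does \<open>l \<mapsto> l f(l)\<close>, since both on the direct integral and in each fibre its
  calculus is that of \<open>f\<close> composed with the operator; likewise \<open>l \<mapsto> cnj l f(l)\<close>, with the adjoint,
  which inner products move to the other side. Finally a bounded pointwise limit of decomposing
  functions decomposes: dominated convergence against the spectral measures gives weak convergence
  of the operators in every fibre and on the direct integral, and a second dominated
  convergence, over the base, identifies the two limits. By Stone-Weierstrass and a monotone class
  argument (\<open>bounded_borel_induct\<close>) these closure properties reach every bounded Borel function on
  a bounded set (\<open>calculus_decomposes\<close>).

  This argument presupposes that the Borel functional calculus is the expected object, both on the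
  fibres and on the direct integral, whose Hilbert space axioms are \<open>direct_integral_hilbert_space\<close>
  (completeness is Riesz-Fischer for vector fields). The spectral theorem is proved as follows.

  A bounded normal operator is \<open>A + i B\<close> with commuting symmetric \<open>A\<close> and \<open>B\<close>. For a vector \<open>x\<close>, the
  map \<open>p \<mapsto> \<langle>p(A, B) x, x\<rangle>\<close> on real bivariate polynomials is positive on squares, and on squares
  multiplied by \<open>K\<^sup>2 - a\<^sup>2\<close> or \<open>K\<^sup>2 - b\<^sup>2\<close>, where \<open>K\<close> bounds the norms of \<open>A\<close> and \<open>B\<close>. Such a functional
  is integration against a finite measure on a square (\<open>moment_measure_exists\<close>): its values on
  products of Bernstein polynomials are nonnegative weights on finer and finer grids, the
  weighted sums over the grids converge for every continuous function, and the limit is a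
  positive functional on continuous functions, hence an integral by the Riesz representation theorem
  (\<open>integral_riesz_measure\<close>).

  With these measures an operator is said to represent a function if its quadratic form is the
  integral of the function. Represented functions are stable under bounded pointwise limits, because
  operators converging weakly have a limit operator (\<open>represents_limit\<close>); so indicators are
  represented as well, and their operators form a projection-valued measure \<open>E\<close>
  (\<open>normal_operator_pvm\<close>). The spectrum is the set of points all of whose balls have nonzero \<open>E\<close>; hence
  it is bounded and closed and carries \<open>E\<close> (\<open>E_spectrum\<close>). A second use of the same
  induction over Borel functions shows that \<open>E\<close> is unique (\<open>spectral_pvm_unique\<close>), so the
  definite descriptions that define the spectral measure and its integrals denote what they
  should (\<open>spectral_measure_props\<close>, \<open>represents_pvm_integral\<close>).\<close>

section \<open>Measures from positive functionals\<close>

text \<open>A positive functional is taken to act on functions that are continuous on the whole space and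
  to see only their values on the compact set \<open>Q\<close> (see \<open>functional_cong\<close>), which avoids extending
  continuous functions from \<open>Q\<close>.\<close>

locale compact_positive_functional =
  fixes Q :: "'a::metric_space set" and \<Lambda> :: "('a \<Rightarrow> real) \<Rightarrow> real"
  assumes compact_support: "compact Q"
    and additive: "\<lbrakk>continuous_on UNIV f; continuous_on UNIV g\<rbrakk> \<Longrightarrow> \<Lambda> (\<lambda>x. f x + g x) = \<Lambda> f + \<Lambda> g"
    and homogeneous: "continuous_on UNIV f \<Longrightarrow> \<Lambda> (\<lambda>x. c * f x) = c * \<Lambda> f"
    and nonneg: "\<lbrakk>continuous_on UNIV f; \<And>x. x \<in> Q \<Longrightarrow> 0 \<le> f x\<rbrakk> \<Longrightarrow> 0 \<le> \<Lambda> f"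
begin

lemma functional_diff:
  assumes "continuous_on UNIV f" "continuous_on UNIV g"
  shows "\<Lambda> (\<lambda>x. f x - g x) = \<Lambda> f - \<Lambda> g"
proof -
  have "\<Lambda> (\<lambda>x. f x + (- 1) * g x) = \<Lambda> f + \<Lambda> (\<lambda>x. (- 1) * g x)"
    using assms by (intro additive continuous_intros)
  then show ?thesis using homogeneous[OF assms(2), of "-1"] by simp
qed

lemma functional_mono:
  assumes "continuous_on UNIV f" "continuous_on UNIV g" "\<And>x. x \<in> Q \<Longrightarrow> f x \<le> g x"
  shows "\<Lambda> f \<le> \<Lambda> g"
proof -
  have "0 \<le> \<Lambda> (\<lambda>x. g x - f x)"
    using assms by (intro nonneg continuous_intros) auto
  then show ?thesis using functional_diff[OF assms(2,1)] by simp
qed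

lemma functional_cong:
  assumes "continuous_on UNIV f" "continuous_on UNIV g" "\<And>x. x \<in> Q \<Longrightarrow> f x = g x"
  shows "\<Lambda> f = \<Lambda> g"
  using functional_mono[of f g] functional_mono[of g f] assms by force

lemma functional_zero: "\<Lambda> (\<lambda>x. 0) = 0"
  using homogeneous[of "\<lambda>x. 0" 0] by simp

lemma functional_sum:
  assumes "\<And>i. continuous_on UNIV (f i)"
  shows "\<Lambda> (\<lambda>x. \<Sum>i<n. f i x) = (\<Sum>i<(n::nat). \<Lambda> (f i))"
proof (induction n)
  case 0 then show ?case by (simp add: functional_zero)
next
  case (Suc n)
  have "\<Lambda> (\<lambda>x. (\<Sum>i<n. f i x) + f n x) = \<Lambda> (\<lambda>x. (\<Sum>i<n. f i x)) + \<Lambda> (f n)"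
    using assms by (intro additive continuous_intros)
  then show ?case using Suc by simp
qed

text \<open>The price of a cover is the sum of the values of the functional, and the outer measure of a set is
  the infimum of the prices of its countable covers by nonnegative continuous functions. Because countable covers are allowed from the start (rather than single continuous
  functions, or open sets), countable subadditivity amounts to a rearrangement of double
  series.\<close>

definition covers :: "'a set \<Rightarrow> (nat \<Rightarrow> 'a \<Rightarrow> real) set" where
  "covers A = {f. (\<forall>n. continuous_on UNIV (f n)) \<and> (\<forall>n x. 0 \<le> f n x) \<and>
     (\<forall>x\<in>A \<inter> Q. 1 \<le> (\<Sum>n. ennreal (f n x)))}"

definition outer :: "'a set \<Rightarrow> ennreal" where
  "outer A = (INF f\<in>covers A. \<Sum>n. ennreal (\<Lambda> (f n)))"

lemma outer_le: "f \<in> covers A \<Longrightarrow> outer A \<le> (\<Sum>n. ennreal (\<Lambda> (f n)))"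
  unfolding outer_def by (rule INF_lower)

lemma outer_le_double:
  assumes cont: "\<And>k n. continuous_on UNIV (g k n)" and pos: "\<And>k n x. 0 \<le> g k n x"
    and cov: "\<And>x. x \<in> A \<Longrightarrow> x \<in> Q \<Longrightarrow> 1 \<le> (\<Sum>k. \<Sum>n. ennreal (g k n x))"
  shows "outer A \<le> (\<Sum>k. \<Sum>n. ennreal (\<Lambda> (g k n)))"
proof -
  define f where "f i = (case prod_decode i of (k, n) \<Rightarrow> g k n)" for i
  have *: "(\<Sum>i. F (f i)) = (\<Sum>k. \<Sum>n. F (g k n))" for F :: "('a \<Rightarrow> real) \<Rightarrow> ennreal"
    using suminf_ennreal_2dimen[of "\<lambda>k. \<Sum>n. F (g k n)" "\<lambda>(k, n). F (g k n)"]
    by (simp add: f_def comp_def case_prod_beta)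
  have "f \<in> covers A"
    unfolding covers_def
  proof (intro CollectI conjI allI ballI)
    fix i x show "continuous_on UNIV (f i)" "0 \<le> f i x"
      using cont pos by (simp_all add: f_def case_prod_beta)
  next
    fix x assume "x \<in> A \<inter> Q"
    then show "1 \<le> (\<Sum>n. ennreal (f n x))"
      using cov[of x] *[of "\<lambda>h. ennreal (h x)"] by simp
  qed
  then show ?thesis using outer_le[of f A] *[of "\<lambda>h. ennreal (\<Lambda> h)"] by simp
qed

lemma outer_le_single:
  assumes "continuous_on UNIV g" "\<And>x. 0 \<le> g x" "\<And>x. x \<in> A \<Longrightarrow> x \<in> Q \<Longrightarrow> 1 \<le> g x"
  shows "outer A \<le> ennreal (\<Lambda> g)"
proof -
  define f where "f n = (if n = 0 then g else (\<lambda>x. 0))" for n :: nat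
  have *: "(\<Sum>n. F (f n)) = F g" if "F (\<lambda>x. 0) = 0" for F :: "('a \<Rightarrow> real) \<Rightarrow> ennreal"
    using suminf_finite[of "{0}" "\<lambda>n. F (f n)"] that by (simp add: f_def)
  have "f \<in> covers A"
    unfolding covers_def
  proof (intro CollectI conjI allI ballI)
    fix i x show "continuous_on UNIV (f i)" "0 \<le> f i x"
      using assms by (auto simp: f_def)
  next
    fix x assume "x \<in> A \<inter> Q"
    then show "1 \<le> (\<Sum>n. ennreal (f n x))"
      using assms(3)[of x] *[of "\<lambda>h. ennreal (h x)"] by simp
  qed
  then show ?thesis using outer_le[of f A] *[of "\<lambda>h. ennreal (\<Lambda> h)"] by (simp add: functional_zero)
qed

lemma outer_finite: "outer A \<le> ennreal (\<Lambda> (\<lambda>x. 1))"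
  by (rule outer_le_single) auto

lemma outer_outside: "A \<inter> Q = {} \<Longrightarrow> outer A = 0"
  using outer_le_single[of "\<lambda>x. 0" A] by (auto simp: functional_zero)

lemma outer_mono: "A \<subseteq> B \<Longrightarrow> outer A \<le> outer B"
  unfolding outer_def by (rule INF_superset_mono) (auto simp: covers_def)

lemma outer_countably_subadditive: "outer (\<Union>i. A i) \<le> (\<Sum>i. outer (A (i::nat)))"
proof (rule ennreal_le_epsilon)
  fix e :: real assume "0 < e"
  define \<epsilon> where "\<epsilon> i = ennreal (e * (1/2)^Suc i)" for i
  have eps: "0 < \<epsilon> i" for i using \<open>0 < e\<close> by (simp add: \<epsilon>_def)
  have "\<exists>f\<in>covers (A i). (\<Sum>n. ennreal (\<Lambda> (f n))) < outer (A i) + \<epsilon> i" for i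
  proof -
    have "outer (A i) < outer (A i) + \<epsilon> i"
      using outer_finite[of "A i"] eps[of i]
      by (metis add.right_neutral ennreal_add_left_cancel_less ennreal_less_top infinity_ennreal_def
          le_less_trans linorder_not_le top.not_eq_extremum)
    then show ?thesis unfolding outer_def INF_less_iff by auto
  qed
  then obtain f where f: "\<And>i. f i \<in> covers (A i)"
      "\<And>i. (\<Sum>n. ennreal (\<Lambda> (f i n))) < outer (A i) + \<epsilon> i" by metis
  have "outer (\<Union>i. A i) \<le> (\<Sum>i. \<Sum>n. ennreal (\<Lambda> (f i n)))"
  proof (rule outer_le_double)
    fix x assume "x \<in> (\<Union>i. A i)" "x \<in> Q"
    then obtain i where "x \<in> A i" by auto
    then have "1 \<le> (\<Sum>n. ennreal (f i n x))" using f(1)[of i] \<open>x \<in> Q\<close> by (auto simp: covers_def)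
    also have "\<dots> \<le> (\<Sum>i. \<Sum>n. ennreal (f i n x))"
      using sum_le_suminf[of "\<lambda>i. \<Sum>n. ennreal (f i n x)" "{i}"] by simp
    finally show "1 \<le> (\<Sum>i. \<Sum>n. ennreal (f i n x))" .
  qed (use f(1) in \<open>auto simp: covers_def\<close>)
  also have "\<dots> \<le> (\<Sum>i. outer (A i) + \<epsilon> i)"
    using f(2) by (intro suminf_le) (auto intro: less_imp_le)
  also have "\<dots> = (\<Sum>i. outer (A i)) + (\<Sum>i. \<epsilon> i)"
    by (rule suminf_add[symmetric]) auto
  also have "(\<Sum>i. \<epsilon> i) = ennreal e"
  proof -
    have "(\<lambda>i. e * (1/2)^Suc i) sums (e * 1)"
      by (intro sums_mult power_half_series)
    then show ?thesis unfolding \<epsilon>_def using \<open>0 < e\<close> by (intro suminf_ennreal_eq) auto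
  qed
  finally show "outer (\<Union>i. A i) \<le> (\<Sum>i. outer (A i)) + ennreal e" .
qed

lemma outer_empty: "outer {} = 0"
  by (rule outer_outside) simp

lemma outer_measure_space_outer: "outer_measure_space UNIV outer"
  unfolding outer_measure_space_def positive_def increasing_def countably_subadditive_def
  using outer_mono outer_countably_subadditive outer_empty by auto

lemma outer_Un: "outer (A \<union> B) \<le> outer A + outer B"
proof -
  have "outer (A \<union> B) = outer (\<Union>i. binaryset A B i)" by (simp add: UN_binaryset_eq)
  also have "\<dots> \<le> (\<Sum>i. outer (binaryset A B i))" by (rule outer_countably_subadditive)
  also have "\<dots> = outer A + outer B" by (rule suminf_binaryset_eq) (rule outer_empty)
  finally show ?thesis .
qed

text \<open>The functions \<open>h k = min 1 (k d(x, - U))\<close> increase to the indicator of \<open>U\<close>, so a cover \<open>f\<close> of \<open>A\<close>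
  splits into the pieces \<open>f n (h (k + 1) - h k)\<close>, which together cover \<open>A \<inter> U\<close>, and for
  every \<open>m\<close> the functions \<open>f n (1 - h m)\<close> still cover \<open>A - U\<close>. The first \<open>m\<close> telescoping pieces and
  the latter functions add up to \<open>f\<close>, so the two prices fit into the price of \<open>f\<close>.\<close>
lemma open_outer_measurable:
  assumes "open U"
  shows "outer (A \<inter> U) + outer (A - U) \<le> outer A"
proof (cases "U = UNIV")
  case True then show ?thesis by (simp add: outer_empty)
next
  case False
  define h where "h k x = min 1 (real k * infdist x (- U))" for k :: nat and x
  have h: "0 \<le> h k x" "h k x \<le> 1" "h k x \<le> h (Suc k) x" "h 0 x = 0" for k x
    by (auto simp: h_def infdist_nonneg min_le_iff_disj mult_right_mono)
  have h_cont: "continuous_on UNIV (h k)" for k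
    unfolding h_def by (intro continuous_intros)
  have h_out: "h k x = 0" if "x \<notin> U" for k x
    using that by (simp add: h_def)
  have h_lim: "(\<lambda>k. h (Suc k) x - h k x) sums 1" if "x \<in> U" for x
  proof -
    have "infdist x (- U) > 0"
      using that False assms infdist_pos_not_in_closed[of "- U" x] by auto
    then obtain N where N: "1 / infdist x (- U) < real N" using reals_Archimedean2 by blast
    have "h k x = 1" if "k \<ge> N" for k
    proof -
      have "1 < real N * infdist x (- U)"
        using N \<open>infdist x (- U) > 0\<close> by (simp add: divide_less_eq)
      also have "\<dots> \<le> real k * infdist x (- U)" using that by (simp add: infdist_nonneg mult_right_mono)
      finally show ?thesis by (simp add: h_def)
    qed
    then have "(\<lambda>k. h k x) \<longlonglongrightarrow> 1" 
      by (intro tendsto_eventually) (auto simp: eventually_sequentially)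
    from telescope_sums[OF this] show ?thesis using h(4) by simp
  qed
  show ?thesis
    unfolding outer_def[of A]
  proof (rule INF_greatest)
    fix f assume f: "f \<in> covers A"
    then have fc[simp]: "\<And>n. continuous_on UNIV (f n)" and fp: "\<And>n x. 0 \<le> f n x"
      and fA: "\<And>x. x \<in> A \<Longrightarrow> x \<in> Q \<Longrightarrow> 1 \<le> (\<Sum>n. ennreal (f n x))" by (auto simp: covers_def)
    define g where "g k n x = f n x * (h (Suc k) x - h k x)" for k n x
    have gc: "continuous_on UNIV (g k n)" for k n
      unfolding g_def using h_cont by (intro continuous_intros fc) auto
    have gp: "0 \<le> g k n x" for k n x using fp h by (simp add: g_def)
    have 1: "outer (A \<inter> U) \<le> (\<Sum>k. \<Sum>n. ennreal (\<Lambda> (g k n)))"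
    proof (rule outer_le_double[OF gc gp])
      fix x assume x: "x \<in> A \<inter> U" "x \<in> Q"
      have "(\<Sum>k. \<Sum>n. ennreal (g k n x)) = (\<Sum>k. (\<Sum>n. ennreal (f n x)) * ennreal (h (Suc k) x - h k x))"
        using fp h by (simp add: g_def ennreal_mult ennreal_suminf_multc)
      also have "\<dots> = (\<Sum>n. ennreal (f n x)) * (\<Sum>k. ennreal (h (Suc k) x - h k x))"
        by simp
      also have "(\<Sum>k. ennreal (h (Suc k) x - h k x)) = ennreal 1"
        by (rule suminf_ennreal_eq) (use h(3) h_lim x in \<open>simp_all only: diff_ge_0_iff_ge Int_iff\<close>)
      finally have "(\<Sum>k. \<Sum>n. ennreal (g k n x)) = (\<Sum>n. ennreal (f n x))" 
        by (simp only: ennreal_1 mult_1_right)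
      then show "1 \<le> (\<Sum>k. \<Sum>n. ennreal (g k n x))" using fA x by (simp only: Int_iff)
    qed
    have "(\<Sum>k. \<Sum>n. ennreal (\<Lambda> (g k n))) + outer (A - U) \<le> (\<Sum>n. ennreal (\<Lambda> (f n)))"
    proof (rule ennreal_suminf_bound_add)
      fix m
      have L0: "0 \<le> \<Lambda> (g k n)" for k n using gp by (intro nonneg gc) auto
      have fh: "continuous_on UNIV (\<lambda>x. f n x * h m x)" for n
        using h_cont by (intro continuous_intros fc) auto
      have fh': "continuous_on UNIV (\<lambda>x. f n x * (1 - h m x))" for n
        using h_cont by (intro continuous_intros fc) auto
      have eq: "(\<Sum>k<m. \<Lambda> (g k n)) = \<Lambda> (\<lambda>x. f n x * h m x)" for n
      proof -
        have "(\<lambda>x. \<Sum>k<m. g k n x) = (\<lambda>x. f n x * h m x)"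
          using sum_lessThan_telescope[of "\<lambda>k. h k _" m] h(4)
          by (auto simp: g_def sum_distrib_left[symmetric])
        then show ?thesis using functional_sum[of "\<lambda>k. g k n" m, OF gc] by simp
      qed
      have "(\<Sum>k<m. \<Sum>n. ennreal (\<Lambda> (g k n))) = (\<Sum>n. \<Sum>k<m. ennreal (\<Lambda> (g k n)))"
        by (intro suminf_sum[symmetric]) auto
      also have "\<dots> = (\<Sum>n. ennreal (\<Lambda> (\<lambda>x. f n x * h m x)))"
        using L0 by (simp add: eq)
      finally have a: "(\<Sum>k<m. \<Sum>n. ennreal (\<Lambda> (g k n))) = \<dots>" .
      have b: "outer (A - U) \<le> (\<Sum>n. ennreal (\<Lambda> (\<lambda>x. f n x * (1 - h m x))))"
        using fh' fp h fA h_out by (intro outer_le) (auto simp: covers_def)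
      have c: "\<Lambda> (f n) = \<Lambda> (\<lambda>x. f n x * h m x) + \<Lambda> (\<lambda>x. f n x * (1 - h m x))" for n
        using additive[OF fh fh', of n n] by (simp add: algebra_simps)
      have "0 \<le> \<Lambda> (\<lambda>x. f n x * h m x)" "0 \<le> \<Lambda> (\<lambda>x. f n x * (1 - h m x))" for n
        using fp h by (auto intro!: nonneg fh fh')
      then have "(\<Sum>n. ennreal (\<Lambda> (f n))) = (\<Sum>n. ennreal (\<Lambda> (\<lambda>x. f n x * h m x))) +
          (\<Sum>n. ennreal (\<Lambda> (\<lambda>x. f n x * (1 - h m x))))"
        by (subst suminf_add) (auto simp: c)
      then show "(\<Sum>k<m. \<Sum>n. ennreal (\<Lambda> (g k n))) + outer (A - U) \<le> (\<Sum>n. ennreal (\<Lambda> (f n)))"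
        using a b by (simp add: add_left_mono)
    qed
    then show "outer (A \<inter> U) + outer (A - U) \<le> (\<Sum>n. ennreal (\<Lambda> (f n)))"
      using 1 by (meson add_right_mono order_trans)
  qed
qed

definition riesz_measure :: "'a measure" where
  "riesz_measure = measure_of UNIV (sets borel) outer"

lemma sets_riesz_measure[simp, measurable_cong]: "sets riesz_measure = sets borel"
  using sets.sets_measure_of_eq[of "borel :: 'a measure"] by (simp add: riesz_measure_def)

lemma space_riesz_measure[simp]: "space riesz_measure = UNIV"
  by (simp add: riesz_measure_def)

lemma emeasure_riesz_measure: "A \<in> sets borel \<Longrightarrow> emeasure riesz_measure A = outer A"
proof -
  assume A: "A \<in> sets borel"
  let ?L = "lambda_system UNIV UNIV outer"
  have *: "measure_space UNIV ?L outer"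
    using sigma_algebra.caratheodory_lemma[OF sigma_algebra_Pow outer_measure_space_outer[folded Pow_UNIV]]
    by simp
  have "{S. open S} \<subseteq> ?L"
  proof
    fix U :: "'a set" assume "U \<in> {S. open S}"
    then have "outer (A \<inter> U) + outer (A - U) = outer A" for A
      using open_outer_measurable[of U A] outer_Un[of "A \<inter> U" "A - U"]
      by (simp add: Un_Diff_Int sup_commute)
    then show "U \<in> ?L"
      by (simp add: lambda_system_def) (metis Compl_eq_Diff_UNIV Diff_eq inf_commute)
  qed
  then have "sets borel \<subseteq> ?L"
    using * unfolding borel_def measure_space_def
    by (simp add: sigma_algebra.sigma_sets_subset)
  moreover have "sigma_algebra UNIV (sets (borel :: 'a measure))"
    using sets.sigma_algebra_axioms[of "borel :: 'a measure"] by simp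
  moreover from this have "sigma_sets UNIV (sets (borel :: 'a measure)) = sets borel"
    by (rule sigma_algebra.sigma_sets_eq)
  ultimately have "measure_space UNIV (sets borel) outer"
    using measure_down[OF *] by blast
  then show ?thesis
    unfolding riesz_measure_def using A \<open>sigma_algebra UNIV (sets borel)\<close>
    by (subst emeasure_measure_of_sigma) (auto simp: measure_space_def)
qed

lemma emeasure_riesz_measure_outside: "emeasure riesz_measure (- Q) = 0"
  using compact_support by (subst emeasure_riesz_measure) (auto intro: outer_outside borel_comp borel_compact)

text \<open>This is where compactness enters: the partial sums of a cover exceed \<open>1 - e\<close> on increasing
  open sets, so a single finite partial sum exceeds \<open>1 - e\<close> on all of \<open>Q\<close>, and monotonicity of the
  functional applies to that finite sum.\<close>
lemma emeasure_riesz_measure_UNIV: "emeasure riesz_measure UNIV = ennreal (\<Lambda> (\<lambda>x. 1))"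
proof -
  have "ennreal (\<Lambda> (\<lambda>x. 1)) \<le> outer UNIV"
    unfolding outer_def
  proof (rule INF_greatest)
    fix f assume f: "f \<in> covers UNIV"
    then have fc: "\<And>n. continuous_on UNIV (f n)" and fp: "\<And>n x. 0 \<le> f n x"
      and fA: "\<And>x. x \<in> Q \<Longrightarrow> 1 \<le> (\<Sum>n. ennreal (f n x))" by (auto simp: covers_def)
    have step: "ennreal ((1 - e) * \<Lambda> (\<lambda>x. 1)) \<le> (\<Sum>n. ennreal (\<Lambda> (f n)))" if e: "0 < e" "e < 1" for e :: real
    proof -
      have ps: "continuous_on UNIV (\<lambda>x. \<Sum>n<N. f n x)" for N
        using fc by (intro continuous_intros)
      define W where "W N = {x. 1 - e < (\<Sum>n<N. f n x)}" for N
      have "open (W N)" for N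
        unfolding W_def by (intro open_Collect_less continuous_on_const ps)
      moreover have "Q \<subseteq> (\<Union>N. W N)"
      proof
        fix x assume "x \<in> Q"
        have "\<exists>N. ennreal (1 - e) < (\<Sum>n<N. ennreal (f n x))"
        proof (rule ccontr)
          assume "\<nexists>N. ennreal (1 - e) < (\<Sum>n<N. ennreal (f n x))"
          then have "(\<Sum>n. ennreal (f n x)) \<le> ennreal (1 - e)"
            by (intro suminf_le_const[OF summableI]) (auto simp: not_less)
          also have "\<dots> < 1" using e by (simp add: ennreal_less_one_iff)
          finally show False using fA[OF \<open>x \<in> Q\<close>] by simp
        qed
        then show "x \<in> (\<Union>N. W N)"
          using fp e by (auto simp: W_def ennreal_less_iff)
      qed
      moreover have "W N \<subseteq> W M" if "N \<le> M" for N M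
      proof -
        have "(\<Sum>n<N. f n x) \<le> (\<Sum>n<M. f n x)" for x
          using that fp by (intro sum_mono2) auto
        then show ?thesis unfolding W_def by (auto intro: less_le_trans)
      qed
      ultimately obtain N where N: "Q \<subseteq> W N"
      proof -
        obtain I where I: "finite I" "Q \<subseteq> (\<Union>N\<in>I. W N)"
          using compactE_image[OF compact_support, of UNIV W] \<open>\<And>N. open (W N)\<close> \<open>Q \<subseteq> (\<Union>N. W N)\<close>
          by metis
        have "W N \<subseteq> W (Max I)" if "N \<in> I" for N
          using I that \<open>\<And>N M. N \<le> M \<Longrightarrow> W N \<subseteq> W M\<close> by simp
        then show ?thesis using I that by blast
      qed
      have "(1 - e) * \<Lambda> (\<lambda>x. 1) = \<Lambda> (\<lambda>x. (1 - e) * 1)"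
        by (rule homogeneous[symmetric]) auto
      also have "\<dots> \<le> \<Lambda> (\<lambda>x. \<Sum>n<N. f n x)"
        using N by (intro functional_mono ps) (auto simp: W_def intro: less_imp_le)
      also have "\<dots> = (\<Sum>n<N. \<Lambda> (f n))" by (rule functional_sum[OF fc])
      finally have "ennreal ((1 - e) * \<Lambda> (\<lambda>x. 1)) \<le> ennreal (\<Sum>n<N. \<Lambda> (f n))"
        by (rule ennreal_leI)
      also have "\<dots> = (\<Sum>n<N. ennreal (\<Lambda> (f n)))"
        using fc fp by (intro sum_ennreal[symmetric] nonneg) auto
      also have "\<dots> \<le> (\<Sum>n. ennreal (\<Lambda> (f n)))"
        by (intro sum_le_suminf) auto
      finally show ?thesis .
    qed
    have "((\<lambda>e. ennreal ((1 - e) * \<Lambda> (\<lambda>x. 1))) \<longlongrightarrow> ennreal ((1 - 0) * \<Lambda> (\<lambda>x. 1))) (at_right 0)"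
      by (intro tendsto_intros tendsto_ennrealI)
    moreover have "\<forall>\<^sub>F e in at_right 0. ennreal ((1 - e) * \<Lambda> (\<lambda>x. 1)) \<le> (\<Sum>n. ennreal (\<Lambda> (f n)))"
      unfolding eventually_at_right_field using step by (intro exI[of _ 1]) auto
    ultimately have "ennreal ((1 - 0) * \<Lambda> (\<lambda>x. 1)) \<le> (\<Sum>n. ennreal (\<Lambda> (f n)))"
      by (rule tendsto_upperbound) simp
    then show "ennreal (\<Lambda> (\<lambda>x. 1)) \<le> (\<Sum>n. ennreal (\<Lambda> (f n)))" by simp
  qed
  then show ?thesis using outer_finite[of UNIV] by (simp add: emeasure_riesz_measure)
qed

lemma finite_riesz_measure: "finite_measure riesz_measure"
  by (rule finite_measureI) (simp add: emeasure_riesz_measure_UNIV)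

text \<open>Cut \<open>N f\<close> into the slices \<open>\<phi> k\<close> of height 1. The slice \<open>\<phi> k\<close> alone covers the
  set \<open>C k\<close> where \<open>N f\<close> is at least \<open>k + 1\<close>, which bounds the measure of \<open>C k\<close>, and \<open>N f\<close> is at most
  one plus the sum of the indicators of the \<open>C k\<close>. The excess is one slice, that is \<open>1 / N\<close> of the
  total mass, and it vanishes in the limit.\<close>
lemma integral_riesz_le:
  assumes fc: "continuous_on UNIV f" and f: "\<And>x. 0 \<le> f x" "\<And>x. f x \<le> 1"
  shows "(\<integral>x. f x \<partial>riesz_measure) \<le> \<Lambda> f"
proof -
  interpret finite_measure riesz_measure by (rule finite_riesz_measure)
  have fm: "f \<in> borel_measurable borel" using fc by (rule borel_measurable_continuous_onI)
  have bound: "(\<integral>x. f x \<partial>riesz_measure) \<le> \<Lambda> (\<lambda>x. 1) / real N + \<Lambda> f" if N: "N > 0" for N :: nat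
  proof -
    define \<phi> where "\<phi> k x = min 1 (max 0 (real N * f x - real k))" for k :: nat and x
    define C where "C k = {x. real k + 1 \<le> real N * f x}" for k :: nat
    have \<phi>c: "continuous_on UNIV (\<phi> k)" for k
      unfolding \<phi>_def using fc by (intro continuous_intros)
    have C: "C k \<in> sets borel" for k
      unfolding C_def using fm by measurable
    have sum: "(\<Sum>k<M. min 1 (max 0 (t - real k))) = min t (real M)" if "0 \<le> t" for t M
      using that by (induction M) auto
    have s\<phi>: "(\<Sum>k<N. \<phi> k x) = real N * f x" for x
    proof -
      have "real N * f x \<le> real N * 1" using f by (intro mult_left_mono) auto
      then show ?thesis using sum[of "real N * f x" N] f(1)[of x] by (simp add: \<phi>_def)
    qed
    have "real N * f x \<le> 1 + (\<Sum>k<N. indicator (C k) x)" for x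
    proof -
      obtain N' where N': "N = Suc N'" using N by (cases N) auto
      have "real N * f x = \<phi> 0 x + (\<Sum>k<N'. \<phi> (Suc k) x)"
        using s\<phi>[of x] unfolding N' sum.lessThan_Suc_shift by simp
      also have "\<dots> \<le> 1 + (\<Sum>k<N'. indicator (C k) x)"
        by (intro add_mono sum_mono) (auto simp: \<phi>_def C_def indicator_def)
      also have "\<dots> \<le> 1 + (\<Sum>k<N. indicator (C k) x)" by (simp add: N')
      finally show ?thesis .
    qed
    then have "(\<integral>x. real N * f x \<partial>riesz_measure) \<le> (\<integral>x. 1 + (\<Sum>k<N. indicator (C k) x) \<partial>riesz_measure)"
      using fm f C
      by (intro integral_mono Bochner_Integration.integrable_add integrable_const
          Bochner_Integration.integrable_sum integrable_real_indicator
          integrable_mult_right integrable_const_bound[of f 1])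
        (auto simp: less_top[symmetric])
    also have "\<dots> = measure riesz_measure UNIV + (\<Sum>k<N. measure riesz_measure (C k))"
      using C by (subst Bochner_Integration.integral_add)
        (auto intro!: Bochner_Integration.integrable_sum integrable_real_indicator
          simp: less_top[symmetric] Bochner_Integration.integral_sum)
    also have "measure riesz_measure UNIV = \<Lambda> (\<lambda>x. 1)"
      by (simp add: measure_def emeasure_riesz_measure_UNIV nonneg)
    also have "measure riesz_measure (C k) \<le> \<Lambda> (\<phi> k)" for k
    proof -
      have "emeasure riesz_measure (C k) \<le> ennreal (\<Lambda> (\<phi> k))"
        unfolding emeasure_riesz_measure[OF C]
        by (rule outer_le_single[OF \<phi>c]) (auto simp: \<phi>_def C_def)
      moreover have "0 \<le> \<Lambda> (\<phi> k)" by (intro nonneg \<phi>c) (auto simp: \<phi>_def)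
      ultimately show ?thesis by (simp add: emeasure_eq_measure)
    qed
    then have "(\<Sum>k<N. measure riesz_measure (C k)) \<le> (\<Sum>k<N. \<Lambda> (\<phi> k))" by (rule sum_mono)
    also have "\<dots> = \<Lambda> (\<lambda>x. real N * f x)"
      using functional_sum[of \<phi> N, OF \<phi>c] by (simp add: s\<phi>)
    also have "\<dots> = real N * \<Lambda> f" by (rule homogeneous[OF fc])
    finally have "real N * (\<integral>x. f x \<partial>riesz_measure) \<le> \<Lambda> (\<lambda>x. 1) + real N * \<Lambda> f" by simp
    then show ?thesis using N by (simp add: field_simps)
  qed
  have "(\<lambda>N. \<Lambda> (\<lambda>x. 1) / real N + \<Lambda> f) \<longlonglongrightarrow> 0 + \<Lambda> f"
    by (intro tendsto_intros lim_const_over_n)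
  then show ?thesis
    using bound by (intro LIMSEQ_le_const[where X="\<lambda>N. \<Lambda> (\<lambda>x. 1) / real N + \<Lambda> f"]) (auto intro: exI[of _ 1])
qed

text \<open>The reverse inequality is \<open>integral_riesz_le\<close> for \<open>1 - f\<close>, as the total masses agree.\<close>
lemma integral_riesz_unit:
  assumes fc: "continuous_on UNIV f" and f: "\<And>x. 0 \<le> f x" "\<And>x. f x \<le> 1"
  shows "(\<integral>x. f x \<partial>riesz_measure) = \<Lambda> f"
proof -
  interpret finite_measure riesz_measure by (rule finite_riesz_measure)
  have fm: "f \<in> borel_measurable borel" using fc by (rule borel_measurable_continuous_onI)
  have "(\<integral>x. 1 - f x \<partial>riesz_measure) \<le> \<Lambda> (\<lambda>x. 1 - f x)"
    using f by (intro integral_riesz_le continuous_intros fc) auto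
  also have "\<dots> = \<Lambda> (\<lambda>x. 1) - \<Lambda> f" by (intro functional_diff fc) auto
  also have "(\<integral>x. 1 - f x \<partial>riesz_measure) = measure riesz_measure UNIV - (\<integral>x. f x \<partial>riesz_measure)"
    using f fm by (subst Bochner_Integration.integral_diff) (auto intro!: integrable_const_bound[where B=1])
  also have "measure riesz_measure UNIV = \<Lambda> (\<lambda>x. 1)"
    by (simp add: measure_def emeasure_riesz_measure_UNIV nonneg)
  finally show ?thesis using integral_riesz_le[OF assms] by simp
qed

theorem integral_riesz_measure:
  assumes fc: "continuous_on UNIV f"
  shows "(\<integral>x. f x \<partial>riesz_measure) = \<Lambda> f"
proof -
  interpret finite_measure riesz_measure by (rule finite_riesz_measure)
  have fm: "f \<in> borel_measurable borel" using fc by (rule borel_measurable_continuous_onI)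
  have "compact (f ` Q)" using compact_support continuous_on_subset[OF fc, of Q] compact_continuous_image by blast
  then obtain B where B: "B > 0" "\<And>x. x \<in> Q \<Longrightarrow> \<bar>f x\<bar> \<le> B"
    using compact_imp_bounded[of "f ` Q"] unfolding bounded_pos by auto
  define g where "g x = min 1 (max 0 ((f x + B) / (2 * B)))" for x
  have gc: "continuous_on UNIV g" unfolding g_def using fc B by (intro continuous_intros) auto
  have gf: "f x = 2 * B * g x - B * 1" if "x \<in> Q" for x
    using B(2)[OF that] \<open>B > 0\<close> by (auto simp: g_def field_simps min_def max_def abs_le_iff)
  have "\<Lambda> f = \<Lambda> (\<lambda>x. 2 * B * g x - B * 1)"
    by (rule functional_cong) (intro fc continuous_intros gc gf; assumption)+
  also have "\<dots> = 2 * B * \<Lambda> g - B * \<Lambda> (\<lambda>x. 1)"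
    using functional_diff[of "\<lambda>x. 2 * B * g x" "\<lambda>x. B * 1"] gc homogeneous[OF gc, of "2 * B"]
      homogeneous[of "\<lambda>x. 1" B] by (simp add: continuous_on_mult_const continuous_on_mult_left)
  also have "\<Lambda> g = (\<integral>x. g x \<partial>riesz_measure)"
    by (rule integral_riesz_unit[symmetric, OF gc]) (auto simp: g_def)
  also have "\<Lambda> (\<lambda>x. 1) = (\<integral>x. 1 \<partial>riesz_measure)"
    by (rule integral_riesz_unit[symmetric]) auto
  also have "2 * B * (\<integral>x. g x \<partial>riesz_measure) - B * (\<integral>x. 1 \<partial>riesz_measure)
      = (\<integral>x. 2 * B * g x - B * 1 \<partial>riesz_measure)"
  proof -
    have "\<bar>g x\<bar> \<le> 1" for x by (simp add: g_def)
    then have "integrable riesz_measure g"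
      using borel_measurable_continuous_onI[OF gc] by (intro integrable_const_bound[where B=1]) auto
    then show ?thesis by simp
  qed
  also have "\<dots> = (\<integral>x. f x \<partial>riesz_measure)"
  proof (rule integral_cong_AE)
    have "AE x in riesz_measure. x \<in> Q"
      using emeasure_riesz_measure_outside compact_support
      by (intro AE_I[of _ _ "- Q"]) (auto intro: borel_comp borel_compact)
    then show "AE x in riesz_measure. 2 * B * g x - B * 1 = f x" by eventually_elim (simp add: gf)
  qed (use fm borel_measurable_continuous_onI[OF gc] in auto)
  finally show ?thesis by simp
qed

end

section \<open>Induction over bounded Borel functions\<close>

text \<open>Boundedness and pointwise convergence are required on a carrier set \<open>Q\<close> only, while measurability
  is global. In this way one function can serve for the operator on the direct integral and for all
  fibre operators, whose spectra are various subsets of \<open>Q\<close>.\<close>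

definition admissible :: "'a measure \<Rightarrow> 'a set \<Rightarrow> ('a \<Rightarrow> complex) \<Rightarrow> bool" where
  "admissible M Q f \<longleftrightarrow> f \<in> borel_measurable M \<and> bounded (f ` Q)"

definition bounded_limit :: "'a measure \<Rightarrow> 'a set \<Rightarrow> (nat \<Rightarrow> 'a \<Rightarrow> complex) \<Rightarrow> ('a \<Rightarrow> complex) \<Rightarrow> bool" where
  "bounded_limit M Q F f \<longleftrightarrow> (\<forall>n. F n \<in> borel_measurable M) \<and> f \<in> borel_measurable M \<and>
     (\<exists>B. \<forall>n. \<forall>x\<in>Q. cmod (F n x) \<le> B) \<and> (\<forall>x\<in>Q. (\<lambda>n. F n x) \<longlonglongrightarrow> f x)"

lemma admissibleD: "admissible M Q f \<Longrightarrow> f \<in> borel_measurable M" "admissible M Q f \<Longrightarrow> bounded (f ` Q)"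
  by (simp_all add: admissible_def)

lemma admissible_bound: assumes "admissible M Q f" obtains B where "0 \<le> B" "\<And>l. l \<in> Q \<Longrightarrow> cmod (f l) \<le> B"
proof -
  obtain B where B: "\<forall>l\<in>Q. cmod (f l) \<le> B" using assms by (auto simp: admissible_def bounded_iff)
  show ?thesis by (rule that[of "max B 0"]) (use B in \<open>auto simp: le_max_iff_disj\<close>)
qed

lemma admissibleI: "f \<in> borel_measurable M \<Longrightarrow> (\<And>l. l \<in> Q \<Longrightarrow> cmod (f l) \<le> B) \<Longrightarrow> admissible M Q f"
  by (auto simp: admissible_def bounded_iff)

lemma admissible_add: "admissible M Q f \<Longrightarrow> admissible M Q g \<Longrightarrow> admissible M Q (\<lambda>l. f l + g l)"
  by (auto simp: admissible_def intro: bounded_plus_comp)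

lemma admissible_mult: assumes "admissible M Q f" "admissible M Q g" shows "admissible M Q (\<lambda>l. f l * g l)"
proof -
  obtain B where B: "0 \<le> B" "\<And>l. l \<in> Q \<Longrightarrow> cmod (f l) \<le> B" using admissible_bound[OF assms(1)] by blast
  obtain C where C: "0 \<le> C" "\<And>l. l \<in> Q \<Longrightarrow> cmod (g l) \<le> C" using admissible_bound[OF assms(2)] by blast
  show ?thesis
  proof (rule admissibleI)
    show "(\<lambda>l. f l * g l) \<in> borel_measurable M" using assms by (auto simp: admissible_def)
    show "cmod (f l * g l) \<le> B * C" if "l \<in> Q" for l
      unfolding norm_mult using B C that by (intro mult_mono) auto
  qed
qed

lemma admissible_const: "admissible M Q (\<lambda>l. c)"
  by (rule admissibleI[where B="cmod c"]) auto

lemma admissible_scale: "admissible M Q f \<Longrightarrow> admissible M Q (\<lambda>l. c * f l)"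
  by (rule admissible_mult[OF admissible_const])

lemma admissible_indicator: "A \<in> sets M \<Longrightarrow> admissible M Q (indicator A)"
  by (rule admissibleI[where B=1]) (auto simp: indicator_def)

lemma cnj_borel_measurable: "cnj \<in> borel_measurable borel"
  by (intro borel_measurable_continuous_onI continuous_on_cnj continuous_on_id)

lemma admissible_cnj: "admissible M Q f \<Longrightarrow> admissible M Q (\<lambda>l. cnj (f l))"
  using measurable_compose[OF _ cnj_borel_measurable, of f M] by (auto simp: admissible_def bounded_iff)

lemma admissible_id: "bounded Q \<Longrightarrow> admissible borel Q (\<lambda>l. l)"
  by (simp add: admissible_def)

lemma bounded_limitI:
  assumes "\<And>n. F n \<in> borel_measurable M" "f \<in> borel_measurable M"
    "\<And>n x. x \<in> Q \<Longrightarrow> cmod (F n x) \<le> B" "\<And>x. x \<in> Q \<Longrightarrow> (\<lambda>n. F n x) \<longlonglongrightarrow> f x"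
  shows "bounded_limit M Q F f"
  using assms unfolding bounded_limit_def by blast

lemma bounded_limit_bound:
  assumes "bounded_limit M Q F f"
  shows "\<exists>B\<ge>0. (\<forall>n. \<forall>x\<in>Q. cmod (F n x) \<le> B) \<and> (\<forall>x\<in>Q. cmod (f x) \<le> B)"
proof -
  obtain B where B: "\<And>n x. x \<in> Q \<Longrightarrow> cmod (F n x) \<le> B" using assms unfolding bounded_limit_def by blast
  have "cmod (f x) \<le> B" if "x \<in> Q" for x
    by (rule LIMSEQ_le_const2[OF tendsto_norm[of "\<lambda>n. F n x"]]) (use assms B that in \<open>auto simp: bounded_limit_def\<close>)
  then show ?thesis using B by (intro exI[of _ "max B 0"]) (auto simp: le_max_iff_disj)
qed

lemma bounded_limit_tendsto: "bounded_limit M Q F f \<Longrightarrow> x \<in> Q \<Longrightarrow> (\<lambda>n. F n x) \<longlonglongrightarrow> f x"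
  by (simp add: bounded_limit_def)

lemma bounded_limit_admissible:
  assumes "bounded_limit M Q F f" shows "admissible M Q (F n)" "admissible M Q f"
proof -
  obtain B where "\<forall>n. \<forall>x\<in>Q. cmod (F n x) \<le> B" "\<forall>x\<in>Q. cmod (f x) \<le> B"
    using bounded_limit_bound[OF assms] by blast
  then show "admissible M Q (F n)" "admissible M Q f"
    using assms by (auto simp: bounded_limit_def intro: admissibleI[of _ _ _ B])
qed

lemma bounded_limit_mult:
  assumes F: "bounded_limit M Q F f" and h: "admissible M Q h"
  shows "bounded_limit M Q (\<lambda>n l. h l * F n l) (\<lambda>l. h l * f l)"
proof -
  obtain B where B: "0 \<le> B" "\<forall>n. \<forall>l\<in>Q. cmod (F n l) \<le> B" using bounded_limit_bound[OF F] by blast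
  obtain C where C: "0 \<le> C" "\<And>l. l \<in> Q \<Longrightarrow> cmod (h l) \<le> C" using admissible_bound[OF h] by blast
  show ?thesis
  proof (rule bounded_limitI)
    show "cmod (h l * F n l) \<le> C * B" if "l \<in> Q" for n l
      unfolding norm_mult using B C that by (intro mult_mono) auto
    show "(\<lambda>n. h l * F n l) \<longlonglongrightarrow> h l * f l" if "l \<in> Q" for l
      by (intro tendsto_mult_left bounded_limit_tendsto[OF F that])
  qed (use F h in \<open>auto simp: bounded_limit_def admissible_def intro!: borel_measurable_times\<close>)
qed

text \<open>Measurable functions are pointwise limits of simple functions bounded by twice the absolute value
  of the function; the hypotheses lead from indicators to simple functions.\<close>
lemma bounded_measurable_induct:
  fixes P :: "('a \<Rightarrow> complex) \<Rightarrow> bool"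
  assumes Q: "Q \<subseteq> space M"
    and indicator: "\<And>A. A \<in> sets M \<Longrightarrow> P (indicator A)"
    and add: "\<And>f g. \<lbrakk>admissible M Q f; P f; admissible M Q g; P g\<rbrakk> \<Longrightarrow> P (\<lambda>x. f x + g x)"
    and scale: "\<And>c f. \<lbrakk>admissible M Q f; P f\<rbrakk> \<Longrightarrow> P (\<lambda>x. c * f x)"
    and lim: "\<And>F f. \<lbrakk>bounded_limit M Q F f; \<And>n. P (F n)\<rbrakk> \<Longrightarrow> P f"
    and f: "admissible M Q f"
  shows "P f"
proof -
  have simple: "admissible M Q (\<lambda>x. \<Sum>y\<in>Y. y * indicator (S y) x) \<and> P (\<lambda>x. \<Sum>y\<in>Y. y * indicator (S y) x)"
    if "finite Y" "\<And>y. S y \<in> sets M" for Y and S :: "complex \<Rightarrow> 'a set"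
    using that(1)
  proof (induction Y)
    case empty
    show ?case using indicator[of "{}"] by (simp add: indicator_def[abs_def] admissible_const)
  next
    case (insert a Y)
    have a: "admissible M Q (indicator (S a))" by (rule admissible_indicator[OF that(2)])
    show ?case
      unfolding sum.insert[OF insert.hyps]
      using insert.IH by (intro conjI add admissible_add admissible_scale a scale indicator that(2)) auto
  qed
  obtain F where F: "\<And>i. simple_function M (F i)"
      "\<And>x. x \<in> space M \<Longrightarrow> (\<lambda>i. F i x) \<longlonglongrightarrow> f x"
      "\<And>i x. x \<in> space M \<Longrightarrow> dist (F i x) 0 \<le> 2 * dist (f x) 0"
    using borel_measurable_implies_sequence_metric[OF admissibleD(1)[OF f], of 0] by blast
  define G where "G i x = (\<Sum>y\<in>F i ` space M. y * indicator (F i -` {y} \<inter> space M) x)" for i x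
  have GF: "G i x = F i x" if "x \<in> space M" for i x
  proof -
    have "G i x = (\<Sum>y\<in>F i ` space M. if y = F i x then y else 0)"
      unfolding G_def by (intro sum.cong) (use that in \<open>auto simp: indicator_def\<close>)
    then show ?thesis using simple_functionD(1)[OF F(1)[of i]] that by simp
  qed
  have G: "admissible M Q (G n) \<and> P (G n)" for n
    unfolding G_def by (rule simple) (use simple_functionD[OF F(1)[of n]] in auto)
  obtain B where B: "\<And>x. x \<in> Q \<Longrightarrow> norm (f x) \<le> B" using admissible_bound[OF f] by blast
  have "bounded_limit M Q G f"
  proof (rule bounded_limitI)
    show "cmod (G n x) \<le> 2 * B" if "x \<in> Q" for n x
      using F(3)[of x n] B[OF that] GF[of x n] Q that by auto
    show "(\<lambda>n. G n x) \<longlonglongrightarrow> f x" if "x \<in> Q" for x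
      using F(2)[of x] GF Q that by auto
  qed (use G f in \<open>auto dest: admissibleD\<close>)
  then show ?thesis by (rule lim) (use G in blast)
qed

text \<open>From polynomials to continuous functions by Stone-Weierstrass on the compact closure of \<open>Q\<close>,
  to indicators of closed sets as decreasing limits of continuous functions, to indicators of
  Borel sets by the \<open>\<pi>\<close>-\<open>\<lambda>\<close> theorem, and to bounded Borel functions by \<open>bounded_measurable_induct\<close>.\<close>
lemma bounded_borel_induct_polynomial:
  fixes P :: "(complex \<Rightarrow> complex) \<Rightarrow> bool"
  assumes Q: "bounded Q"
    and poly: "\<And>p. real_polynomial_function p \<Longrightarrow> P (\<lambda>l. of_real (p l))"
    and add: "\<And>f g. \<lbrakk>admissible borel Q f; P f; admissible borel Q g; P g\<rbrakk> \<Longrightarrow> P (\<lambda>x. f x + g x)"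
    and scale: "\<And>c f. \<lbrakk>admissible borel Q f; P f\<rbrakk> \<Longrightarrow> P (\<lambda>x. c * f x)"
    and lim: "\<And>F f. \<lbrakk>bounded_limit borel Q F f; \<And>n. P (F n)\<rbrakk> \<Longrightarrow> P f"
    and f: "admissible borel Q f"
  shows "P f"
proof -
  have comp: "compact (closure Q)" using Q by simp
  have cont: "P (\<lambda>l. of_real (g l))" if g: "continuous_on UNIV g" for g :: "complex \<Rightarrow> real"
  proof -
    have "\<exists>p. real_polynomial_function p \<and> (\<forall>l\<in>closure Q. \<bar>g l - p l\<bar> < 1 / real (Suc n))" for n
      using Stone_Weierstrass_real_polynomial_function[OF comp continuous_on_subset[OF g], of "1 / real (Suc n)"]
      by (metis of_nat_0_less_iff subset_UNIV zero_less_Suc zero_less_divide_1_iff)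
    then obtain p where p: "\<And>n. real_polynomial_function (p n)"
        "\<And>n l. l \<in> closure Q \<Longrightarrow> \<bar>g l - p n l\<bar> < 1 / real (Suc n)" by metis
    have "bounded (g ` closure Q)"
      by (intro compact_imp_bounded compact_continuous_image comp continuous_on_subset[OF g]) auto
    then obtain B where B: "\<And>l. l \<in> closure Q \<Longrightarrow> \<bar>g l\<bar> \<le> B"
      unfolding bounded_iff by auto
    have "bounded_limit borel Q (\<lambda>n l. of_real (p n l)) (\<lambda>l. of_real (g l))"
    proof (rule bounded_limitI)
      show "(\<lambda>l. complex_of_real (p n l)) \<in> borel_measurable borel" for n
        using p(1)[of n] by (intro borel_measurable_continuous_onI continuous_intros)
          (simp add: continuous_on_polymonial_function real_polynomial_function_eq)
      show "(\<lambda>l. complex_of_real (g l)) \<in> borel_measurable borel"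
        by (intro borel_measurable_continuous_onI continuous_intros g)
      fix l assume "l \<in> Q"
      then have l: "l \<in> closure Q" using closure_subset by auto
      show "cmod (of_real (p n l)) \<le> B + 1" for n
      proof -
        have "1 / real (Suc n) \<le> 1" by simp
        then show ?thesis unfolding norm_of_real using p(2)[OF l, of n] B[OF l] by linarith
      qed
      have "(\<lambda>n. g l - p n l) \<longlonglongrightarrow> 0"
      proof (rule Lim_null_comparison)
        show "\<forall>\<^sub>F n in sequentially. norm (g l - p n l) \<le> 1 / real (Suc n)"
          using p(2)[OF l] by (intro always_eventually) (auto intro: less_imp_le)
        show "(\<lambda>n. 1 / real (Suc n)) \<longlonglongrightarrow> 0"
          using LIMSEQ_inverse_real_of_nat by (simp add: inverse_eq_divide)
      qed
      from tendsto_diff[OF tendsto_const[of "g l"] this]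
      show "(\<lambda>n. complex_of_real (p n l)) \<longlonglongrightarrow> complex_of_real (g l)" by (intro tendsto_of_real) simp
    qed
    then show ?thesis by (rule lim) (rule poly[OF p(1)])
  qed
  have ind_a: "admissible borel Q (indicator A)" if "A \<in> sets borel" for A
    using that by (rule admissible_indicator)
  have closed: "P (indicator C)" if C: "closed C" for C
  proof (cases "C = {}")
    case True
    then show ?thesis using cont[of "\<lambda>_. 0"] by (simp add: indicator_def[abs_def])
  next
    case False
    define g where "g k l = max 0 (1 - real k * infdist l C)" for k l
    have gc: "continuous_on UNIV (g k)" for k
      unfolding g_def by (intro continuous_intros)
    have "bounded_limit borel Q (\<lambda>n l. of_real (g n l)) (indicator C)"
    proof (rule bounded_limitI)
      show "(\<lambda>l. complex_of_real (g n l)) \<in> borel_measurable borel" for n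
        by (intro borel_measurable_continuous_onI continuous_intros gc)
      show "cmod (of_real (g n l)) \<le> 1" for n l
        by (simp add: g_def infdist_nonneg)
      show "(\<lambda>n. complex_of_real (g n l)) \<longlonglongrightarrow> indicator C l" for l
      proof (cases "l \<in> C")
        case True then show ?thesis by (simp add: g_def)
      next
        case l: False
        then have pos: "infdist l C > 0" using infdist_pos_not_in_closed[OF C False] by auto
        then obtain N where N: "1 / infdist l C < real N" using reals_Archimedean2 by blast
        have "g k l = 0" if "k \<ge> N" for k
        proof -
          have "1 < real N * infdist l C" using N pos by (simp add: divide_less_eq)
          also have "\<dots> \<le> real k * infdist l C" using that by (simp add: infdist_nonneg mult_right_mono)
          finally show ?thesis by (simp add: g_def)
        qed
        then show ?thesis using l
          by (intro tendsto_eventually) (auto simp: eventually_sequentially)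
      qed
    qed (use C in \<open>auto intro: borel_closed\<close>)
    then show ?thesis by (rule lim) (rule cont[OF gc])
  qed
  have ind: "P (indicator A)" if "A \<in> sets borel" for A
  proof -
    have "Int_stable (Collect closed :: complex set set)" by (auto simp: Int_stable_def)
    moreover have "Collect closed \<subseteq> Pow (UNIV :: complex set)" by simp
    moreover have "A \<in> sigma_sets UNIV (Collect closed)"
      using that by (simp add: borel_eq_closed)
    ultimately show ?thesis
    proof (induction rule: sigma_sets_induct_disjoint[consumes 3])
      case (basic A) then show ?case using closed by simp
    next
      case empty show ?case by (rule closed) simp
    next
      case (compl A)
      have A: "A \<in> sets borel" using compl(1) by (simp add: borel_eq_closed)
      have "P (\<lambda>l. indicator UNIV l + (-1) * indicator A l)"
        by (intro add scale compl closed ind_a A admissible_scale) simp_all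
      moreover have "(\<lambda>l. indicator UNIV l + (-1) * indicator A l) = (indicator (UNIV - A) :: complex \<Rightarrow> complex)"
        by (auto simp: indicator_def)
      ultimately show ?case by simp
    next
      case (union A)
      have A: "A n \<in> sets borel" for n using union(2) by (auto simp: borel_eq_closed)
      have fin: "P (indicator (\<Union>i<n. A i))" for n
      proof (induction n)
        case 0 then show ?case using closed[OF closed_empty] by (simp only: lessThan_0 UN_empty)
      next
        case (Suc n)
        have "P (\<lambda>l. indicator (\<Union>i<n. A i) l + indicator (A n) l)"
          using A by (intro add Suc union ind_a) auto
        moreover have "(\<lambda>l. indicator (\<Union>i<n. A i) l + indicator (A n) l) = (indicator (\<Union>i<Suc n. A i) :: complex \<Rightarrow> complex)"
        proof
          fix l
          have "l \<in> A i \<Longrightarrow> l \<in> A n \<Longrightarrow> i < n \<Longrightarrow> False" for i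
            using union(1) by (metis disjoint_family_onD disjoint_iff less_irrefl UNIV_I)
          then show "indicator (\<Union>i<n. A i) l + indicator (A n) l = (indicator (\<Union>i<Suc n. A i) l :: complex)"
            by (auto simp: indicator_def lessThan_Suc)
        qed
        ultimately show ?case by simp
      qed
      have "bounded_limit borel Q (\<lambda>n. indicator (\<Union>i<n. A i)) (indicator (\<Union>i. A i))"
      proof (rule bounded_limitI)
        show "(\<lambda>n. indicator (\<Union>i<n. A i) l) \<longlonglongrightarrow> (indicator (\<Union>i. A i) l :: complex)" for l
          by (rule LIMSEQ_indicator_UN)
        show "cmod (indicator (\<Union>i<n. A i) l) \<le> 1" for n l
          by (auto simp: indicator_def)
      qed (use A in \<open>auto intro!: borel_measurable_indicator\<close>)
      then show ?case by (rule lim) (rule fin)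
    qed
  qed
  show ?thesis
  proof (rule bounded_measurable_induct[where M=borel and Q=Q and P=P and f=f])
    show "P g" if "bounded_limit borel Q F g" "\<And>n. P (F n)" for F g
      using that by (rule lim)
  qed (simp_all add: ind add scale f)
qed

text \<open>Every real polynomial in \<open>Re l\<close> and \<open>Im l\<close> is a complex polynomial in \<open>l\<close> and \<open>cnj l\<close>. The
  polynomial case is therefore replaced by multiplication with \<open>l\<close> and with \<open>cnj l\<close>, which in a
  functional calculus are composition with an operator and with its adjoint: no operator version of
  a polynomial needs to be formed.\<close>
lemma bounded_borel_induct:
  fixes P :: "(complex \<Rightarrow> complex) \<Rightarrow> bool"
  assumes Q: "bounded Q"
    and one: "P (\<lambda>l. 1)"
    and mult: "\<And>f. \<lbrakk>admissible borel Q f; P f\<rbrakk> \<Longrightarrow> P (\<lambda>l. l * f l)"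
    and mult_cnj: "\<And>f. \<lbrakk>admissible borel Q f; P f\<rbrakk> \<Longrightarrow> P (\<lambda>l. cnj l * f l)"
    and add: "\<And>f g. \<lbrakk>admissible borel Q f; P f; admissible borel Q g; P g\<rbrakk> \<Longrightarrow> P (\<lambda>x. f x + g x)"
    and scale: "\<And>c f. \<lbrakk>admissible borel Q f; P f\<rbrakk> \<Longrightarrow> P (\<lambda>x. c * f x)"
    and lim: "\<And>F f. \<lbrakk>bounded_limit borel Q F f; \<And>n. P (F n)\<rbrakk> \<Longrightarrow> P f"
    and f: "admissible borel Q f"
  shows "P f"
proof (rule bounded_borel_induct_polynomial[OF Q, where P=P and f=f])
  show "P g" if "bounded_limit borel Q F g" "\<And>n. P (F n)" for F g
    using that by (rule lim)
next
  define good where "good f \<longleftrightarrow> admissible borel Q f \<and> P f" for f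
  have gadd: "good (\<lambda>l. f l + g l)" if "good f" "good g" for f g
    using that add[of f g] admissible_add unfolding good_def by blast
  have gscale: "good (\<lambda>l. c * f l)" if "good f" for c f
    using that scale[of f c] admissible_scale unfolding good_def by blast
  have gid: "good (\<lambda>l. l * f l)" "good (\<lambda>l. cnj l * f l)" if "good f" for f
    using that mult[of f] mult_cnj[of f] admissible_mult[OF admissible_id[OF Q]]
      admissible_mult[OF admissible_cnj[OF admissible_id[OF Q]]] unfolding good_def by blast+
  have "good (\<lambda>l. of_real (p l) * f l)" if "real_polynomial_function p" "good f" for p f
    using that
  proof (induction p arbitrary: f rule: real_polynomial_function.induct)
    case (linear h)
    then interpret h: bounded_linear h by simp
    have lin: "h l = Re l * h 1 + Im l * h \<i>" for l
    proof -
      have "h l = h (Re l *\<^sub>R 1 + Im l *\<^sub>R \<i>)" by (rule arg_cong[of _ _ h]) (simp add: complex_eq_iff)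
      then show ?thesis by (simp add: h.add h.scale)
    qed
    \<comment> \<open>from \<open>Re l = (l + cnj l) / 2\<close> and \<open>Im l = (l - cnj l) / (2 \<i>)\<close>\<close>
    define a b where "a = (of_real (h 1) - \<i> * of_real (h \<i>)) / 2"
      and "b = (of_real (h 1) + \<i> * of_real (h \<i>)) / 2"
    have "of_real (h l) = a * l + b * cnj l" for l
      unfolding a_def b_def by (subst lin) (simp add: complex_eq_iff field_simps)
    then have "(\<lambda>l. of_real (h l) * f l) = (\<lambda>l. a * (l * f l) + b * (cnj l * f l))"
      by (simp add: fun_eq_iff algebra_simps)
    moreover have "good (\<lambda>l. a * (l * f l) + b * (cnj l * f l))"
      by (intro gadd gscale gid linear)
    ultimately show ?case by simp
  next
    case (const c) then show ?case by (intro gscale)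
  next
    case (add p q)
    then show ?case using gadd[of "\<lambda>l. of_real (p l) * f l" "\<lambda>l. of_real (q l) * f l"]
      by (simp add: algebra_simps)
  next
    case (mult p q)
    from mult.IH(1)[OF mult.IH(2)[OF mult.prems]] show ?case by (simp add: mult.assoc)
  qed
  moreover have "good (\<lambda>l. 1)"
    using one by (simp add: good_def admissible_const)
  ultimately have "good (\<lambda>l. of_real (p l) * 1)" if "real_polynomial_function p" for p
    using that by blast
  then show "P (\<lambda>l. of_real (p l))" if "real_polynomial_function p" for p
    using that by (simp add: good_def)
qed (simp_all add: add scale f)

section \<open>A bounded two-dimensional moment problem\<close>

text \<open>Bivariate real polynomials are polynomials in \<open>Y\<close> whose coefficients are polynomials in \<open>X\<close>.
  They are evaluated at a complex number by \<open>X = Re l\<close>, \<open>Y = Im l\<close>.\<close>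

abbreviation const_poly :: "real \<Rightarrow> real poly poly" where
  "const_poly c \<equiv> [:[:c:]:]"

abbreviation X_poly :: "real poly poly" where
  "X_poly \<equiv> [:[:0, 1:]:]"

abbreviation Y_poly :: "real poly poly" where
  "Y_poly \<equiv> [:0, 1:]"

definition eval_poly :: "real poly poly \<Rightarrow> complex \<Rightarrow> real" where
  "eval_poly p l = poly (poly p [:Im l:]) (Re l)"

lemma eval_poly_simps[simp]:
  "eval_poly (p + q) l = eval_poly p l + eval_poly q l"
  "eval_poly (p - q) l = eval_poly p l - eval_poly q l"
  "eval_poly (p * q) l = eval_poly p l * eval_poly q l"
  "eval_poly (p ^ n) l = eval_poly p l ^ n"
  "eval_poly 0 l = 0" "eval_poly 1 l = 1"
  "eval_poly (const_poly c) l = c"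
  "eval_poly X_poly l = Re l" "eval_poly Y_poly l = Im l"
  by (simp_all add: eval_poly_def poly_power)

lemma const_poly_mult: "const_poly c * const_poly d = const_poly (c * d)"
  by simp

lemma const_poly_add: "const_poly c + const_poly d = const_poly (c + d)"
  by simp

lemma bivariate_poly_induct[case_names const add X Y]:
  fixes P :: "real poly poly \<Rightarrow> bool"
  assumes const: "\<And>c. P (const_poly c)"
    and add: "\<And>p q. P p \<Longrightarrow> P q \<Longrightarrow> P (p + q)"
    and X: "\<And>p. P p \<Longrightarrow> P (X_poly * p)"
    and Y: "\<And>p. P p \<Longrightarrow> P (Y_poly * p)"
  shows "P p"
proof (induction p)
  case 0 then show ?case using const[of 0] by simp
next
  case (pCons c q)
  have "P [:c:]"
  proof (induction c)
    case 0 then show ?case using const[of 0] by simp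
  next
    case (pCons a c)
    have "P (const_poly a + X_poly * [:c:])" by (intro add X const pCons)
    then show ?case by simp
  qed
  then have "P ([:c:] + Y_poly * q)" by (intro add Y pCons)
  then show ?case by simp
qed

lemma real_polynomial_function_eval_poly:
  assumes "real_polynomial_function f"
  shows "\<exists>p. f = eval_poly p"
  using assms
proof (induction rule: real_polynomial_function.induct)
  case (linear f)
  then interpret bounded_linear f by simp
  have "f l = eval_poly (const_poly (f 1) * X_poly + const_poly (f \<i>) * Y_poly) l" for l
  proof -
    have "f l = f (Re l *\<^sub>R 1 + Im l *\<^sub>R \<i>)" by (rule arg_cong[of _ _ f]) (simp add: complex_eq_iff)
    then show ?thesis unfolding eval_poly_simps by (simp add: add scale)
  qed
  then show ?case by blast
next
  case (const c)
  have "(\<lambda>l. c) = eval_poly (const_poly c)" unfolding eval_poly_simps fun_eq_iff by simp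
  then show ?case by blast
next
  case (add f g)
  then obtain p q where "f = eval_poly p" "g = eval_poly q" by auto
  then have "(\<lambda>l. f l + g l) = eval_poly (p + q)" by (simp add: fun_eq_iff)
  then show ?case by blast
next
  case (mult f g)
  then obtain p q where "f = eval_poly p" "g = eval_poly q" by auto
  then have "(\<lambda>l. f l * g l) = eval_poly (p * q)" by (simp add: fun_eq_iff)
  then show ?case by blast
qed

lemma continuous_eval_poly: "continuous_on UNIV (eval_poly p)"
proof (induction p rule: bivariate_poly_induct)
  case (const c)
  have "eval_poly (const_poly c) = (\<lambda>l. c)" unfolding fun_eq_iff eval_poly_simps by simp
  then show ?case by simp
next
  case (add p q)
  have "eval_poly (p + q) = (\<lambda>l. eval_poly p l + eval_poly q l)" by (simp add: fun_eq_iff)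
  then show ?case using add by (simp add: continuous_on_add)
next
  case (X p)
  have "eval_poly (X_poly * p) = (\<lambda>l. Re l * eval_poly p l)" unfolding fun_eq_iff eval_poly_simps by simp
  then show ?case using X by (auto intro!: continuous_intros)
next
  case (Y p)
  have "eval_poly (Y_poly * p) = (\<lambda>l. Im l * eval_poly p l)" unfolding fun_eq_iff eval_poly_simps by simp
  then show ?case using Y by (auto intro!: continuous_intros)
qed

text \<open>On a grid of mesh \<open>1 / n\<close> the falling factorials that Bernstein polynomials integrate exactly
  approximate powers, uniformly in \<open>k\<close>. The induction uses
  \<open>(k choose (m + 1)) / (n choose (m + 1)) = (k choose m) / (n choose m) \<cdot> (k - m) / (n - m)\<close>.\<close>
lemma choose_ratio_converges:
  "\<exists>e. e \<longlonglongrightarrow> 0 \<and> (\<forall>n>m. \<forall>k\<le>n.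
     \<bar>real (k choose m) / real (n choose m) - (real k / real n) ^ m\<bar> \<le> e n)"
proof (induction m)
  case 0
  show ?case by (intro exI[of _ "\<lambda>_. 0"]) auto
next
  case (Suc m)
  then obtain e where e: "e \<longlonglongrightarrow> 0" and b: "\<And>n k. n > m \<Longrightarrow> k \<le> n \<Longrightarrow>
      \<bar>real (k choose m) / real (n choose m) - (real k / real n) ^ m\<bar> \<le> e n" by auto
  define e' where "e' n = e n + real m * inverse (real n - real m)" for n
  have "filterlim (\<lambda>n. real n - real m) at_top sequentially"
    using filterlim_tendsto_add_at_top[OF tendsto_const[of "- real m"] filterlim_real_sequentially]
    by simp
  then have "(\<lambda>n. inverse (real n - real m)) \<longlonglongrightarrow> 0"
    by (rule tendsto_inverse_0_at_top)
  then have "e' \<longlonglongrightarrow> 0 + real m * 0" unfolding e'_def by (intro tendsto_intros e)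
  moreover have "\<bar>real (k choose Suc m) / real (n choose Suc m) - (real k / real n) ^ Suc m\<bar> \<le> e' n"
    if n: "n > Suc m" and k: "k \<le> n" for n k
  proof -
    let ?g = "real (k choose m) / real (n choose m)" and ?u = "real k / real n"
    let ?a = "(real k - real m) / (real n - real m)"
    have suc: "real (j choose Suc m) * real (Suc m) = real (j choose m) * (real j - real m)" for j
    proof (cases "m \<le> j")
      case True
      have "Suc m * (j choose Suc m) = (j choose m) * (j - m)"
        using binomial_absorption[of m j] binomial_absorb_comp[of j m] by (simp only: mult.commute)
      then have "real (Suc m * (j choose Suc m)) = real ((j choose m) * (j - m))" by (rule arg_cong)
      then show ?thesis using True by (simp add: of_nat_diff algebra_simps)
    qed (simp add: binomial_eq_0)
    have g: "real (k choose Suc m) / real (n choose Suc m) = ?g * ?a"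
    proof -
      have "real (k choose Suc m) / real (n choose Suc m)
          = (real (k choose Suc m) * real (Suc m)) / (real (n choose Suc m) * real (Suc m))" by simp
      also have "\<dots> = ?g * ?a" unfolding suc by simp
      finally show ?thesis .
    qed
    have g1: "0 \<le> ?g" "?g \<le> 1"
      using binomial_right_mono[of k n m] k n by (auto simp: divide_le_eq_1)
    have u: "0 \<le> ?u" "?u \<le> 1" using k n by auto
    have "\<bar>?a - ?u\<bar> \<le> real m * inverse (real n - real m)"
    proof -
      have "?a - ?u = - (real m * (1 - ?u) * inverse (real n - real m))"
        using n by (simp add: field_simps)
      also have "\<bar>\<dots>\<bar> = real m * (1 - ?u) * inverse (real n - real m)"
        using n u by (simp add: abs_mult)
      also have "\<dots> \<le> real m * 1 * inverse (real n - real m)"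
        using n u by (intro mult_right_mono mult_left_mono) auto
      finally show ?thesis by simp
    qed
    moreover have "\<bar>?g - ?u ^ m\<bar> \<le> e n" using b[of n k] n k by simp
    moreover have "\<bar>?g * ?a - ?u ^ Suc m\<bar> \<le> \<bar>?g * (?a - ?u)\<bar> + \<bar>?u * (?g - ?u ^ m)\<bar>"
    proof -
      have "?g * ?a - ?u ^ Suc m = ?g * (?a - ?u) + ?u * (?g - ?u ^ m)"
        by (simp add: algebra_simps)
      then show ?thesis by (simp only: abs_triangle_ineq)
    qed
    moreover have "\<bar>?g * (?a - ?u)\<bar> \<le> 1 * \<bar>?a - ?u\<bar>"
      unfolding abs_mult using g1 by (intro mult_right_mono) auto
    moreover have "\<bar>?u * (?g - ?u ^ m)\<bar> \<le> 1 * \<bar>?g - ?u ^ m\<bar>"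
      unfolding abs_mult using u by (intro mult_right_mono) auto
    ultimately have "\<bar>?g * ?a - ?u ^ Suc m\<bar> \<le> real m * inverse (real n - real m) + e n"
      by (simp only: mult_1)
    then show ?thesis unfolding g e'_def by (simp only: add.commute)
  qed
  ultimately show ?case by auto
qed

text \<open>The factorial moments of the binomial distribution, as an identity in any commutative ring. It
  is exact, so that it can be applied inside a functional that is known on polynomials only.\<close>
lemma bernstein_moment:
  fixes s :: "'a::comm_ring_1"
  assumes "m \<le> n"
  shows "(\<Sum>k\<le>n. of_nat (k choose m) * (of_nat (n choose k) * s ^ k * (1 - s) ^ (n - k)))
      = of_nat (n choose m) * s ^ m"
proof -
  have "(\<Sum>k\<le>n. of_nat (k choose m) * (of_nat (n choose k) * s ^ k * (1 - s) ^ (n - k)))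
      = (\<Sum>k\<in>{m..n}. of_nat (k choose m) * (of_nat (n choose k) * s ^ k * (1 - s) ^ (n - k)))"
    by (rule sum.mono_neutral_right) (auto simp: binomial_eq_0)
  also have "\<dots> = (\<Sum>j\<le>n - m. of_nat ((m + j) choose m) * (of_nat (n choose (m + j)) * s ^ (m + j) * (1 - s) ^ (n - (m + j))))"
    by (rule sum.reindex_bij_witness[of _ "\<lambda>j. m + j" "\<lambda>k. k - m"]) (use assms in auto)
  also have "\<dots> = (\<Sum>j\<le>n - m. of_nat (n choose m) * s ^ m * (of_nat ((n - m) choose j) * s ^ j * (1 - s) ^ ((n - m) - j)))"
  proof (rule sum.cong)
    fix j assume "j \<in> {..n - m}"
    then have "(n choose (m + j)) * ((m + j) choose m) = (n choose m) * ((n - m) choose j)"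
      using choose_mult[of m "m + j" n] assms by auto
    then have "of_nat ((n choose (m + j)) * ((m + j) choose m)) = (of_nat ((n choose m) * ((n - m) choose j)) :: 'a)"
      by (rule arg_cong)
    then have "of_nat (n choose (m + j)) * of_nat ((m + j) choose m) = (of_nat (n choose m) * of_nat ((n - m) choose j) :: 'a)"
      by (simp only: of_nat_mult)
    moreover have "of_nat ((m + j) choose m) * (of_nat (n choose (m + j)) * s ^ (m + j) * (1 - s) ^ (n - (m + j)))
       = (of_nat (n choose (m + j)) * of_nat ((m + j) choose m)) * s ^ (m + j) * (1 - s) ^ (n - (m + j))"
      by (simp only: mult_ac)
    ultimately have "of_nat ((m + j) choose m) * (of_nat (n choose (m + j)) * s ^ (m + j) * (1 - s) ^ (n - (m + j)))
       = (of_nat (n choose m) * of_nat ((n - m) choose j)) * s ^ (m + j) * (1 - s) ^ (n - (m + j))"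
      by (simp only:)
    then show "of_nat ((m + j) choose m) * (of_nat (n choose (m + j)) * s ^ (m + j) * (1 - s) ^ (n - (m + j)))
       = of_nat (n choose m) * s ^ m * (of_nat ((n - m) choose j) * s ^ j * (1 - s) ^ ((n - m) - j))"
      by (simp add: power_add mult_ac)
  qed simp
  also have "\<dots> = of_nat (n choose m) * s ^ m * (\<Sum>j\<le>n - m. of_nat ((n - m) choose j) * s ^ j * (1 - s) ^ ((n - m) - j))"
    by (simp add: sum_distrib_left)
  also have "(\<Sum>j\<le>n - m. of_nat ((n - m) choose j) * s ^ j * (1 - s) ^ ((n - m) - j)) = (s + (1 - s)) ^ (n - m)"
    by (rule binomial_ring[symmetric])
  finally show ?thesis by simp
qed

definition centered_square :: "real \<Rightarrow> complex set" where
  "centered_square K = {l. \<bar>Re l\<bar> \<le> K \<and> \<bar>Im l\<bar> \<le> K}"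

lemma compact_centered_square: "compact (centered_square K)"
proof -
  have "centered_square K = cbox (Complex (-K) (-K)) (Complex K K)"
    by (auto simp: centered_square_def in_cbox_complex_iff)
  then show ?thesis by simp
qed

text \<open>The positivity that \<open>p \<mapsto> \<langle>p(A, B) x, x\<rangle>\<close> visibly has. Positivity on the products
  \<open>(K\<^sup>2 - X\<^sup>2) (K\<^sup>2 - Y\<^sup>2) q\<^sup>2\<close> is not part of it and has to be derived (\<open>pos_mult\<close>); a
  functional on polynomials in two variables that is merely positive on squares need not come from
  a measure.\<close>

locale positive_poly_functional =
  fixes L :: "real poly poly \<Rightarrow> real" and K :: real
  assumes K_pos: "0 < K"
    and L_add: "L (p + q) = L p + L q"
    and L_scale: "L (const_poly c * p) = c * L p"
    and L_square: "0 \<le> L (q * q)"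
    and L_X: "0 \<le> L ((const_poly (K\<^sup>2) - X_poly * X_poly) * (q * q))"
    and L_Y: "0 \<le> L ((const_poly (K\<^sup>2) - Y_poly * Y_poly) * (q * q))"
begin

lemma L_0: "L 0 = 0"
  using L_add[of 0 0] by simp

lemma L_diff: "L (p - q) = L p - L q"
  using L_add[of "p - q" q] by simp

lemma L_sum: "finite A \<Longrightarrow> L (\<Sum>i\<in>A. f i) = (\<Sum>i\<in>A. L (f i))"
  by (induction A rule: finite_induct) (simp_all add: L_0 L_add)

lemma Cauchy_Schwarz: "(L (u * v))\<^sup>2 \<le> L (u * u) * L (v * v)"
proof -
  let ?a = "L (u * u)" and ?b = "L (u * v)" and ?d = "L (v * v)"
  have quad: "0 \<le> ?a + 2 * r * ?b + r\<^sup>2 * ?d" for r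
  proof -
    have "0 \<le> L ((u + const_poly r * v) * (u + const_poly r * v))" by (rule L_square)
    also have "(u + const_poly r * v) * (u + const_poly r * v)
        = u * u + (const_poly r * (u * v) + const_poly r * (u * v)) + const_poly r * (const_poly r * (v * v))"
      unfolding distrib_left distrib_right by (simp only: mult_ac add_ac)
    also have "L \<dots> = ?a + (r * ?b + r * ?b) + r * (r * ?d)"
      by (simp only: L_add L_scale)
    finally show ?thesis by (simp add: power2_eq_square)
  qed
  show ?thesis
  proof (cases "?d = 0")
    case True
    have "?b = 0"
    proof (rule ccontr)
      assume b: "?b \<noteq> 0"
      show False using quad[of "- (?a + 1) / (2 * ?b)"] b True by (simp add: field_simps)
    qed
    then show ?thesis using True by simp
  next
    case False
    then have d: "?d > 0" using L_square[of v] by simp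
    have "0 \<le> (?a + 2 * (- ?b / ?d) * ?b + (- ?b / ?d)\<^sup>2 * ?d) * ?d"
      using quad[of "- ?b / ?d"] d by (intro mult_nonneg_nonneg) auto
    also have "\<dots> = ?a * ?d - ?b\<^sup>2"
      using d by (simp add: field_simps power2_eq_square)
    finally show ?thesis by simp
  qed
qed

text \<open>For the functional \<open>p \<mapsto> \<langle>p(A, B) x, x\<rangle>\<close> this says that the operator \<open>c(A, B)\<close> is positive on
  the cyclic subspace generated by \<open>x\<close>.\<close>

definition pos :: "real poly poly \<Rightarrow> bool" where
  "pos c \<longleftrightarrow> (\<forall>q. 0 \<le> L (c * (q * q)))"

lemma pos_add: "pos c \<Longrightarrow> pos d \<Longrightarrow> pos (c + d)"
  by (simp add: pos_def distrib_right L_add)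

lemma pos_mult_square: "pos c \<Longrightarrow> pos (c * (r * r))"
  unfolding pos_def
proof
  fix q assume "\<forall>q. 0 \<le> L (c * (q * q))"
  then have "0 \<le> L (c * ((r * q) * (r * q)))" by blast
  then show "0 \<le> L (c * (r * r) * (q * q))" by (simp only: mult_ac)
qed

lemma pos_one: "pos 1"
  using L_square by (simp add: pos_def)

lemma pos_square: "pos (r * r)"
  using pos_mult_square[OF pos_one, of r] by simp

lemma pos_scale: "0 \<le> c \<Longrightarrow> pos p \<Longrightarrow> pos (const_poly c * p)"
  unfolding pos_def mult.assoc L_scale by simp

text \<open>The analogue of the theorem that a product of commuting positive operators is positive, by
  Riesz' recursion \<open>a (n + 1) = a n - (a n)\<^sup>2\<close>, \<open>a 0 = c\<close>. It keeps \<open>0 \<le> a n \<le> 1\<close> and writes \<open>c\<close> as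
  a sum of squares \<open>(a k)\<^sup>2\<close> plus the remainder \<open>a n\<close>. Multiplied by \<open>d\<close> the squares contribute
  nonnegative terms. As the partial sums of \<open>L ((a k)\<^sup>2 q\<^sup>2)\<close> are bounded by \<open>L (c q\<^sup>2)\<close>, the terms tend
  to 0, and by Cauchy-Schwarz so does the remainder \<open>L (a n d q\<^sup>2)\<close>.\<close>
lemma pos_mult:
  assumes c: "pos c" "pos (1 - c)" and d: "pos d"
  shows "pos (c * d)"
  unfolding pos_def
proof
  fix q
  define a where "a = rec_nat c (\<lambda>_ x. x - x * x)"
  have a0: "a 0 = c" and aS: "a (Suc n) = a n - a n * a n" for n
    by (simp_all add: a_def)
  have pa: "pos (a n) \<and> pos (1 - a n)" for n
  proof (induction n)
    case 0 then show ?case using c by (simp add: a0)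
  next
    case (Suc n)
    have "pos (a n * ((1 - a n) * (1 - a n)) + (1 - a n) * (a n * a n))"
      using Suc by (intro pos_add pos_mult_square) auto
    moreover have "a n * ((1 - a n) * (1 - a n)) + (1 - a n) * (a n * a n) = a (Suc n)"
      unfolding aS by (simp add: algebra_simps)
    moreover have "pos ((1 - a n) + a n * a n)"
      using Suc by (intro pos_add pos_square) auto
    moreover have "(1 - a n) + a n * a n = 1 - a (Suc n)" unfolding aS by simp
    ultimately show ?case by simp
  qed
  have tele: "(\<Sum>k<n. a k * a k) = c - a n" for n
    by (induction n) (simp_all add: a0 aS)
  have bound: "(\<Sum>k<n. L ((a k * q) * (a k * q))) \<le> L (c * (q * q))" for n
  proof -
    have "(\<Sum>k<n. L ((a k * q) * (a k * q))) = L (\<Sum>k<n. (a k * a k) * (q * q))"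
      by (subst L_sum) (simp_all add: mult_ac)
    also have "(\<Sum>k<n. (a k * a k) * (q * q)) = c * (q * q) - a n * (q * q)"
      unfolding sum_distrib_right[symmetric] tele by (simp add: algebra_simps)
    also have "L \<dots> = L (c * (q * q)) - L (a n * (q * q))" by (rule L_diff)
    also have "\<dots> \<le> L (c * (q * q))" using pa[of n] by (simp add: pos_def)
    finally show ?thesis .
  qed
  have "summable (\<lambda>k. L ((a k * q) * (a k * q)))"
    by (rule summableI_nonneg_bounded[OF L_square bound])
  then have lim0: "(\<lambda>k. L ((a k * q) * (a k * q))) \<longlonglongrightarrow> 0"
    by (rule summable_LIMSEQ_zero)
  have lim: "(\<lambda>k. L ((a k * q) * (d * q))) \<longlonglongrightarrow> 0"
  proof -
    have "(\<lambda>k. (L ((a k * q) * (d * q)))\<^sup>2) \<longlonglongrightarrow> 0"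
    proof (rule Lim_null_comparison)
      show "\<forall>\<^sub>F k in sequentially. norm ((L ((a k * q) * (d * q)))\<^sup>2) \<le> L ((a k * q) * (a k * q)) * L ((d * q) * (d * q))"
        using Cauchy_Schwarz by simp
      show "(\<lambda>k. L ((a k * q) * (a k * q)) * L ((d * q) * (d * q))) \<longlonglongrightarrow> 0"
        using tendsto_mult_right[OF lim0] by simp
    qed
    then show ?thesis by simp
  qed
  have "L ((a n * q) * (d * q)) \<le> L (c * d * (q * q))" for n
  proof -
    have "(\<Sum>k<n. (a k * a k) * (d * (q * q))) + a n * (d * (q * q)) = c * (d * (q * q))"
      unfolding sum_distrib_right[symmetric] tele by (simp add: algebra_simps)
    then have "L (c * d * (q * q)) = L ((\<Sum>k<n. (a k * a k) * (d * (q * q))) + a n * (d * (q * q)))"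
      by (simp add: mult.assoc)
    also have "\<dots> = (\<Sum>k<n. L (d * ((a k * q) * (a k * q)))) + L ((a n * q) * (d * q))"
      by (simp add: L_add L_sum mult_ac)
    moreover have "0 \<le> (\<Sum>k<n. L (d * ((a k * q) * (a k * q))))"
      using d by (intro sum_nonneg) (simp add: pos_def)
    ultimately show ?thesis by simp
  qed
  then show "0 \<le> L (c * d * (q * q))"
    by (intro LIMSEQ_le_const2[OF lim]) auto
qed

text \<open>Affine change of the coordinates \<open>X\<close> and \<open>Y\<close> from \<open>[-K, K]\<close> to \<open>[0, 1]\<close>.\<close>

definition s_poly :: "real poly poly" where
  "s_poly = const_poly (1/2) + const_poly (1 / (2 * K)) * X_poly"

definition t_poly :: "real poly poly" where
  "t_poly = const_poly (1/2) + const_poly (1 / (2 * K)) * Y_poly"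

text \<open>For \<open>s = (K + Z) / 2 K\<close> one has \<open>s (1 - s) = (K\<^sup>2 - Z\<^sup>2) / 4 K\<^sup>2\<close>, and both \<open>s\<close> and \<open>1 - s\<close> arise from
  \<open>s (1 - s)\<close> by adding a square.\<close>
lemma pos_half:
  assumes "\<And>q. 0 \<le> L ((const_poly (K\<^sup>2) - Z * Z) * (q * q))"
  defines "s \<equiv> const_poly (1/2) + const_poly (1 / (2 * K)) * Z"
  shows "pos s \<and> pos (1 - s)"
proof -
  have eq: "s * (1 - s) = const_poly (1 / (4 * K\<^sup>2)) * (const_poly (K\<^sup>2) - Z * Z)"
  proof -
    define h k where "h = const_poly (1/2)" and "k = const_poly (1 / (2 * K))"
    have s: "s = h + k * Z" by (simp only: s_def h_def k_def)
    have one: "1 = h + h" unfolding h_def const_poly_add by (simp add: one_pCons)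
    have "s * (1 - s) = h * h - (k * k) * (Z * Z)"
      unfolding s one by (simp add: algebra_simps)
    also have "h * h = const_poly (1 / (4 * K\<^sup>2)) * const_poly (K\<^sup>2)"
      unfolding h_def const_poly_mult using K_pos by simp
    also have "k * k = const_poly (1 / (4 * K\<^sup>2))"
      unfolding k_def const_poly_mult by (simp add: power2_eq_square)
    finally show ?thesis by (simp only: right_diff_distrib mult.assoc)
  qed
  have "pos (const_poly (K\<^sup>2) - Z * Z)" using assms by (simp add: pos_def)
  then have ss: "pos (s * (1 - s))" unfolding eq using K_pos by (intro pos_scale) auto
  have "pos (s * (1 - s) + s * s)" "pos (s * (1 - s) + (1 - s) * (1 - s))"
    by (intro pos_add ss pos_square)+
  moreover have "s * (1 - s) + s * s = s" "s * (1 - s) + (1 - s) * (1 - s) = 1 - s"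
    by (simp_all add: algebra_simps)
  ultimately show ?thesis by simp
qed

lemma pos_power_mult:
  assumes "pos c" "pos (1 - c)" "pos d" shows "pos (c ^ n * d)"
  by (induction n) (use assms pos_mult in \<open>auto simp: mult.assoc\<close>)

definition bern :: "real poly poly \<Rightarrow> nat \<Rightarrow> nat \<Rightarrow> real poly poly" where
  "bern s n k = of_nat (n choose k) * s ^ k * (1 - s) ^ (n - k)"

text \<open>Quadrature weights: the mass that the functional assigns to the product Bernstein polynomial
  peaking at the grid point with coordinates \<open>s = k / n\<close>, \<open>t = l / n\<close>.\<close>

definition weight :: "nat \<Rightarrow> nat \<Rightarrow> nat \<Rightarrow> real" where
  "weight n k l = L (bern s_poly n k * bern t_poly n l)"

lemma weight_nonneg: "0 \<le> weight n k l"
proof -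
  have s: "pos s_poly" "pos (1 - s_poly)" "pos (1 - (1 - s_poly))"
    and t: "pos t_poly" "pos (1 - t_poly)" "pos (1 - (1 - t_poly))"
    using pos_half[OF L_X] pos_half[OF L_Y] by (simp_all add: s_poly_def t_poly_def)
  have nat: "of_nat m = const_poly (real m)" for m
    by (simp add: of_nat_poly)
  have "pos (const_poly (real (n choose k) * real (n choose l)) * (s_poly ^ k * ((1 - s_poly) ^ (n - k) *
      (t_poly ^ l * ((1 - t_poly) ^ (n - l) * 1)))))"
    using s t by (intro pos_scale pos_power_mult pos_one) auto
  also have "const_poly (real (n choose k) * real (n choose l)) * (s_poly ^ k * ((1 - s_poly) ^ (n - k) *
      (t_poly ^ l * ((1 - t_poly) ^ (n - l) * 1)))) = bern s_poly n k * bern t_poly n l"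
    unfolding bern_def nat const_poly_mult[symmetric] by (simp only: mult_ac mult_1_right)
  finally show ?thesis unfolding pos_def weight_def by (metis mult_1_right)
qed

definition grid :: "nat \<Rightarrow> nat \<Rightarrow> nat \<Rightarrow> complex" where
  "grid n k l = Complex (K * (2 * (real k / real n) - 1)) (K * (2 * (real l / real n) - 1))"

definition grid_sum :: "(complex \<Rightarrow> real) \<Rightarrow> nat \<Rightarrow> real" where
  "grid_sum f n = (\<Sum>k\<le>n. \<Sum>l\<le>n. f (grid n k l) * weight n k l)"

lemma grid_square: "0 < n \<Longrightarrow> k \<le> n \<Longrightarrow> l \<le> n \<Longrightarrow> grid n k l \<in> centered_square K"
proof -
  have *: "\<bar>K * (2 * (real k / real n) - 1)\<bar> \<le> K" if "0 < n" "k \<le> n" for k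
  proof -
    have "0 \<le> real k / real n" "real k / real n \<le> 1" using that by auto
    then have "\<bar>2 * (real k / real n) - 1\<bar> \<le> 1" by linarith
    then show ?thesis using K_pos by (simp add: abs_mult)
  qed
  assume "0 < n" "k \<le> n" "l \<le> n"
  then show ?thesis using * by (simp add: centered_square_def grid_def)
qed

lemma grid_sum_add: "grid_sum (\<lambda>x. f x + g x) n = grid_sum f n + grid_sum g n"
  by (simp add: grid_sum_def distrib_right sum.distrib)

lemma grid_sum_scale: "grid_sum (\<lambda>x. c * f x) n = c * grid_sum f n"
  by (simp add: grid_sum_def sum_distrib_left mult.assoc)

lemma grid_sum_mono: "0 < n \<Longrightarrow> (\<And>x. x \<in> centered_square K \<Longrightarrow> f x \<le> g x) \<Longrightarrow> grid_sum f n \<le> grid_sum g n"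
  unfolding grid_sum_def by (intro sum_mono mult_right_mono weight_nonneg) (auto intro: grid_square)

lemma weight_moment:
  assumes "i \<le> n" "j \<le> n"
  shows "(\<Sum>k\<le>n. \<Sum>l\<le>n. (real (k choose i) / real (n choose i)) * (real (l choose j) / real (n choose j)) * weight n k l)
      = L (s_poly ^ i * t_poly ^ j)"
proof -
  have nat: "of_nat m = const_poly (real m)" for m
    by (simp add: of_nat_poly)
  have *: "(\<Sum>k\<le>n. const_poly (real (k choose i) / real (n choose i)) * bern s n k) = s ^ i" if "i \<le> n" for s i
  proof -
    have "(\<Sum>k\<le>n. const_poly (real (k choose i) / real (n choose i)) * bern s n k)
        = const_poly (1 / real (n choose i)) * (\<Sum>k\<le>n. of_nat (k choose i) * bern s n k)"
      unfolding sum_distrib_left nat mult.assoc[symmetric] const_poly_mult by simp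
    also have "\<dots> = const_poly (1 / real (n choose i)) * (const_poly (real (n choose i)) * s ^ i)"
      unfolding bern_def using bernstein_moment[OF that, of s] by (simp only: nat)
    also have "\<dots> = s ^ i"
      unfolding mult.assoc[symmetric] const_poly_mult using that by (simp add: one_pCons[symmetric])
    finally show ?thesis .
  qed
  have "L (s_poly ^ i * t_poly ^ j) = L ((\<Sum>k\<le>n. const_poly (real (k choose i) / real (n choose i)) * bern s_poly n k)
      * (\<Sum>l\<le>n. const_poly (real (l choose j) / real (n choose j)) * bern t_poly n l))"
    using assms by (simp only: *)
  also have "\<dots> = (\<Sum>k\<le>n. \<Sum>l\<le>n. L (const_poly ((real (k choose i) / real (n choose i)) * (real (l choose j) / real (n choose j))) *
      (bern s_poly n k * bern t_poly n l)))"
    unfolding sum_product const_poly_mult[symmetric] by (simp only: L_sum[OF finite_atMost] mult_ac)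
  also have "\<dots> = (\<Sum>k\<le>n. \<Sum>l\<le>n. (real (k choose i) / real (n choose i)) * (real (l choose j) / real (n choose j)) * weight n k l)"
    by (simp only: L_scale weight_def)
  finally show ?thesis by simp
qed

lemma weight_total: "(\<Sum>k\<le>n. \<Sum>l\<le>n. weight n k l) = L 1"
  using weight_moment[of 0 n 0] by simp

lemma eval_s_t_grid:
  assumes "0 < n"
  shows "eval_poly s_poly (grid n k l) = real k / real n" "eval_poly t_poly (grid n k l) = real l / real n"
  unfolding s_poly_def t_poly_def eval_poly_simps grid_def complex.sel using K_pos assms
  by (simp_all add: field_simps)

text \<open>By \<open>weight_moment\<close> the quadrature is exact for products of normalized binomial coefficients. These
  differ from the monomials in \<open>k / n\<close> and \<open>l / n\<close> by a uniformly small amount, while the weights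
  are nonnegative with fixed total \<open>L 1\<close>.\<close>
lemma grid_sum_monomial: "grid_sum (eval_poly (s_poly ^ i * t_poly ^ j)) \<longlonglongrightarrow> L (s_poly ^ i * t_poly ^ j)"
proof -
  obtain e where e: "e \<longlonglongrightarrow> 0" "\<And>n k. n > i \<Longrightarrow> k \<le> n \<Longrightarrow>
      \<bar>real (k choose i) / real (n choose i) - (real k / real n) ^ i\<bar> \<le> e n"
    using choose_ratio_converges[of i] by auto
  obtain e' where e': "e' \<longlonglongrightarrow> 0" "\<And>n k. n > j \<Longrightarrow> k \<le> n \<Longrightarrow>
      \<bar>real (k choose j) / real (n choose j) - (real k / real n) ^ j\<bar> \<le> e' n"
    using choose_ratio_converges[of j] by auto
  have bound: "norm (grid_sum (eval_poly (s_poly ^ i * t_poly ^ j)) n - L (s_poly ^ i * t_poly ^ j)) \<le> (e n + e' n) * L 1"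
    if n: "n > max i j" for n
  proof -
    have eq: "grid_sum (eval_poly (s_poly ^ i * t_poly ^ j)) n - L (s_poly ^ i * t_poly ^ j)
        = (\<Sum>k\<le>n. \<Sum>l\<le>n. ((real k / real n) ^ i * (real l / real n) ^ j
          - (real (k choose i) / real (n choose i)) * (real (l choose j) / real (n choose j))) * weight n k l)"
      using n weight_moment[of i n j]
      by (simp add: grid_sum_def eval_s_t_grid left_diff_distrib sum_subtractf)
    have "norm (grid_sum (eval_poly (s_poly ^ i * t_poly ^ j)) n - L (s_poly ^ i * t_poly ^ j))
        \<le> (\<Sum>k\<le>n. \<Sum>l\<le>n. (e n + e' n) * weight n k l)"
      unfolding eq
    proof (intro order_trans[OF norm_sum] sum_mono)
      fix k l assume kl: "k \<in> {..n}" "l \<in> {..n}"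
      let ?u = "real k / real n" and ?v = "real l / real n"
      let ?g = "real (k choose i) / real (n choose i)" and ?h = "real (l choose j) / real (n choose j)"
      have eq': "?u ^ i * ?v ^ j - ?g * ?h = - ((?g - ?u ^ i) * ?v ^ j + ?g * (?h - ?v ^ j))"
        by (simp add: algebra_simps)
      have "\<bar>?u ^ i * ?v ^ j - ?g * ?h\<bar> \<le> \<bar>?g - ?u ^ i\<bar> * \<bar>?v ^ j\<bar> + \<bar>?g\<bar> * \<bar>?h - ?v ^ j\<bar>"
        unfolding eq' abs_minus_cancel abs_mult[symmetric] by (rule abs_triangle_ineq)
      also have "\<dots> \<le> \<bar>?g - ?u ^ i\<bar> * 1 + 1 * \<bar>?h - ?v ^ j\<bar>"
      proof (intro add_mono mult_left_mono mult_right_mono)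
        show "\<bar>?v ^ j\<bar> \<le> 1" using kl by (auto intro!: power_le_one simp: divide_le_eq_1)
        show "\<bar>?g\<bar> \<le> 1" using binomial_right_mono[of k n i] kl by (auto simp: divide_le_eq_1)
      qed auto
      also have "\<dots> \<le> e n + e' n"
        using e(2)[of n k] e'(2)[of n l] n kl by simp
      finally have "\<bar>?u ^ i * ?v ^ j - ?g * ?h\<bar> \<le> e n + e' n" .
      then show "norm ((?u ^ i * ?v ^ j - ?g * ?h) * weight n k l) \<le> (e n + e' n) * weight n k l"
        using weight_nonneg[of n k l] by (simp add: abs_mult mult_right_mono)
    qed
    also have "\<dots> = (e n + e' n) * L 1"
      by (simp add: sum_distrib_left[symmetric] weight_total)
    finally show ?thesis .
  qed
  have "(\<lambda>n. grid_sum (eval_poly (s_poly ^ i * t_poly ^ j)) n - L (s_poly ^ i * t_poly ^ j)) \<longlonglongrightarrow> 0"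
  proof (rule Lim_null_comparison)
    show "\<forall>\<^sub>F n in sequentially. norm (grid_sum (eval_poly (s_poly ^ i * t_poly ^ j)) n - L (s_poly ^ i * t_poly ^ j)) \<le> (e n + e' n) * L 1"
      using bound eventually_gt_at_top[of "max i j"] by (auto elim: eventually_mono)
    show "(\<lambda>n. (e n + e' n) * L 1) \<longlonglongrightarrow> 0"
      using tendsto_mult_right[OF tendsto_add[OF e(1) e'(1)], of "L 1"] by simp
  qed
  then show ?thesis by (simp add: LIM_zero_iff)
qed

text \<open>Passing from the monomials in \<open>s\<close> and \<open>t\<close> to all polynomials uses \<open>X = 2 K s - K\<close> and
  \<open>Y = 2 K t - K\<close>. To multiply by \<open>X\<close> the induction must be able to absorb a factor \<open>s\<close>, so the
  claim is generalized to \<open>p s\<^sup>i t\<^sup>j\<close>.\<close>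
lemma grid_sum_poly: "grid_sum (eval_poly p) \<longlonglongrightarrow> L p"
proof -
  let ?V = "\<lambda>p. grid_sum (eval_poly p) \<longlonglongrightarrow> L p"
  have add: "?V (p + q)" if "?V p" "?V q" for p q
  proof -
    have "grid_sum (eval_poly (p + q)) = (\<lambda>n. grid_sum (eval_poly p) n + grid_sum (eval_poly q) n)"
    proof -
      have "eval_poly (p + q) = (\<lambda>l. eval_poly p l + eval_poly q l)" by (rule ext) simp
      then show ?thesis by (intro ext) (simp only: grid_sum_add)
    qed
    then show ?thesis using tendsto_add[OF that] by (simp only: L_add)
  qed
  have scale: "?V (const_poly c * p)" if "?V p" for c p
  proof -
    have "eval_poly (const_poly c * p) = (\<lambda>l. c * eval_poly p l)"
      unfolding fun_eq_iff eval_poly_simps by simp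
    then have "grid_sum (eval_poly (const_poly c * p)) = (\<lambda>n. c * grid_sum (eval_poly p) n)"
      by (intro ext) (simp only: grid_sum_scale)
    then show ?thesis using tendsto_mult_left[OF that, of c] by (simp only: L_scale)
  qed
  have XY: "Z * p = const_poly (2 * K) * (p * (const_poly (1/2) + const_poly (1 / (2 * K)) * Z)) + const_poly (- K) * p" for Z p
  proof -
    have "const_poly (2 * K) * (p * (const_poly (1/2) + const_poly (1 / (2 * K)) * Z)) + const_poly (- K) * p
       = (const_poly (2 * K) * const_poly (1/2) + const_poly (- K)) * p + (const_poly (2 * K) * const_poly (1 / (2 * K))) * (Z * p)"
      unfolding distrib_left distrib_right by (simp only: mult_ac add_ac)
    also have "\<dots> = Z * p"
      unfolding const_poly_mult const_poly_add using K_pos by (simp add: one_pCons[symmetric])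
    finally show ?thesis by simp
  qed
  have "\<forall>i j. ?V (p * (s_poly ^ i * t_poly ^ j))"
  proof (induction p rule: bivariate_poly_induct)
    case (const c) then show ?case using scale grid_sum_monomial by blast
  next
    case (add p q) then show ?case unfolding distrib_right using \<open>\<And>p q. ?V p \<Longrightarrow> ?V q \<Longrightarrow> ?V (p + q)\<close> by blast
  next
    case (X p)
    show ?case
    proof (intro allI)
      fix i j
      have "?V (const_poly (2 * K) * (p * (s_poly ^ Suc i * t_poly ^ j)) + const_poly (- K) * (p * (s_poly ^ i * t_poly ^ j)))"
        by (intro add scale X[rule_format])
      also have "const_poly (2 * K) * (p * (s_poly ^ Suc i * t_poly ^ j)) + const_poly (- K) * (p * (s_poly ^ i * t_poly ^ j))
         = X_poly * (p * (s_poly ^ i * t_poly ^ j))"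
        unfolding XY[of X_poly "p * (s_poly ^ i * t_poly ^ j)"] s_poly_def[symmetric] by (simp only: mult_ac power_Suc)
      finally show "?V (X_poly * p * (s_poly ^ i * t_poly ^ j))" by (simp only: mult.assoc)
    qed
  next
    case (Y p)
    show ?case
    proof (intro allI)
      fix i j
      have "?V (const_poly (2 * K) * (p * (s_poly ^ i * t_poly ^ Suc j)) + const_poly (- K) * (p * (s_poly ^ i * t_poly ^ j)))"
        by (intro add scale Y[rule_format])
      also have "const_poly (2 * K) * (p * (s_poly ^ i * t_poly ^ Suc j)) + const_poly (- K) * (p * (s_poly ^ i * t_poly ^ j))
         = Y_poly * (p * (s_poly ^ i * t_poly ^ j))"
        unfolding XY[of Y_poly "p * (s_poly ^ i * t_poly ^ j)"] t_poly_def[symmetric] by (simp only: mult_ac power_Suc)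
      finally show "?V (Y_poly * p * (s_poly ^ i * t_poly ^ j))" by (simp only: mult.assoc)
    qed
  qed
  from this[rule_format, of 0 0] show ?thesis by simp
qed

text \<open>Convergence spreads from polynomials to uniform limits of them, because the grid sums
  are monotone with bounded total weight.\<close>
lemma grid_sum_convergent:
  assumes "continuous_on UNIV f"
  shows "convergent (grid_sum f)"
proof -
  have "Cauchy (grid_sum f)"
  proof (rule metric_CauchyI)
    fix e :: real assume "0 < e"
    have L1: "0 \<le> L 1" using L_square[of 1] by simp
    define d where "d = e / (4 * (L 1 + 1))"
    have d: "0 < d" "d * L 1 \<le> e / 4" using \<open>0 < e\<close> L1 by (auto simp: d_def field_simps)
    obtain p where p: "\<And>l. l \<in> centered_square K \<Longrightarrow> \<bar>f l - eval_poly p l\<bar> < d"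
      using Stone_Weierstrass_real_polynomial_function[OF compact_centered_square continuous_on_subset[OF assms subset_UNIV] d(1)]
        real_polynomial_function_eval_poly by metis
    have pd: "f l \<le> eval_poly p l + d" "eval_poly p l \<le> f l + d" if "l \<in> centered_square K" for l
      using p[OF that] unfolding abs_less_iff by linarith+
    have close: "\<bar>grid_sum f n - grid_sum (eval_poly p) n\<bar> \<le> e / 4" if "0 < n" for n
    proof -
      have c: "grid_sum (\<lambda>_. d) n = d * L 1"
        unfolding grid_sum_def sum_distrib_left[symmetric] weight_total by simp
      have "grid_sum f n \<le> grid_sum (\<lambda>l. eval_poly p l + d) n"
        using that pd by (intro grid_sum_mono)
      moreover have "grid_sum (eval_poly p) n \<le> grid_sum (\<lambda>l. f l + d) n"
        using that pd by (intro grid_sum_mono)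
      ultimately show ?thesis using d(2) unfolding grid_sum_add c by linarith
    qed
    have "Cauchy (grid_sum (eval_poly p))"
      using grid_sum_poly by (rule LIMSEQ_imp_Cauchy)
    then obtain N where N: "\<And>m n. m \<ge> N \<Longrightarrow> n \<ge> N \<Longrightarrow> dist (grid_sum (eval_poly p) m) (grid_sum (eval_poly p) n) < e / 4"
      using metric_CauchyD[of _ "e / 4"] \<open>0 < e\<close> by (metis zero_less_divide_iff zero_less_numeral)
    show "\<exists>M. \<forall>m\<ge>M. \<forall>n\<ge>M. dist (grid_sum f m) (grid_sum f n) < e"
    proof (intro exI[of _ "Suc N"] allI impI)
      fix m n assume mn: "Suc N \<le> m" "Suc N \<le> n"
      have "\<bar>grid_sum f m - grid_sum (eval_poly p) m\<bar> \<le> e / 4" "\<bar>grid_sum f n - grid_sum (eval_poly p) n\<bar> \<le> e / 4"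
        using mn by (intro close; simp)+
      moreover have "\<bar>grid_sum (eval_poly p) m - grid_sum (eval_poly p) n\<bar> < e / 4"
        using N[of m n] mn by (simp add: dist_real_def)
      ultimately show "dist (grid_sum f m) (grid_sum f n) < e"
        using \<open>0 < e\<close> unfolding dist_real_def by linarith
    qed
  qed
  then show ?thesis by (rule Cauchy_convergent)
qed

text \<open>Solution of the moment problem on a square: the limit of the grid sums is a positive functional on
  continuous functions that extends \<open>L\<close>.\<close>
theorem moment_measure_exists:
  "\<exists>\<mu> :: complex measure. sets \<mu> = sets borel \<and> finite_measure \<mu> \<and> emeasure \<mu> (- centered_square K) = 0 \<and>
     (\<forall>p. (\<integral>l. eval_poly p l \<partial>\<mu>) = L p)"
proof -
  have lim: "grid_sum f \<longlonglongrightarrow> lim (grid_sum f)" if "continuous_on UNIV f" for f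
    using grid_sum_convergent[OF that] unfolding convergent_LIMSEQ_iff .
  interpret R: compact_positive_functional "centered_square K" "\<lambda>f. lim (grid_sum f)"
  proof
    show "compact (centered_square K)" by (rule compact_centered_square)
    fix f g :: "complex \<Rightarrow> real" and c
    assume f: "continuous_on UNIV f"
    show "lim (grid_sum (\<lambda>x. c * f x)) = c * lim (grid_sum f)"
      using tendsto_mult_left[OF lim[OF f], of c] by (intro limI) (simp add: grid_sum_scale[abs_def])
    show "0 \<le> lim (grid_sum f)" if "\<And>x. x \<in> centered_square K \<Longrightarrow> 0 \<le> f x"
    proof (rule LIMSEQ_le_const[OF lim[OF f]])
      have "0 \<le> grid_sum f n" if "n \<ge> 1" for n
        using grid_sum_mono[of n "\<lambda>_. 0" f] that \<open>\<And>x. x \<in> centered_square K \<Longrightarrow> 0 \<le> f x\<close> by (simp add: grid_sum_def)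
      then show "\<exists>N. \<forall>n\<ge>N. 0 \<le> grid_sum f n" by blast
    qed
    assume g: "continuous_on UNIV g"
    show "lim (grid_sum (\<lambda>x. f x + g x)) = lim (grid_sum f) + lim (grid_sum g)"
      using tendsto_add[OF lim[OF f] lim[OF g]] by (intro limI) (simp add: grid_sum_add[abs_def])
  qed
  have "(\<integral>l. eval_poly p l \<partial>R.riesz_measure) = L p" for p
    using R.integral_riesz_measure[OF continuous_eval_poly, of p] limI[OF grid_sum_poly, of p] by simp
  then show ?thesis
    using R.finite_riesz_measure R.emeasure_riesz_measure_outside R.sets_riesz_measure by blast
qed

end

section \<open>Bounded operators on a Hilbert space\<close>

lemma mult_cnj_eq_norm_sq: "c * cnj c = (complex_of_real (cmod c))\<^sup>2"
  using complex_norm_square[of c] by simp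

context hilbert_space
begin

abbreviation V :: "'a set" where "V \<equiv> hcarrier H"
abbreviation ip :: "'a \<Rightarrow> 'a \<Rightarrow> complex" where "ip \<equiv> hinner H"
abbreviation nrm :: "'a \<Rightarrow> real" where "nrm \<equiv> hnorm H"
abbreviation ops :: "('a \<Rightarrow> 'a) set" where "ops \<equiv> bounded_ops H"

lemmas closed_simps[simp] = zero_closed add_closed scale_closed

lemma diff_closed[simp]: "\<lbrakk>x \<in> V; y \<in> V\<rbrakk> \<Longrightarrow> hdiff H x y \<in> V"
  by (simp add: hdiff_def)

lemma inner_add_right: "\<lbrakk>x \<in> V; y \<in> V; z \<in> V\<rbrakk> \<Longrightarrow> ip x (hadd H y z) = ip x y + ip x z"
  using inner_commute[of "hadd H y z" x] inner_commute[of y x] inner_commute[of z x] inner_add[of y z x]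
  by simp

lemma inner_scale_right: "\<lbrakk>x \<in> V; y \<in> V\<rbrakk> \<Longrightarrow> ip x (hscale H c y) = cnj c * ip x y"
  using inner_commute[of "hscale H c y" x] inner_commute[of y x] inner_scale[of y x c] by simp

lemma inner_zero: "y \<in> V \<Longrightarrow> ip (hzero H) y = 0"
  using inner_add[of "hzero H" "hzero H" y] add_zero[of "hzero H"] by simp

lemma inner_zero_right: "y \<in> V \<Longrightarrow> ip y (hzero H) = 0"
  using inner_commute[of "hzero H" y] inner_zero[of y] by simp

lemma inner_diff: "\<lbrakk>x \<in> V; y \<in> V; z \<in> V\<rbrakk> \<Longrightarrow> ip (hdiff H x y) z = ip x z - ip y z"
  by (simp add: hdiff_def inner_add inner_scale)

lemma inner_diff_right: "\<lbrakk>x \<in> V; y \<in> V; z \<in> V\<rbrakk> \<Longrightarrow> ip x (hdiff H y z) = ip x y - ip x z"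
  by (simp add: hdiff_def inner_add_right inner_scale_right)

lemmas inner_simps = inner_add inner_add_right inner_scale inner_scale_right inner_zero
  inner_zero_right inner_diff inner_diff_right

lemma diff_eq_zero: assumes "x \<in> V" "y \<in> V" "hdiff H x y = hzero H" shows "x = y"
proof -
  have "hadd H (hscale H (-1) y) y = hzero H"
    using add_minus[OF assms(2)] assms by (simp add: hdiff_def add_commute)
  then have "x = hadd H x (hadd H (hscale H (-1) y) y)" using assms by (simp add: add_zero)
  also have "\<dots> = hadd H (hdiff H x y) y"
    unfolding hdiff_def using assms(1,2) by (intro add_assoc[symmetric]) auto
  also have "\<dots> = y" using assms by (simp add: add_commute add_zero)
  finally show ?thesis .
qed

text \<open>The record operations form no instance of an algebraic type class, so vector identities are
  verified after taking inner products, as identities between complex numbers.\<close>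
lemma vector_eqI:
  assumes "x \<in> V" "y \<in> V" "\<And>z. z \<in> V \<Longrightarrow> ip x z = ip y z" shows "x = y"
proof (rule diff_eq_zero)
  have "ip (hdiff H x y) (hdiff H x y) = 0" using assms by (simp add: inner_diff)
  then show "hdiff H x y = hzero H" using assms by (intro inner_definite) auto
qed (use assms in auto)

lemma hnorm_nonneg[simp]: "x \<in> V \<Longrightarrow> 0 \<le> nrm x"
  by (simp add: hnorm_def inner_nonneg)

lemma inner_self: "x \<in> V \<Longrightarrow> ip x x = of_real ((nrm x)\<^sup>2)"
  using inner_commute[of x x] inner_nonneg[of x] by (simp add: hnorm_def complex_eq_iff)

lemma hnorm_sq: "x \<in> V \<Longrightarrow> (nrm x)\<^sup>2 = Re (ip x x)"
  by (simp add: inner_self)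

lemma hnorm_zero: "nrm (hzero H) = 0"
  by (simp add: hnorm_def inner_zero)

lemma hnorm_eq_zero: "x \<in> V \<Longrightarrow> nrm x = 0 \<Longrightarrow> x = hzero H"
  using inner_self[of x] by (intro inner_definite) auto

lemma hnorm_scale: "x \<in> V \<Longrightarrow> nrm (hscale H c x) = cmod c * nrm x"
proof -
  assume x: "x \<in> V"
  have "ip (hscale H c x) (hscale H c x) = of_real ((cmod c * nrm x)\<^sup>2)"
    unfolding inner_scale[OF x scale_closed[OF x]] inner_scale_right[OF x x] inner_self[OF x]
    by (simp add: power_mult_distrib mult_cnj_eq_norm_sq)
  then have "Re (ip (hscale H c x) (hscale H c x)) = (cmod c * nrm x)\<^sup>2"
    by (metis Re_complex_of_real)
  then show ?thesis using x by (simp add: hnorm_def[of H "hscale H c x"] hnorm_nonneg)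
qed

lemma Cauchy_Schwarz: "x \<in> V \<Longrightarrow> y \<in> V \<Longrightarrow> cmod (ip x y) \<le> nrm x * nrm y"
proof -
  assume x: "x \<in> V" and y: "y \<in> V"
  show ?thesis
  proof (cases "nrm y = 0")
    case True
    then show ?thesis using hnorm_eq_zero[OF y] x by (simp add: inner_zero_right)
  next
    case False
    then have y0: "(nrm y)\<^sup>2 > 0" by simp
    define c where "c = ip x y / of_real ((nrm y)\<^sup>2)"
    let ?z = "hdiff H x (hscale H c y)"
    have yy: "ip y y = of_real ((nrm y)\<^sup>2)" by (rule inner_self[OF y])
    have yx: "ip y x = cnj (ip x y)" by (rule inner_commute[OF x y])
    have "ip ?z ?z = ip x x - cnj c * ip x y - c * cnj (ip x y) + c * cnj c * of_real ((nrm y)\<^sup>2)"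
      using x y by (simp add: inner_simps yx yy algebra_simps)
    also have "c * cnj c * of_real ((nrm y)\<^sup>2) = c * cnj (ip x y)"
    proof -
      have "complex_of_real ((nrm y)\<^sup>2) \<noteq> 0" using False by simp
      then show ?thesis by (simp only: c_def complex_cnj_divide complex_cnj_complex_of_real) (simp add: field_simps)
    qed
    also have "cnj c * ip x y = of_real ((cmod (ip x y))\<^sup>2 / (nrm y)\<^sup>2)"
      by (simp add: c_def mult_cnj_eq_norm_sq mult.commute)
    finally have "ip ?z ?z = ip x x - of_real ((cmod (ip x y))\<^sup>2 / (nrm y)\<^sup>2)" by simp
    then have "Re (ip ?z ?z) = (nrm x)\<^sup>2 - (cmod (ip x y))\<^sup>2 / (nrm y)\<^sup>2"
      using x by (simp only: inner_self minus_complex.sel Re_complex_of_real)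
    moreover have "0 \<le> Re (ip ?z ?z)" using x y by (intro inner_nonneg) auto
    ultimately have "(cmod (ip x y))\<^sup>2 / (nrm y)\<^sup>2 \<le> (nrm x)\<^sup>2" by linarith
    then have "(cmod (ip x y))\<^sup>2 \<le> (nrm x)\<^sup>2 * (nrm y)\<^sup>2"
      using y0 by (simp only: pos_divide_le_eq)
    then have "(cmod (ip x y))\<^sup>2 \<le> (nrm x * nrm y)\<^sup>2" by (simp add: power_mult_distrib)
    then show ?thesis by (rule power2_le_imp_le) (use x y in simp)
  qed
qed

lemma hnorm_add_sq: "x \<in> V \<Longrightarrow> y \<in> V \<Longrightarrow> (nrm (hadd H x y))\<^sup>2 = (nrm x)\<^sup>2 + 2 * Re (ip x y) + (nrm y)\<^sup>2"
  using inner_commute[of x y] by (simp add: hnorm_sq inner_simps)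

lemma hnorm_diff_sq: "x \<in> V \<Longrightarrow> y \<in> V \<Longrightarrow> (nrm (hdiff H x y))\<^sup>2 = (nrm x)\<^sup>2 - 2 * Re (ip x y) + (nrm y)\<^sup>2"
  using inner_commute[of x y] by (simp add: hnorm_sq inner_simps)

lemma hnorm_triangle: "x \<in> V \<Longrightarrow> y \<in> V \<Longrightarrow> nrm (hadd H x y) \<le> nrm x + nrm y"
proof (rule power2_le_imp_le)
  assume x: "x \<in> V" and y: "y \<in> V"
  have "Re (ip x y) \<le> nrm x * nrm y"
    using complex_Re_le_cmod[of "ip x y"] Cauchy_Schwarz[OF x y] by simp
  then show "(nrm (hadd H x y))\<^sup>2 \<le> (nrm x + nrm y)\<^sup>2"
    using hnorm_add_sq[OF x y] by (simp add: power2_sum)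
qed auto

lemma hnorm_minus_commute: "x \<in> V \<Longrightarrow> y \<in> V \<Longrightarrow> nrm (hdiff H x y) = nrm (hdiff H y x)"
  using inner_commute[of x y] by (simp add: hnorm_def inner_simps)

lemma tendsto_inner:
  assumes "\<And>n. s n \<in> V" "l \<in> V" "y \<in> V" "(\<lambda>n. nrm (hdiff H (s n) l)) \<longlonglongrightarrow> 0"
  shows "(\<lambda>n. ip (s n) y) \<longlonglongrightarrow> ip l y"
proof -
  have "(\<lambda>n. ip (s n) y - ip l y) \<longlonglongrightarrow> 0"
  proof (rule Lim_null_comparison)
    show "\<forall>\<^sub>F n in sequentially. norm (ip (s n) y - ip l y) \<le> nrm (hdiff H (s n) l) * nrm y"
      using assms Cauchy_Schwarz[of "hdiff H (s _) l" y] by (simp add: inner_diff)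
    show "(\<lambda>n. nrm (hdiff H (s n) l) * nrm y) \<longlonglongrightarrow> 0"
      using tendsto_mult_right[OF assms(4), of "nrm y"] by simp
  qed
  then show ?thesis by (simp add: LIM_zero_iff)
qed

lemma op_closed[simp]: "T \<in> ops \<Longrightarrow> x \<in> V \<Longrightarrow> T x \<in> V"
  by (auto simp: bounded_ops_def)

lemma op_add: "T \<in> ops \<Longrightarrow> x \<in> V \<Longrightarrow> y \<in> V \<Longrightarrow> T (hadd H x y) = hadd H (T x) (T y)"
  by (auto simp: bounded_ops_def)

lemma op_scale: "T \<in> ops \<Longrightarrow> x \<in> V \<Longrightarrow> T (hscale H c x) = hscale H c (T x)"
  by (auto simp: bounded_ops_def)

lemma op_extensional: "T \<in> ops \<Longrightarrow> T \<in> extensional V"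
  unfolding bounded_ops_def PiE_def by blast

lemma op_bound:
  assumes "T \<in> ops" obtains K where "0 \<le> K" "\<And>x. x \<in> V \<Longrightarrow> nrm (T x) \<le> K * nrm x"
proof -
  obtain K where K: "\<And>x. x \<in> V \<Longrightarrow> nrm (T x) \<le> K * nrm x"
    using assms unfolding bounded_ops_def by blast
  have "nrm (T x) \<le> max K 0 * nrm x" if "x \<in> V" for x
    using K[OF that] mult_right_mono[of K "max K 0" "nrm x"] that by simp
  then show ?thesis by (intro that[of "max K 0"]) auto
qed

lemma opI:
  assumes "\<And>x. x \<in> V \<Longrightarrow> T x \<in> V" "T \<in> extensional V"
    and "\<And>x y. x \<in> V \<Longrightarrow> y \<in> V \<Longrightarrow> T (hadd H x y) = hadd H (T x) (T y)"
    and "\<And>c x. x \<in> V \<Longrightarrow> T (hscale H c x) = hscale H c (T x)"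
    and "\<And>x. x \<in> V \<Longrightarrow> nrm (T x) \<le> K * nrm x"
  shows "T \<in> ops"
proof -
  have "T \<in> V \<rightarrow>\<^sub>E V" using assms(1,2) by (simp add: PiE_def)
  moreover have "\<exists>K. \<forall>x\<in>V. nrm (T x) \<le> K * nrm x" using assms(5) by blast
  ultimately show ?thesis unfolding bounded_ops_def using assms(3,4) by simp
qed

lemma op_eqI: "S \<in> ops \<Longrightarrow> T \<in> ops \<Longrightarrow> (\<And>x. x \<in> V \<Longrightarrow> S x = T x) \<Longrightarrow> S = T"
  by (rule extensionalityI[OF op_extensional op_extensional])

lemma op_eqI_inner:
  "S \<in> ops \<Longrightarrow> T \<in> ops \<Longrightarrow> (\<And>x y. x \<in> V \<Longrightarrow> y \<in> V \<Longrightarrow> ip (S x) y = ip (T x) y) \<Longrightarrow> S = T"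
  by (rule op_eqI) (simp_all add: vector_eqI)

lemma id_in_ops[simp]: "id_op H \<in> ops"
  by (rule opI[where K=1]) (auto simp: id_op_def)

lemma id_op_apply[simp]: "x \<in> V \<Longrightarrow> id_op H x = x"
  by (simp add: id_op_def)

lemma comp_op_apply[simp]: "x \<in> V \<Longrightarrow> comp_op H S T x = S (T x)"
  by (simp add: comp_op_def compose_def)

lemma comp_in_ops[simp]: "S \<in> ops \<Longrightarrow> T \<in> ops \<Longrightarrow> comp_op H S T \<in> ops"
proof -
  assume S: "S \<in> ops" and T: "T \<in> ops"
  obtain K where K: "0 \<le> K" "\<And>x. x \<in> V \<Longrightarrow> nrm (S x) \<le> K * nrm x" by (rule op_bound[OF S]) blast
  obtain L where L: "0 \<le> L" "\<And>x. x \<in> V \<Longrightarrow> nrm (T x) \<le> L * nrm x" by (rule op_bound[OF T]) blast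
  show ?thesis
  proof (rule opI[where K="K * L"])
    fix x assume x: "x \<in> V"
    have "nrm (S (T x)) \<le> K * nrm (T x)" using K x T by simp
    also have "\<dots> \<le> K * (L * nrm x)" using L x K by (intro mult_left_mono) auto
    finally show "nrm (comp_op H S T x) \<le> K * L * nrm x" using x by (simp add: mult.assoc)
  qed (use S T in \<open>auto simp: op_add op_scale comp_op_def compose_def\<close>)
qed

definition add_op :: "('a \<Rightarrow> 'a) \<Rightarrow> ('a \<Rightarrow> 'a) \<Rightarrow> 'a \<Rightarrow> 'a" where
  "add_op S T = (\<lambda>x\<in>V. hadd H (S x) (T x))"

definition scale_op :: "complex \<Rightarrow> ('a \<Rightarrow> 'a) \<Rightarrow> 'a \<Rightarrow> 'a" where
  "scale_op c T = (\<lambda>x\<in>V. hscale H c (T x))"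

lemma add_op_apply[simp]: "x \<in> V \<Longrightarrow> add_op S T x = hadd H (S x) (T x)"
  by (simp add: add_op_def)

lemma scale_op_apply[simp]: "x \<in> V \<Longrightarrow> scale_op c T x = hscale H c (T x)"
  by (simp add: scale_op_def)

lemma add_in_ops[simp]: "S \<in> ops \<Longrightarrow> T \<in> ops \<Longrightarrow> add_op S T \<in> ops"
proof -
  assume S: "S \<in> ops" and T: "T \<in> ops"
  obtain K where K: "0 \<le> K" "\<And>x. x \<in> V \<Longrightarrow> nrm (S x) \<le> K * nrm x" by (rule op_bound[OF S]) blast
  obtain L where L: "0 \<le> L" "\<And>x. x \<in> V \<Longrightarrow> nrm (T x) \<le> L * nrm x" by (rule op_bound[OF T]) blast
  show ?thesis
  proof (rule opI[where K="K + L"])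
    fix x assume x: "x \<in> V"
    have "nrm (hadd H (S x) (T x)) \<le> nrm (S x) + nrm (T x)" using x S T by (intro hnorm_triangle) auto
    also have "\<dots> \<le> (K + L) * nrm x" using K(2)[OF x] L(2)[OF x] by (simp add: distrib_right)
    finally show "nrm (add_op S T x) \<le> (K + L) * nrm x" using x by simp
  next
    fix x y assume "x \<in> V" "y \<in> V"
    then show "add_op S T (hadd H x y) = hadd H (add_op S T x) (add_op S T y)"
      using S T by (intro vector_eqI) (auto simp: op_add inner_simps)
  next
    fix c x assume "x \<in> V"
    then show "add_op S T (hscale H c x) = hscale H c (add_op S T x)"
      using S T by (intro vector_eqI) (auto simp: op_scale inner_simps algebra_simps)
  qed (use S T in \<open>auto simp: add_op_def\<close>)
qed

lemma scale_in_ops[simp]: "T \<in> ops \<Longrightarrow> scale_op c T \<in> ops"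
proof -
  assume T: "T \<in> ops"
  obtain L where L: "0 \<le> L" "\<And>x. x \<in> V \<Longrightarrow> nrm (T x) \<le> L * nrm x" by (rule op_bound[OF T]) blast
  show ?thesis
  proof (rule opI[where K="cmod c * L"])
    fix x assume x: "x \<in> V"
    show "nrm (scale_op c T x) \<le> cmod c * L * nrm x"
      using x T L(2)[OF x] by (simp add: hnorm_scale mult.assoc mult_left_mono)
  next
    fix x y assume "x \<in> V" "y \<in> V"
    then show "scale_op c T (hadd H x y) = hadd H (scale_op c T x) (scale_op c T y)"
      using T by (intro vector_eqI) (auto simp: op_add inner_simps algebra_simps)
  next
    fix d x assume "x \<in> V"
    then show "scale_op c T (hscale H d x) = hscale H d (scale_op c T x)"
      using T by (intro vector_eqI) (auto simp: op_scale inner_simps algebra_simps)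
  qed (use T in \<open>auto simp: scale_op_def\<close>)
qed

text \<open>The representing vector is the minimizer of \<open>F x = \<parallel>x\<parallel>\<^sup>2 - 2 Re (\<phi> x)\<close>, as the vanishing of the
  derivative of \<open>F\<close> says that \<open>Re \<langle>x, v\<rangle> = Re (\<phi> x)\<close>. By the parallelogram law a minimizing sequence
  is Cauchy.\<close>
lemma riesz_representation:
  assumes cl: "\<And>x y. x \<in> V \<Longrightarrow> y \<in> V \<Longrightarrow> \<phi> (hadd H x y) = \<phi> x + \<phi> y"
    and sc: "\<And>c x. x \<in> V \<Longrightarrow> \<phi> (hscale H c x) = c * \<phi> x"
    and bd: "\<And>x. x \<in> V \<Longrightarrow> cmod (\<phi> x) \<le> K * nrm x"
  shows "\<exists>v\<in>V. \<forall>x\<in>V. \<phi> x = ip x v"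
proof -
  define F where "F x = (nrm x)\<^sup>2 - 2 * Re (\<phi> x)" for x
  have lower: "- K\<^sup>2 \<le> F x" if "x \<in> V" for x
  proof -
    have "Re (\<phi> x) \<le> K * nrm x" using complex_Re_le_cmod[of "\<phi> x"] bd[OF that] by simp
    moreover have "0 \<le> (nrm x - K)\<^sup>2" by simp
    ultimately show ?thesis unfolding F_def power2_diff by (simp add: mult_ac)
  qed
  define m where "m = Inf (F ` V)"
  have bdd: "bdd_below (F ` V)" using lower by (auto simp: bdd_below_def)
  have ne: "F ` V \<noteq> {}" using zero_closed by blast
  have m_le: "m \<le> F x" if "x \<in> V" for x
    unfolding m_def using bdd that by (intro cInf_lower) auto
  have "\<exists>x\<in>V. F x < m + 1 / real (Suc n)" for n
    using cInf_lessD[OF ne, of "m + 1 / real (Suc n)"] by (auto simp: m_def)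
  then obtain s where s: "\<And>n. s n \<in> V" "\<And>n. F (s n) < m + 1 / real (Suc n)" by metis
  have par: "(nrm (hdiff H x y))\<^sup>2 \<le> 2 * (F x - m) + 2 * (F y - m)" if x: "x \<in> V" and y: "y \<in> V" for x y
  proof -
    let ?h = "hscale H (1/2) (hadd H x y)"
    have h1: "\<phi> ?h = (\<phi> x + \<phi> y) / 2" using x y by (simp add: cl sc)
    have h2: "nrm ?h = nrm (hadd H x y) / 2" using x y by (simp add: hnorm_scale)
    have "F ?h = (nrm (hadd H x y))\<^sup>2 / 4 - Re (\<phi> x) - Re (\<phi> y)"
      unfolding F_def h1 h2 by (simp add: power_divide add_divide_distrib)
    then have "m \<le> ((nrm x)\<^sup>2 + 2 * Re (ip x y) + (nrm y)\<^sup>2) / 4 - Re (\<phi> x) - Re (\<phi> y)"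
      using m_le[of ?h] x y by (simp add: hnorm_add_sq)
    moreover have "m \<le> (a + 2 * b + c) / 4 - p - q \<Longrightarrow> a - 2 * b + c \<le> 2 * (a - 2 * p - m) + 2 * (c - 2 * q - m)"
      for a b c p q :: real by (simp add: field_simps)
    ultimately show ?thesis unfolding hnorm_diff_sq[OF x y] F_def by blast
  qed
  have "\<exists>N. \<forall>i\<ge>N. \<forall>j\<ge>N. nrm (hdiff H (s i) (s j)) < e" if e: "0 < e" for e
  proof -
    obtain N where N: "inverse (real (Suc N)) < e\<^sup>2 / 4"
      using reals_Archimedean[of "e\<^sup>2 / 4"] e by auto
    have "nrm (hdiff H (s i) (s j)) < e" if ij: "i \<ge> N" "j \<ge> N" for i j
    proof (rule power2_less_imp_less)
      have "F (s k) - m < e\<^sup>2 / 4" if "k \<ge> N" for k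
      proof -
        have "1 / real (Suc k) \<le> 1 / real (Suc N)" using that by (intro divide_left_mono) auto
        then show ?thesis using s(2)[of k] N by (simp add: inverse_eq_divide)
      qed
      from this[OF ij(1)] this[OF ij(2)] show "(nrm (hdiff H (s i) (s j)))\<^sup>2 < e\<^sup>2"
        using par[OF s(1)[of i] s(1)[of j]] by simp
    qed (use e in auto)
    then show ?thesis by blast
  qed
  from complete[OF s(1) this] obtain v where v: "v \<in> V" "(\<lambda>n. nrm (hdiff H (s n) v)) \<longlonglongrightarrow> 0" by blast
  have \<phi>d: "\<phi> (hdiff H x y) = \<phi> x - \<phi> y" if "x \<in> V" "y \<in> V" for x y
    using that by (simp add: hdiff_def cl sc)
  have Flim: "F v \<le> m"
  proof -
    have "(\<lambda>n. ip (s n) v) \<longlonglongrightarrow> ip v v" by (rule tendsto_inner[OF s(1) v(1) v(1) v(2)])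
    then have l1: "(\<lambda>n. Re (ip (s n) v)) \<longlonglongrightarrow> (nrm v)\<^sup>2" using v(1) by (auto intro!: tendsto_Re simp: hnorm_sq)
    have l2: "(\<lambda>n. Re (\<phi> (s n))) \<longlonglongrightarrow> Re (\<phi> v)"
    proof -
      have "(\<lambda>n. \<phi> (s n) - \<phi> v) \<longlonglongrightarrow> 0"
      proof (rule Lim_null_comparison)
        show "\<forall>\<^sub>F n in sequentially. norm (\<phi> (s n) - \<phi> v) \<le> K * nrm (hdiff H (s n) v)"
          using s(1) v(1) bd[of "hdiff H (s _) v"] by (simp add: \<phi>d)
        show "(\<lambda>n. K * nrm (hdiff H (s n) v)) \<longlonglongrightarrow> 0"
          using tendsto_mult_left[OF v(2), of K] by simp
      qed
      then show ?thesis by (auto intro!: tendsto_Re simp: LIM_zero_iff)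
    qed
    have "F v \<le> F (s n) + 2 * Re (\<phi> (s n)) - 2 * Re (\<phi> v) + 2 * ((nrm v)\<^sup>2 - Re (ip (s n) v))" for n
    proof -
      have "0 \<le> (nrm (hdiff H (s n) v))\<^sup>2" by simp
      moreover have "0 \<le> a - 2 * b + c \<Longrightarrow> c - 2 * p \<le> a - 2 * q + 2 * q - 2 * p + 2 * (c - b)"
        for a b c p q :: real by simp
      ultimately show ?thesis unfolding hnorm_diff_sq[OF s(1) v(1)] F_def by blast
    qed
    then have *: "F v \<le> m + 1 / real (Suc n) + 2 * Re (\<phi> (s n)) - 2 * Re (\<phi> v) + 2 * ((nrm v)\<^sup>2 - Re (ip (s n) v))" for n
      using s(2)[of n] by (meson add_right_mono diff_right_mono less_imp_le order_trans)
    have "(\<lambda>n. m + 1 / real (Suc n) + 2 * Re (\<phi> (s n)) - 2 * Re (\<phi> v) + 2 * ((nrm v)\<^sup>2 - Re (ip (s n) v)))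
        \<longlonglongrightarrow> m + 0 + 2 * Re (\<phi> v) - 2 * Re (\<phi> v) + 2 * ((nrm v)\<^sup>2 - (nrm v)\<^sup>2)"
      using LIMSEQ_inverse_real_of_nat
      by (intro tendsto_intros l1 l2) (simp add: inverse_eq_divide)
    then have "F v \<le> m + 0 + 2 * Re (\<phi> v) - 2 * Re (\<phi> v) + 2 * ((nrm v)\<^sup>2 - (nrm v)\<^sup>2)"
      by (rule LIMSEQ_le_const) (use * in blast)
    then show ?thesis by simp
  qed
  have main: "Re (ip x v) = Re (\<phi> x)" if x: "x \<in> V" for x
  proof -
    define b where "b = Re (ip v x) - Re (\<phi> x)"
    have quad: "0 \<le> 2 * t * b + t\<^sup>2 * (nrm x)\<^sup>2" for t
    proof -
      have "F v \<le> F (hadd H v (hscale H (of_real t) x))" using Flim m_le x v(1) by (meson add_closed order_trans scale_closed)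
      then show ?thesis using x v(1)
        by (simp add: F_def hnorm_add_sq cl sc inner_simps hnorm_scale power_mult_distrib b_def algebra_simps)
    qed
    have "b = 0"
    proof (rule ccontr)
      assume b: "b \<noteq> 0"
      define N where "N = (nrm x)\<^sup>2 + 1"
      have N: "N > 0" "(nrm x)\<^sup>2 \<le> N" by (auto simp: N_def intro: add_nonneg_pos)
      have "0 \<le> 2 * (- b / N) * b + (- b / N)\<^sup>2 * (nrm x)\<^sup>2" by (rule quad)
      also have "\<dots> \<le> 2 * (- b / N) * b + (- b / N)\<^sup>2 * N" by (intro add_left_mono mult_left_mono N(2)) simp
      also have "\<dots> = - (b\<^sup>2 / N)" using N by (simp add: field_simps power2_eq_square)
      also have "\<dots> < 0" using b N by simp
      finally show False by simp
    qed
    then show ?thesis using inner_commute[OF x v(1)] by (simp add: b_def)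
  qed
  have "\<phi> x = ip x v" if x: "x \<in> V" for x
  proof -
    have "Im (ip x v) = Im (\<phi> x)"
      using main[of "hscale H (-\<i>) x"] x v(1) by (simp add: inner_simps sc)
    then show ?thesis using main[OF x] by (simp add: complex_eq_iff)
  qed
  then show ?thesis using v(1) by blast
qed

text \<open>Lax-Milgram style: the Riesz vector of \<open>y \<mapsto> cnj (B x y)\<close> depends linearly on \<open>x\<close>.\<close>
lemma bounded_form_operator:
  assumes "\<And>x x' y. x \<in> V \<Longrightarrow> x' \<in> V \<Longrightarrow> y \<in> V \<Longrightarrow> B (hadd H x x') y = B x y + B x' y"
    and "\<And>c x y. x \<in> V \<Longrightarrow> y \<in> V \<Longrightarrow> B (hscale H c x) y = c * B x y"
    and "\<And>x y y'. x \<in> V \<Longrightarrow> y \<in> V \<Longrightarrow> y' \<in> V \<Longrightarrow> B x (hadd H y y') = B x y + B x y'"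
    and "\<And>c x y. x \<in> V \<Longrightarrow> y \<in> V \<Longrightarrow> B x (hscale H c y) = cnj c * B x y"
    and bd: "\<And>x y. x \<in> V \<Longrightarrow> y \<in> V \<Longrightarrow> cmod (B x y) \<le> K * nrm x * nrm y"
  shows "\<exists>R\<in>ops. \<forall>x\<in>V. \<forall>y\<in>V. ip (R x) y = B x y"
proof -
  have "\<exists>v\<in>V. \<forall>y\<in>V. cnj (B x y) = ip y v" if "x \<in> V" for x
    by (rule riesz_representation[where K="K * nrm x"]) (use assms that in auto)
  then obtain f where f: "\<And>x. x \<in> V \<Longrightarrow> f x \<in> V" "\<And>x y. x \<in> V \<Longrightarrow> y \<in> V \<Longrightarrow> cnj (B x y) = ip y (f x)"
    by metis
  define R where "R = (\<lambda>x\<in>V. f x)"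
  have R: "ip (R x) y = B x y" "R x \<in> V" if "x \<in> V" "y \<in> V" for x y
    using f(2)[OF that] inner_commute[of y "f x"] f(1) that by (auto simp: R_def) (metis complex_cnj_cnj)
  have "R \<in> ops"
  proof (rule opI[where K=K])
    fix x assume x: "x \<in> V"
    show Rx: "R x \<in> V" using R(2)[OF x x] .
    have "(nrm (R x))\<^sup>2 = cmod (ip (R x) (R x))" unfolding inner_self[OF Rx] norm_of_real by simp
    also have "\<dots> \<le> K * nrm x * nrm (R x)" using R(1)[OF x Rx] bd[OF x Rx] by simp
    finally have "nrm (R x) * nrm (R x) \<le> K * nrm x * nrm (R x)" by (simp add: power2_eq_square)
    moreover have "0 \<le> K * nrm x"
    proof (cases "nrm x = 0")
      case False
      have "0 * nrm x \<le> (K * nrm x) * nrm x" using bd[OF x x] by (simp, meson norm_ge_zero order_trans)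
      moreover have "0 < nrm x" using False x by (simp add: less_le)
      ultimately show ?thesis by (simp only: mult_le_cancel_right_pos)
    qed simp
    ultimately show "nrm (R x) \<le> K * nrm x"
      using hnorm_nonneg[OF Rx] by (cases "nrm (R x) = 0") (auto simp: mult_le_cancel_right)
  next
    fix x y assume "x \<in> V" "y \<in> V"
    then show "R (hadd H x y) = hadd H (R x) (R y)"
      by (intro vector_eqI) (auto simp: R assms inner_simps)
  next
    fix c x assume "x \<in> V"
    then show "R (hscale H c x) = hscale H c (R x)"
      by (intro vector_eqI) (auto simp: R assms inner_simps)
  qed (simp add: R_def)
  then show ?thesis using R by blast
qed

lemma adjoint_eqI:
  assumes "T' \<in> ops" "T \<in> ops" "\<And>x y. x \<in> V \<Longrightarrow> y \<in> V \<Longrightarrow> ip (T x) y = ip x (T' y)"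
  shows "adjoint_op H T = T'"
  unfolding adjoint_op_def
proof (rule the_equality)
  fix S assume S: "S \<in> ops \<and> (\<forall>x\<in>V. \<forall>y\<in>V. ip (T x) y = ip x (S y))"
  show "S = T'"
  proof (rule op_eqI_inner)
    fix x y assume xy: "x \<in> V" "y \<in> V"
    have "ip y (S x) = ip y (T' x)" using assms S xy by metis
    then show "ip (S x) y = ip (T' x) y"
      using inner_commute[of y "S x"] inner_commute[of y "T' x"] xy S assms by simp
  qed (use S assms in auto)
qed (use assms in auto)

lemma adjoint_exists: "T \<in> ops \<Longrightarrow> \<exists>T'\<in>ops. \<forall>x\<in>V. \<forall>y\<in>V. ip (T x) y = ip x (T' y)"
proof -
  assume T: "T \<in> ops"
  obtain K where K: "0 \<le> K" "\<And>x. x \<in> V \<Longrightarrow> nrm (T x) \<le> K * nrm x" by (rule op_bound[OF T]) blast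
  have "\<exists>R\<in>ops. \<forall>x\<in>V. \<forall>y\<in>V. ip (R x) y = ip x (T y)"
  proof (rule bounded_form_operator[where K=K])
    fix x y assume x: "x \<in> V" and y: "y \<in> V"
    have "cmod (ip x (T y)) \<le> nrm x * nrm (T y)" using x y T by (intro Cauchy_Schwarz) auto
    also have "\<dots> \<le> nrm x * (K * nrm y)" using x K(2)[OF y] by (intro mult_left_mono) auto
    finally show "cmod (ip x (T y)) \<le> K * nrm x * nrm y" by (simp add: mult_ac)
  qed (use T in \<open>auto simp: op_add op_scale inner_simps\<close>)
  then obtain R where R: "R \<in> ops" "\<And>x y. x \<in> V \<Longrightarrow> y \<in> V \<Longrightarrow> ip (R x) y = ip x (T y)" by blast
  have "ip (T x) y = ip x (R y)" if "x \<in> V" "y \<in> V" for x y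
    using R(2)[of y x] inner_commute[of y "T x"] inner_commute[of "R y" x] that T R(1) by simp
  then show ?thesis using R(1) by blast
qed

lemma adjoint_in_ops[simp]: "T \<in> ops \<Longrightarrow> adjoint_op H T \<in> ops"
  and adjoint_inner: "T \<in> ops \<Longrightarrow> x \<in> V \<Longrightarrow> y \<in> V \<Longrightarrow> ip (T x) y = ip x (adjoint_op H T y)"
  using adjoint_exists[of T] adjoint_eqI[of _ T] by metis+

lemma adjoint_inner_left: "T \<in> ops \<Longrightarrow> x \<in> V \<Longrightarrow> y \<in> V \<Longrightarrow> ip (adjoint_op H T x) y = ip x (T y)"
  using adjoint_inner[of T y x] inner_commute[of "adjoint_op H T x" y] inner_commute[of x "T y"] by simp

lemma polarization:
  assumes "T \<in> ops" "x \<in> V" "y \<in> V"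
  defines "q c \<equiv> ip (T (hadd H x (hscale H c y))) (hadd H x (hscale H c y))"
  shows "4 * ip (T x) y = q 1 - q (-1) + \<i> * q \<i> - \<i> * q (-\<i>)"
  using assms by (simp add: q_def op_add op_scale inner_simps algebra_simps)

lemma op_eqI_diagonal:
  assumes "S \<in> ops" "T \<in> ops" "\<And>x. x \<in> V \<Longrightarrow> ip (S x) x = ip (T x) x"
  shows "S = T"
proof (rule op_eqI_inner)
  fix x y assume "x \<in> V" "y \<in> V"
  then have "4 * ip (S x) y = 4 * ip (T x) y"
    unfolding polarization[OF assms(1) \<open>x \<in> V\<close> \<open>y \<in> V\<close>] polarization[OF assms(2) \<open>x \<in> V\<close> \<open>y \<in> V\<close>]
    by (simp add: assms(3))
  then show "ip (S x) y = ip (T x) y" by simp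
qed fact+

lemma polarization_norm_sum:
  assumes "x \<in> V" "y \<in> V"
  shows "(nrm (hadd H x (hscale H 1 y)))\<^sup>2 + (nrm (hadd H x (hscale H (-1) y)))\<^sup>2
    + (nrm (hadd H x (hscale H \<i> y)))\<^sup>2 + (nrm (hadd H x (hscale H (-\<i>) y)))\<^sup>2
    = 4 * ((nrm x)\<^sup>2 + (nrm y)\<^sup>2)"
  using assms by (simp add: hnorm_add_sq hnorm_scale inner_simps)

text \<open>By polarization a bound on the quadratic form controls the sesquilinear form, and scaling \<open>T x\<close>
  to the length of \<open>x\<close> gives a norm bound (\<open>diagonal_bound_norm\<close>). The constant 2 is not optimal; what
  matters is a bound uniform over a family of operators.\<close>
lemma diagonal_bound:
  assumes T: "T \<in> ops" and c: "\<And>x. x \<in> V \<Longrightarrow> cmod (ip (T x) x) \<le> c * (nrm x)\<^sup>2"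
    and x: "x \<in> V" and y: "y \<in> V"
  shows "cmod (ip (T x) y) \<le> c * ((nrm x)\<^sup>2 + (nrm y)\<^sup>2)"
proof -
  define q where "q c = ip (T (hadd H x (hscale H c y))) (hadd H x (hscale H c y))" for c
  have q: "cmod (q d) \<le> c * (nrm (hadd H x (hscale H d y)))\<^sup>2" for d
    unfolding q_def using x y by (intro c) auto
  have "4 * cmod (ip (T x) y) = cmod (4 * ip (T x) y)" by (simp add: norm_mult)
  also have "\<dots> = cmod (q 1 - q (-1) + \<i> * q \<i> - \<i> * q (-\<i>))"
    using polarization[OF T x y] by (simp add: q_def)
  also have "\<dots> \<le> cmod (q 1) + cmod (q (-1)) + cmod (\<i> * q \<i>) + cmod (\<i> * q (-\<i>))"
    by (meson norm_triangle_ineq4 norm_triangle_ineq add_mono order_trans order_refl)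
  also have "\<dots> = cmod (q 1) + cmod (q (-1)) + cmod (q \<i>) + cmod (q (-\<i>))"
    by (simp add: norm_mult)
  also have "\<dots> \<le> c * (nrm (hadd H x (hscale H 1 y)))\<^sup>2 + c * (nrm (hadd H x (hscale H (-1) y)))\<^sup>2
    + c * (nrm (hadd H x (hscale H \<i> y)))\<^sup>2 + c * (nrm (hadd H x (hscale H (-\<i>) y)))\<^sup>2"
    by (intro add_mono q)
  also have "\<dots> = c * (4 * ((nrm x)\<^sup>2 + (nrm y)\<^sup>2))"
    unfolding polarization_norm_sum[OF x y, symmetric] by (simp only: distrib_left)
  finally have "4 * cmod (ip (T x) y) \<le> 4 * (c * ((nrm x)\<^sup>2 + (nrm y)\<^sup>2))" by (simp only: mult.left_commute)
  then show ?thesis by simp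
qed

lemma diagonal_bound_norm:
  assumes T: "T \<in> ops" and c: "\<And>x. x \<in> V \<Longrightarrow> cmod (ip (T x) x) \<le> c * (nrm x)\<^sup>2" and x: "x \<in> V"
  shows "nrm (T x) \<le> 2 * c * nrm x"
proof (cases "nrm (T x) = 0 \<or> nrm x = 0")
  case True
  have "0 \<le> 2 * c * nrm x"
  proof (cases "nrm x = 0")
    case False
    have "0 \<le> c * (nrm x)\<^sup>2" using c[OF x] by (meson norm_ge_zero order_trans)
    then show ?thesis using False x by (simp add: zero_le_mult_iff)
  qed simp
  moreover have "nrm (T x) = 0" using True
  proof
    assume "nrm x = 0"
    then have "x = hzero H" using x hnorm_eq_zero by simp
    then have "T x = hscale H 0 (T x)" using op_scale[OF T x, of 0] x
      by (metis T inner_definite inner_scale mult_zero_left op_closed scale_closed zero_closed)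
    then show ?thesis using hnorm_scale[of "T x" 0] T x by simp
  qed
  ultimately show ?thesis by simp
next
  case False
  let ?r = "nrm x / nrm (T x)"
  have Tx: "T x \<in> V" using T x by simp
  have "cmod (ip (T x) (hscale H (of_real ?r) (T x))) \<le> c * ((nrm x)\<^sup>2 + (nrm (hscale H (of_real ?r) (T x)))\<^sup>2)"
    using T x by (intro diagonal_bound[OF T c]) auto
  also have "nrm (hscale H (of_real ?r) (T x)) = nrm x"
    using False Tx x by (simp add: hnorm_scale norm_divide)
  also have "cmod (ip (T x) (hscale H (of_real ?r) (T x))) = nrm x * nrm (T x)"
    using False Tx x by (simp add: inner_simps inner_self norm_mult power2_eq_square)
  finally have "nrm x * nrm (T x) \<le> nrm x * (2 * c * nrm x)" by (simp add: power2_eq_square algebra_simps)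
  then show ?thesis using False x by (simp add: mult_le_cancel_left less_le)
qed

text \<open>Weak sequential completeness of the bounded operators, in terms of quadratic forms alone.
  Quadratic forms are what integrals against scalar measures compute, and polarization supplies
  the rest.\<close>
lemma weak_limit_operator:
  assumes R: "\<And>n. R n \<in> ops" and c: "\<And>n x. x \<in> V \<Longrightarrow> cmod (ip (R n x) x) \<le> c * (nrm x)\<^sup>2"
    and conv: "\<And>x. x \<in> V \<Longrightarrow> convergent (\<lambda>n. ip (R n x) x)"
  shows "\<exists>T\<in>ops. \<forall>x\<in>V. \<forall>y\<in>V. (\<lambda>n. ip (R n x) y) \<longlonglongrightarrow> ip (T x) y"
proof -
  define B where "B x y = lim (\<lambda>n. ip (R n x) y)" for x y
  have B: "(\<lambda>n. ip (R n x) y) \<longlonglongrightarrow> B x y" if x: "x \<in> V" and y: "y \<in> V" for x y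
  proof -
    define q where "q c n = ip (R n (hadd H x (hscale H c y))) (hadd H x (hscale H c y))" for c n
    have "convergent (\<lambda>n. q c n)" for c unfolding q_def using x y by (intro conv) auto
    then have q: "q c \<longlonglongrightarrow> lim (q c)" for c by (simp add: convergent_LIMSEQ_iff)
    have eq: "(\<lambda>n. ip (R n x) y) = (\<lambda>n. (q 1 n - q (-1) n + \<i> * q \<i> n - \<i> * q (-\<i>) n) / 4)"
      using polarization[OF R x y] by (simp add: q_def fun_eq_iff field_simps)
    have "convergent (\<lambda>n. ip (R n x) y)"
    proof (rule convergentI)
      show "(\<lambda>n. ip (R n x) y) \<longlonglongrightarrow> (lim (q 1) - lim (q (-1)) + \<i> * lim (q \<i>) - \<i> * lim (q (-\<i>))) / 4"
        unfolding eq by (intro tendsto_intros q) simp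
    qed
    then show ?thesis unfolding B_def by (rule convergent_LIMSEQ_iff[THEN iffD1])
  qed
  have bd: "nrm (R n x) \<le> 2 * c * nrm x" if "x \<in> V" for n x
    by (rule diagonal_bound_norm[OF R c that])
  have "\<exists>T\<in>ops. \<forall>x\<in>V. \<forall>y\<in>V. ip (T x) y = B x y"
  proof (rule bounded_form_operator[where K="2 * c"])
    fix x y z assume x: "x \<in> V" and y: "y \<in> V" and z: "z \<in> V"
    show "B (hadd H x y) z = B x z + B y z"
      using tendsto_add[OF B[OF x z] B[OF y z]] B[of "hadd H x y" z] x y z
      by (simp add: op_add[OF R] inner_simps op_closed[OF R] LIMSEQ_unique)
    show "B x (hadd H y z) = B x y + B x z"
      using tendsto_add[OF B[OF x y] B[OF x z]] B[of x "hadd H y z"] x y z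
      by (simp add: inner_simps op_closed[OF R] LIMSEQ_unique)
    fix d
    show "B (hscale H d x) y = d * B x y"
      using tendsto_mult_left[OF B[OF x y], of d] B[of "hscale H d x" y] x y
      by (simp add: op_scale[OF R] inner_simps op_closed[OF R] LIMSEQ_unique)
    show "B x (hscale H d y) = cnj d * B x y"
      using tendsto_mult_left[OF B[OF x y], of "cnj d"] B[of x "hscale H d y"] x y
      by (simp add: inner_simps op_closed[OF R] LIMSEQ_unique)
    show "cmod (B x y) \<le> 2 * c * nrm x * nrm y"
    proof (rule LIMSEQ_le_const2[OF tendsto_norm[OF B[OF x y]]], intro exI allI impI)
      fix n
      have "cmod (ip (R n x) y) \<le> nrm (R n x) * nrm y" using x y R by (intro Cauchy_Schwarz) auto
      also have "\<dots> \<le> 2 * c * nrm x * nrm y" using bd[OF x] y by (intro mult_right_mono) auto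
      finally show "cmod (ip (R n x) y) \<le> 2 * c * nrm x * nrm y" .
    qed
  qed
  then obtain T where T: "T \<in> ops" "\<And>x y. x \<in> V \<Longrightarrow> y \<in> V \<Longrightarrow> ip (T x) y = B x y" by blast
  have "(\<lambda>n. ip (R n x) y) \<longlonglongrightarrow> ip (T x) y" if "x \<in> V" "y \<in> V" for x y
    unfolding T(2)[OF that] by (rule B[OF that])
  then show ?thesis using T(1) by blast
qed

end

section \<open>Operators represented by integrals\<close>

context hilbert_space
begin

text \<open>This is the relation \<open>R = \<integral> f dE\<close>, expressed through the scalar measures. It makes sense before
  \<open>E\<close> is known, so the same lemmas serve for the construction of \<open>E\<close> and for its
  properties.\<close>

definition represents :: "('a \<Rightarrow> 'b measure) \<Rightarrow> ('a \<Rightarrow> 'a) \<Rightarrow> ('b \<Rightarrow> complex) \<Rightarrow> bool" where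
  "represents \<mu> R f \<longleftrightarrow> R \<in> ops \<and> (\<forall>x\<in>V. ip (R x) x = (\<integral>l. f l \<partial>\<mu> x))"

lemma representsD: "represents \<mu> R f \<Longrightarrow> R \<in> ops"
  "represents \<mu> R f \<Longrightarrow> x \<in> V \<Longrightarrow> ip (R x) x = (\<integral>l. f l \<partial>\<mu> x)"
  by (auto simp: represents_def)

lemma represents_unique: "represents \<mu> R f \<Longrightarrow> represents \<mu> S f \<Longrightarrow> R = S"
  by (rule op_eqI_diagonal) (auto simp: represents_def)

definition zero_op :: "'a \<Rightarrow> 'a" where "zero_op = (\<lambda>x\<in>V. hzero H)"

lemma zero_op_apply[simp]: "x \<in> V \<Longrightarrow> zero_op x = hzero H"
  by (simp add: zero_op_def)

lemma scale_zero: "x \<in> V \<Longrightarrow> hscale H 0 x = hzero H"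
  by (rule vector_eqI) (simp_all add: inner_simps)

lemma zero_in_ops[simp]: "zero_op \<in> ops"
proof -
  have "zero_op = scale_op 0 (id_op H)"
    by (rule extensionalityI[of _ V]) (auto simp: zero_op_def scale_op_def scale_zero)
  then show ?thesis by simp
qed

lemma comp_add_left: "R \<in> ops \<Longrightarrow> S \<in> ops \<Longrightarrow> T \<in> ops \<Longrightarrow> comp_op H (add_op R S) T = add_op (comp_op H R T) (comp_op H S T)"
  by (rule op_eqI) simp_all

lemma comp_add_right: "R \<in> ops \<Longrightarrow> S \<in> ops \<Longrightarrow> T \<in> ops \<Longrightarrow> comp_op H T (add_op R S) = add_op (comp_op H T R) (comp_op H T S)"
  by (rule op_eqI) (simp_all add: op_add)

lemma comp_scale_right: "R \<in> ops \<Longrightarrow> T \<in> ops \<Longrightarrow> comp_op H T (scale_op c R) = scale_op c (comp_op H T R)"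
  by (rule op_eqI) (simp_all add: op_scale)

end

text \<open>Measures \<open>\<mu> x\<close> indexed by vectors, as they come from a projection-valued measure or from a moment
  problem. Apart from the total mass, how \<open>\<mu> x\<close> depends on \<open>x\<close> is left open: it is imposed by the existence of representing
  operators. The measures live on \<open>Q\<close>, so that functions need to be bounded there only.\<close>

locale spectral_family = hilbert_space H
  for H :: "'a hspace" +
  fixes M :: "'b measure" and \<mu> :: "'a \<Rightarrow> 'b measure" and Q :: "'b set"
  assumes sets_family: "x \<in> V \<Longrightarrow> sets (\<mu> x) = sets M"
    and finite_family: "x \<in> V \<Longrightarrow> finite_measure (\<mu> x)"
    and total_mass: "x \<in> V \<Longrightarrow> measure (\<mu> x) (space M) = (nrm x)\<^sup>2"
    and carrier_subset: "Q \<subseteq> space M"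
    and carrier_AE: "x \<in> V \<Longrightarrow> AE l in \<mu> x. l \<in> Q"
begin

abbreviation adm :: "('b \<Rightarrow> complex) \<Rightarrow> bool" where "adm \<equiv> admissible M Q"

lemma measurable_family: "x \<in> V \<Longrightarrow> borel_measurable (\<mu> x) = borel_measurable M"
  by (intro measurable_cong_sets sets_family refl)

lemma space_family: "x \<in> V \<Longrightarrow> space (\<mu> x) = space M"
  using sets_eq_imp_space_eq[OF sets_family] .

lemma integrable_family: assumes "adm f" "x \<in> V" shows "integrable (\<mu> x) f"
proof -
  obtain B where B: "0 \<le> B" "\<And>l. l \<in> Q \<Longrightarrow> cmod (f l) \<le> B" using admissible_bound[OF assms(1)] by blast
  interpret finite_measure "\<mu> x" by (rule finite_family[OF assms(2)])
  show ?thesis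
  proof (rule integrable_const_bound[where B=B])
    show "AE l in \<mu> x. cmod (f l) \<le> B" using carrier_AE[OF assms(2)] by eventually_elim (rule B)
    show "f \<in> borel_measurable (\<mu> x)" using assms by (simp add: measurable_family admissibleD)
  qed
qed

lemma integral_bound:
  assumes f: "adm f" and B: "\<And>l. l \<in> Q \<Longrightarrow> cmod (f l) \<le> B" and x: "x \<in> V"
  shows "cmod (\<integral>l. f l \<partial>\<mu> x) \<le> B * (nrm x)\<^sup>2"
proof -
  interpret finite_measure "\<mu> x" by (rule finite_family[OF x])
  have "cmod (\<integral>l. f l \<partial>\<mu> x) \<le> (\<integral>l. cmod (f l) \<partial>\<mu> x)" by (rule integral_norm_bound)
  also have "\<dots> \<le> (\<integral>l. B \<partial>\<mu> x)"
  proof (rule integral_mono_AE)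
    show "AE l in \<mu> x. cmod (f l) \<le> B" using carrier_AE[OF x] by eventually_elim (rule B)
  qed (use integrable_family[OF f x] in auto)
  also have "\<dots> = B * (nrm x)\<^sup>2" using total_mass[OF x] space_family[OF x] by simp
  finally show ?thesis .
qed

lemma integral_cong_carrier:
  assumes "f \<in> borel_measurable M" "g \<in> borel_measurable M" "\<And>l. l \<in> Q \<Longrightarrow> f l = g l" "x \<in> V"
  shows "(\<integral>l. f l \<partial>\<mu> x) = (\<integral>l. g l \<partial>\<mu> x)"
proof (rule integral_cong_AE)
  show "AE l in \<mu> x. f l = g l" using carrier_AE[OF assms(4)] by eventually_elim (rule assms(3))
qed (use assms measurable_family in auto)

lemma tendsto_integral_family:
  assumes F: "bounded_limit M Q F f" and x: "x \<in> V"
  shows "(\<lambda>n. \<integral>l. F n l \<partial>\<mu> x) \<longlonglongrightarrow> (\<integral>l. f l \<partial>\<mu> x)"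
proof -
  obtain B where B: "\<forall>n. \<forall>l\<in>Q. cmod (F n l) \<le> B" using bounded_limit_bound[OF F] by blast
  interpret finite_measure "\<mu> x" by (rule finite_family[OF x])
  show ?thesis
  proof (rule integral_dominated_convergence[where w="\<lambda>_. B"])
    show "AE l in \<mu> x. (\<lambda>n. F n l) \<longlonglongrightarrow> f l"
      using carrier_AE[OF x] by eventually_elim (rule bounded_limit_tendsto[OF F])
    show "AE l in \<mu> x. cmod (F n l) \<le> B" for n using carrier_AE[OF x] by eventually_elim (use B in blast)
  qed (use F x measurable_family in \<open>auto simp: bounded_limit_def\<close>)
qed

lemma represents_cong:
  assumes "represents \<mu> R f" "f \<in> borel_measurable M" "g \<in> borel_measurable M" "\<And>l. l \<in> Q \<Longrightarrow> f l = g l"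
  shows "represents \<mu> R g"
  using assms(1) integral_cong_carrier[OF assms(2-4)] by (simp add: represents_def)

lemma represents_add:
  "\<lbrakk>represents \<mu> R f; represents \<mu> S g; adm f; adm g\<rbrakk> \<Longrightarrow> represents \<mu> (add_op R S) (\<lambda>l. f l + g l)"
  unfolding represents_def by (auto simp: inner_simps integrable_family)

lemma represents_scale:
  "\<lbrakk>represents \<mu> R f; adm f\<rbrakk> \<Longrightarrow> represents \<mu> (scale_op c R) (\<lambda>l. c * f l)"
  unfolding represents_def by (auto simp: inner_simps integrable_family)

lemma represents_id: "represents \<mu> (id_op H) (\<lambda>l. 1)"
  unfolding represents_def using total_mass space_family by (simp add: inner_self scaleR_conv_of_real)

lemma represents_const: "represents \<mu> (scale_op c (id_op H)) (\<lambda>l. c)"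
  using represents_scale[OF represents_id admissible_const, of c] by simp

lemma represents_zero: "represents \<mu> zero_op (\<lambda>l. 0)"
  unfolding represents_def by (simp add: inner_simps)

lemma represents_diff:
  assumes "represents \<mu> R f" "represents \<mu> S g" "adm f" "adm g"
  shows "represents \<mu> (\<lambda>x\<in>V. hdiff H (R x) (S x)) (\<lambda>l. f l - g l)"
proof -
  have "represents \<mu> (add_op R (scale_op (-1) S)) (\<lambda>l. f l + (-1) * g l)"
    by (intro represents_add represents_scale assms admissible_scale)
  moreover have "add_op R (scale_op (-1) S) = (\<lambda>x\<in>V. hdiff H (R x) (S x))"
    by (auto simp: add_op_def scale_op_def hdiff_def)
  ultimately show ?thesis by simp
qed

lemma represents_adjoint:
  assumes "represents \<mu> R f" shows "represents \<mu> (adjoint_op H R) (\<lambda>l. cnj (f l))"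
proof -
  have R: "R \<in> ops" using assms by (rule representsD)
  have "ip (adjoint_op H R x) x = (\<integral>l. cnj (f l) \<partial>\<mu> x)" if x: "x \<in> V" for x
  proof -
    have "ip (adjoint_op H R x) x = cnj (ip (R x) x)"
      using adjoint_inner_left[OF R x x] inner_commute[of "R x" x] x R by simp
    then show ?thesis using representsD(2)[OF assms x] by simp
  qed
  then show ?thesis using R by (simp add: represents_def)
qed

text \<open>The key to all existence statements about \<open>f(T)\<close>: the scalar integrals converge by dominated
  convergence and are bounded by a multiple of \<open>\<parallel>x\<parallel>\<^sup>2\<close>, so a limit operator exists without any explicit
  construction.\<close>
lemma represents_limit:
  assumes R: "\<And>n. represents \<mu> (R n) (F n)" and F: "bounded_limit M Q F f"
  shows "\<exists>T. represents \<mu> T f \<and> (\<forall>x\<in>V. \<forall>y\<in>V. (\<lambda>n. ip (R n x) y) \<longlonglongrightarrow> ip (T x) y)"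
proof -
  obtain B where B: "\<And>n l. l \<in> Q \<Longrightarrow> cmod (F n l) \<le> B" using bounded_limit_bound[OF F] by blast
  have Rops: "R n \<in> ops" for n using R by (rule representsD)
  have lim: "(\<lambda>n. ip (R n x) x) \<longlonglongrightarrow> (\<integral>l. f l \<partial>\<mu> x)" if "x \<in> V" for x
    using tendsto_integral_family[OF F that] representsD(2)[OF R that] by simp
  have "\<exists>T\<in>ops. \<forall>x\<in>V. \<forall>y\<in>V. (\<lambda>n. ip (R n x) y) \<longlonglongrightarrow> ip (T x) y"
  proof (rule weak_limit_operator[OF Rops])
    fix n x assume x: "x \<in> V"
    show "cmod (ip (R n x) x) \<le> B * (nrm x)\<^sup>2"
      unfolding representsD(2)[OF R x] by (rule integral_bound[OF bounded_limit_admissible(1)[OF F] B x])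
    show "convergent (\<lambda>n. ip (R n x) x)" using lim[OF x] by (rule convergentI)
  qed
  then obtain T where T: "T \<in> ops" "\<And>x y. x \<in> V \<Longrightarrow> y \<in> V \<Longrightarrow> (\<lambda>n. ip (R n x) y) \<longlonglongrightarrow> ip (T x) y" by blast
  have "ip (T x) x = (\<integral>l. f l \<partial>\<mu> x)" if "x \<in> V" for x
    using T(2)[OF that that] lim[OF that] by (rule LIMSEQ_unique)
  then show ?thesis using T by (auto simp: represents_def)
qed

text \<open>With \<open>T\<close> in the role of \<open>h(T')\<close>, this is the statement \<open>(h f)(T') = h(T') f(T')\<close> for one function
  \<open>f\<close>. For fixed \<open>T\<close> and \<open>h\<close> it is stable under the operations of the induction principles.\<close>

definition multiplicative :: "('a \<Rightarrow> 'a) \<Rightarrow> ('b \<Rightarrow> complex) \<Rightarrow> ('b \<Rightarrow> complex) \<Rightarrow> bool" where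
  "multiplicative T h f \<longleftrightarrow> (\<exists>R. represents \<mu> R f \<and> represents \<mu> (comp_op H T R) (\<lambda>l. h l * f l))"

lemma multiplicativeD: "multiplicative T h f \<Longrightarrow> represents \<mu> R f \<Longrightarrow> represents \<mu> (comp_op H T R) (\<lambda>l. h l * f l)"
  unfolding multiplicative_def using represents_unique by blast

lemma multiplicative_add:
  assumes T: "T \<in> ops" and h: "adm h" and f: "adm f" "multiplicative T h f" and g: "adm g" "multiplicative T h g"
  shows "multiplicative T h (\<lambda>l. f l + g l)"
proof -
  obtain R S where R: "represents \<mu> R f" "represents \<mu> (comp_op H T R) (\<lambda>l. h l * f l)"
    and S: "represents \<mu> S g" "represents \<mu> (comp_op H T S) (\<lambda>l. h l * g l)"
    using f(2) g(2) by (auto simp: multiplicative_def)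
  have "represents \<mu> (comp_op H T (add_op R S)) (\<lambda>l. h l * (f l + g l))"
    using represents_add[OF R(2) S(2) admissible_mult[OF h f(1)] admissible_mult[OF h g(1)]]
      comp_add_right[OF representsD(1)[OF R(1)] representsD(1)[OF S(1)] T] by (simp add: distrib_left)
  then show ?thesis
    using represents_add[OF R(1) S(1) f(1) g(1)] by (auto simp: multiplicative_def)
qed

lemma multiplicative_scale:
  assumes T: "T \<in> ops" and h: "adm h" and f: "adm f" "multiplicative T h f"
  shows "multiplicative T h (\<lambda>l. c * f l)"
proof -
  obtain R where R: "represents \<mu> R f" "represents \<mu> (comp_op H T R) (\<lambda>l. h l * f l)"
    using f(2) by (auto simp: multiplicative_def)
  have "represents \<mu> (comp_op H T (scale_op c R)) (\<lambda>l. h l * (c * f l))"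
    using represents_scale[OF R(2) admissible_mult[OF h f(1)], of c]
      comp_scale_right[OF representsD(1)[OF R(1)] T] by (simp add: mult.left_commute)
  then show ?thesis
    using represents_scale[OF R(1) f(1)] by (auto simp: multiplicative_def)
qed

lemma multiplicative_limit:
  assumes T: "T \<in> ops" and h: "adm h" and F: "bounded_limit M Q F f" and mult: "\<And>n. multiplicative T h (F n)"
  shows "multiplicative T h f"
proof -
  obtain R where R: "\<And>n. represents \<mu> (R n) (F n)" "\<And>n. represents \<mu> (comp_op H T (R n)) (\<lambda>l. h l * F n l)"
    using mult unfolding multiplicative_def by metis
  obtain S where S: "represents \<mu> S f" "\<And>x y. x \<in> V \<Longrightarrow> y \<in> V \<Longrightarrow> (\<lambda>n. ip (R n x) y) \<longlonglongrightarrow> ip (S x) y"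
    using represents_limit[OF R(1) F] by blast
  have Sops: "S \<in> ops" and Rops: "\<And>n. R n \<in> ops" by (rule representsD(1)[OF S(1)], rule representsD(1)[OF R(1)])
  have "ip (comp_op H T S x) x = (\<integral>l. h l * f l \<partial>\<mu> x)" if x: "x \<in> V" for x
  proof -
    have "(\<lambda>n. ip (R n x) (adjoint_op H T x)) \<longlonglongrightarrow> ip (S x) (adjoint_op H T x)"
      using x T by (intro S) auto
    moreover have "ip (R n x) (adjoint_op H T x) = (\<integral>l. h l * F n l \<partial>\<mu> x)" for n
      using representsD(2)[OF R(2) x, of n] adjoint_inner[OF T, of "R n x" x] Rops x by simp
    ultimately have "ip (S x) (adjoint_op H T x) = (\<integral>l. h l * f l \<partial>\<mu> x)"
      using tendsto_integral_family[OF bounded_limit_mult[OF F h] x] by (simp add: LIMSEQ_unique)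
    then show ?thesis using adjoint_inner[OF T, of "S x" x] Sops x by simp
  qed
  then show ?thesis
    using S(1) Sops T by (auto simp: multiplicative_def represents_def)
qed

text \<open>Multiplicativity in the other factor. The integrals of products are symmetric while
  composition is not; taking adjoints exchanges the factors.\<close>
lemma represents_swap:
  assumes T: "T \<in> ops"
    and R: "represents \<mu> R f" and mult: "multiplicative (adjoint_op H T) (\<lambda>l. cnj (h l)) (\<lambda>l. cnj (f l))"
  shows "represents \<mu> (comp_op H R T) (\<lambda>l. f l * h l)"
proof -
  have Rops: "R \<in> ops" using R by (rule representsD)
  have "represents \<mu> (comp_op H (adjoint_op H T) (adjoint_op H R)) (\<lambda>l. cnj (h l) * cnj (f l))"
    by (rule multiplicativeD[OF mult represents_adjoint[OF R]])
  from represents_adjoint[OF this]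
  have "represents \<mu> (adjoint_op H (comp_op H (adjoint_op H T) (adjoint_op H R))) (\<lambda>l. f l * h l)"
    by (simp add: mult.commute)
  moreover have "adjoint_op H (comp_op H (adjoint_op H T) (adjoint_op H R)) = comp_op H R T"
    using Rops T by (intro adjoint_eqI) (auto simp: adjoint_inner_left)
  ultimately show ?thesis by simp
qed

end

section \<open>Integration against a projection-valued measure\<close>

text \<open>The set \<open>Q\<close> carries the measure. It is the spectrum in the end, but at first only some square.\<close>

locale pvm = hilbert_space H
  for H :: "'a hspace" +
  fixes M :: "'b measure" and E :: "'b set \<Rightarrow> 'a \<Rightarrow> 'a" and Q :: "'b set"
  assumes pvm: "proj_valued_measure H M E"
    and Q_sets: "Q \<in> sets M" and Q_full: "E (space M - Q) = zero_op"
begin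

lemma E_proj: "A \<in> sets M \<Longrightarrow> orth_projection H (E A)"
  and E_empty: "E {} = zero_op" and E_space: "E (space M) = id_op H"
  and E_Int: "A \<in> sets M \<Longrightarrow> B \<in> sets M \<Longrightarrow> E (A \<inter> B) = comp_op H (E A) (E B)"
  and E_sums: "range F \<subseteq> sets M \<Longrightarrow> disjoint_family F \<Longrightarrow> x \<in> V \<Longrightarrow> y \<in> V \<Longrightarrow>
      (\<lambda>n. ip (E (F n) x) y) sums ip (E (\<Union>n. F n) x) y"
  and E_extensional: "E \<in> extensional (sets M)"
  using pvm unfolding proj_valued_measure_def zero_op_def by auto

lemma E_ops[simp]: "A \<in> sets M \<Longrightarrow> E A \<in> ops"
  using E_proj by (simp add: orth_projection_def)

lemma E_inner_self: assumes "A \<in> sets M" "x \<in> V" shows "ip (E A x) x = of_real ((nrm (E A x))\<^sup>2)"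
proof -
  have "E A (E A x) = E A x"
    using E_proj[OF assms(1)] assms comp_op_apply[of x "E A" "E A"] by (simp add: orth_projection_def)
  then have "ip (E A x) x = ip (E A (E A x)) x" by simp
  also have "\<dots> = ip (E A x) (E A x)"
    using adjoint_inner[of "E A" "E A x" x] E_proj[OF assms(1)] assms by (simp add: orth_projection_def)
  finally show ?thesis using assms by (simp add: inner_self)
qed

abbreviation \<mu> :: "'a \<Rightarrow> 'b measure" where "\<mu> \<equiv> scalar_measure H M E"

lemma space_scalar[simp]: "space (\<mu> x) = space M" and sets_scalar[simp]: "sets (\<mu> x) = sets M"
  unfolding scalar_measure_def using sets.space_closed[of M] by (simp_all add: sets.sigma_sets_eq)

lemma emeasure_scalar:
  assumes x: "x \<in> V" and A: "A \<in> sets M"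
  shows "emeasure (\<mu> x) A = ennreal (Re (ip (E A x) x))"
  unfolding scalar_measure_def
proof (rule emeasure_measure_of_sigma[OF sets.sigma_algebra_axioms _ _ A])
  show "positive (sets M) (\<lambda>A. ennreal (Re (ip (E A x) x)))"
    using x by (simp add: positive_def E_empty inner_simps)
  show "countably_additive (sets M) (\<lambda>A. ennreal (Re (ip (E A x) x)))"
  proof (rule countably_additiveI)
    fix F :: "nat \<Rightarrow> 'b set" assume F: "range F \<subseteq> sets M" "disjoint_family F"
    have "(\<lambda>n. Re (ip (E (F n) x) x)) sums Re (ip (E (\<Union>n. F n) x) x)"
      using E_sums[OF F x x] by (rule sums_Re)
    moreover have "0 \<le> Re (ip (E (F n) x) x)" for n
      using E_inner_self[of "F n" x] F x by (auto simp: range_subsetD)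
    ultimately show "(\<Sum>i. ennreal (Re (ip (E (F i) x) x))) = ennreal (Re (ip (E (\<Union>i. F i) x) x))"
      by (intro suminf_ennreal_eq)
  qed
qed

lemma measure_scalar: "x \<in> V \<Longrightarrow> A \<in> sets M \<Longrightarrow> ip (E A x) x = of_real (measure (\<mu> x) A)"
  using emeasure_scalar[of x A] E_inner_self[of A x] by (simp add: measure_def)

sublocale spectral_family H M "\<mu>" Q
proof (intro spectral_family.intro spectral_family_axioms.intro hilbert_space_axioms)
  fix x assume x: "x \<in> V"
  show "sets (\<mu> x) = sets M" by simp
  show "finite_measure (\<mu> x)"
    using x by (intro finite_measureI) (simp add: emeasure_scalar)
  show "measure (\<mu> x) (space M) = (nrm x)\<^sup>2"
    using x by (simp add: measure_def emeasure_scalar E_space hnorm_sq[symmetric])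
  have "emeasure (\<mu> x) (space M - Q) = 0"
    using x Q_sets by (subst emeasure_scalar) (auto simp: Q_full inner_simps)
  then show "AE l in \<mu> x. l \<in> Q"
    using Q_sets by (intro AE_I[of _ _ "space M - Q"]) auto
next
  show "Q \<subseteq> space M" using Q_sets by (rule sets.sets_into_space)
qed

lemma represents_indicator: "A \<in> sets M \<Longrightarrow> represents \<mu> (E A) (indicator A)"
proof -
  assume A: "A \<in> sets M"
  have "ip (E A x) x = (\<integral>l. indicator A l \<partial>\<mu> x)" if x: "x \<in> V" for x
  proof -
    interpret finite_measure "\<mu> x" by (rule finite_family[OF x])
    have "(\<integral>l. complex_of_real (indicator A l) \<partial>\<mu> x) = of_real (measure (\<mu> x) A)"
      using A by (simp add: integral_complex_of_real)
    moreover have "(\<lambda>l. complex_of_real (indicator A l)) = indicator A" by (auto simp: indicator_def)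
    ultimately show ?thesis using measure_scalar[OF x A] by simp
  qed
  then show ?thesis using A by (simp add: represents_def)
qed

lemma represents_exists: "adm f \<Longrightarrow> \<exists>R. represents \<mu> R f"
proof (erule bounded_measurable_induct[where P="\<lambda>f. \<exists>R. represents \<mu> R f", rotated -1])
  show "\<exists>R. represents \<mu> R (indicator A)" if "A \<in> sets M" for A
    using represents_indicator[OF that] by blast
  show "\<exists>R. represents \<mu> R f" if F: "bounded_limit M Q F f" "\<And>n. \<exists>R. represents \<mu> R (F n)" for F f
  proof -
    obtain R where "\<And>n. represents \<mu> (R n) (F n)" using F(2) by metis
    then show ?thesis using represents_limit[of R F f] F(1) by blast
  qed
qed (use carrier_subset in \<open>blast intro: represents_add represents_scale\<close>)+

lemma multiplicativeI:
  assumes T: "T \<in> ops" and h: "adm h" and ind: "\<And>A. A \<in> sets M \<Longrightarrow> multiplicative T h (indicator A)" and f: "adm f"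
  shows "multiplicative T h f"
  using f
proof (rule bounded_measurable_induct[where P="multiplicative T h", rotated -1])
  show "multiplicative T h f" if "bounded_limit M Q F f" "\<And>n. multiplicative T h (F n)" for F f
    by (rule multiplicative_limit[OF T h that])
qed (simp_all add: carrier_subset ind multiplicative_add[OF T h] multiplicative_scale[OF T h])

text \<open>Two inductions: multiplicativity of \<open>E B\<close> on indicators is \<open>E_Int\<close>; it extends to a general
  function in one factor, and after swapping the factors to a general function in the other.\<close>
lemma represents_comp:
  assumes R: "represents \<mu> R f" and S: "represents \<mu> S g" and f: "adm f" and g: "adm g"
  shows "represents \<mu> (comp_op H R S) (\<lambda>l. f l * g l)"
proof (rule multiplicativeD[OF multiplicativeI[OF _ f _ g] S])
  show "R \<in> ops" using R by (rule representsD)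
  fix B assume B: "B \<in> sets M"
  have adj: "adjoint_op H (E B) = E B" using E_proj[OF B] by (simp add: orth_projection_def)
  have cnj: "(\<lambda>l. cnj (indicator B l)) = indicator B" by (auto simp: indicator_def)
  have "multiplicative (E B) (indicator B) (\<lambda>l. cnj (f l))"
  proof (rule multiplicativeI[OF E_ops[OF B] admissible_indicator[OF B] _ admissible_cnj[OF f]])
    show "multiplicative (E B) (indicator B) (indicator A)" if A: "A \<in> sets M" for A
      unfolding multiplicative_def indicator_inter_arith[symmetric]
      using represents_indicator[OF A] represents_indicator[of "B \<inter> A"] A B E_Int[OF B A] by auto
  qed
  then have "represents \<mu> (comp_op H R (E B)) (\<lambda>l. f l * indicator B l)"
    using B by (intro represents_swap R) (simp_all add: adj cnj)
  then show "multiplicative R f (indicator B)"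
    using represents_indicator[OF B] by (auto simp: multiplicative_def)
qed

text \<open>As the calculus is multiplicative, \<open>\<parallel>R x\<parallel>\<^sup>2\<close> is the integral of \<open>|f|\<^sup>2\<close>, which improves the constant 2
  of \<open>diagonal_bound_norm\<close> to 1.\<close>
lemma represents_contraction:
  assumes R: "represents \<mu> R f" and f: "adm f" and B: "0 \<le> B" "\<And>l. l \<in> Q \<Longrightarrow> cmod (f l) \<le> B" and x: "x \<in> V"
  shows "nrm (R x) \<le> B * nrm x"
proof (rule power2_le_imp_le)
  have Rops: "R \<in> ops" using R by (rule representsD)
  have rep: "represents \<mu> (comp_op H (adjoint_op H R) R) (\<lambda>l. cnj (f l) * f l)"
    by (intro represents_comp represents_adjoint R admissible_cnj f)
  have "(nrm (R x))\<^sup>2 = cmod (ip (R x) (R x))"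
    unfolding inner_self[OF op_closed[OF Rops x]] norm_of_real by simp
  also have "ip (R x) (R x) = ip (comp_op H (adjoint_op H R) R x) x"
    using adjoint_inner_left[OF Rops, of "R x" x] x Rops by simp
  also have "\<dots> = (\<integral>l. cnj (f l) * f l \<partial>\<mu> x)" by (rule representsD(2)[OF rep x])
  also have "cmod \<dots> \<le> (B * B) * (nrm x)\<^sup>2"
    using B mult_mono[OF B(2) B(2) B(1)] by (intro integral_bound admissible_mult admissible_cnj f x) (simp add: norm_mult)
  finally show "(nrm (R x))\<^sup>2 \<le> (B * nrm x)\<^sup>2" by (simp add: power2_eq_square mult_ac)
qed (use B x in simp)

lemma pvm_integral_eqI: "represents \<mu> R f \<Longrightarrow> pvm_integral H M E f = R"
  unfolding pvm_integral_def
  by (rule the_equality) (auto simp: represents_def intro: op_eqI_diagonal)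

lemma represents_pvm_integral: "adm f \<Longrightarrow> represents \<mu> (pvm_integral H M E f) f"
  using represents_exists[of f] pvm_integral_eqI by auto

lemma E_zero_iff: "A \<in> sets M \<Longrightarrow> E A = zero_op \<longleftrightarrow> (\<forall>x\<in>V. emeasure (\<mu> x) A = 0)"
proof
  assume A: "A \<in> sets M"
  show "\<forall>x\<in>V. emeasure (\<mu> x) A = 0" if "E A = zero_op"
    using that A by (simp add: emeasure_scalar inner_simps)
  show "E A = zero_op" if *: "\<forall>x\<in>V. emeasure (\<mu> x) A = 0"
  proof (rule op_eqI_diagonal)
    fix x assume "x \<in> V"
    then show "ip (E A x) x = ip (zero_op x) x"
      using * measure_scalar[of x A] A by (simp add: measure_def inner_simps)
  qed (use A in auto)
qed

end

section \<open>Spectral measures of normal operators\<close>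

context hilbert_space
begin

text \<open>Horner evaluation of a polynomial at the operator \<open>A\<close>, where \<open>c\<close> turns coefficients into operators.
  The coefficient map is a parameter so that the definition can be iterated: for a bivariate
  polynomial the coefficients are polynomials in \<open>A\<close> and the argument is \<open>B\<close>.\<close>

definition op_poly :: "('c::zero \<Rightarrow> 'a \<Rightarrow> 'a) \<Rightarrow> ('a \<Rightarrow> 'a) \<Rightarrow> 'c poly \<Rightarrow> 'a \<Rightarrow> 'a" where
  "op_poly c A p = foldr (\<lambda>a R. add_op (c a) (comp_op H A R)) (coeffs p) zero_op"

lemma op_poly_0: "op_poly c A 0 = zero_op"
  by (simp add: op_poly_def)

lemma op_poly_pCons:
  assumes "c 0 = zero_op" "A \<in> ops"
  shows "op_poly c A (pCons a p) = add_op (c a) (comp_op H A (op_poly c A p))"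
proof (cases "a = 0 \<and> p = 0")
  case True
  have "A (hzero H) = hzero H"
    using op_scale[OF assms(2) zero_closed, of 0] assms(2) scale_zero by simp
  then have "zero_op = add_op zero_op (comp_op H A zero_op)"
    using assms(2) by (intro op_eqI) (auto simp: add_zero)
  then show ?thesis using True assms by (simp add: op_poly_0)
qed (auto simp: op_poly_def cCons_def)

lemma op_poly_in_ops:
  assumes "c 0 = zero_op" "A \<in> ops" "\<And>a. c a \<in> ops" shows "op_poly c A p \<in> ops"
  by (induction p) (use assms in \<open>auto simp: op_poly_0 op_poly_pCons\<close>)

lemma add_op_interchange:
  assumes "P \<in> ops" "Q \<in> ops" "R \<in> ops" "S \<in> ops"
  shows "add_op (add_op P Q) (add_op R S) = add_op (add_op P R) (add_op Q S)"
  using assms by (intro op_eqI_inner) (auto simp: inner_simps)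

lemma op_poly_add:
  assumes c: "c 0 = zero_op" "\<And>a. c a \<in> ops" and A: "A \<in> ops"
    and add: "\<And>a b. c (a + b) = add_op (c a) (c b)"
  shows "op_poly c A (p + q) = add_op (op_poly c A p) (op_poly c A (q :: 'c::comm_monoid_add poly))"
proof (induction p q rule: poly_induct2)
  case 0
  have "zero_op = add_op zero_op zero_op" by (intro op_eqI) (auto simp: add_zero)
  then show ?case by (simp add: op_poly_0)
next
  case (pCons a p b q)
  show ?case
    using c A add pCons op_poly_in_ops[of c A, OF c(1) A c(2)]
    by (simp add: op_poly_pCons comp_add_right add_op_interchange)
qed

end

locale commuting_pair = hilbert_space H
  for H :: "'a hspace" +
  fixes A B :: "'a \<Rightarrow> 'a" and K :: real
  assumes A_ops[simp]: "A \<in> ops" and B_ops[simp]: "B \<in> ops"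
    and A_sym: "x \<in> V \<Longrightarrow> y \<in> V \<Longrightarrow> ip (A x) y = ip x (A y)"
    and B_sym: "x \<in> V \<Longrightarrow> y \<in> V \<Longrightarrow> ip (B x) y = ip x (B y)"
    and commute: "x \<in> V \<Longrightarrow> A (B x) = B (A x)"
    and K_pos: "0 < K"
    and A_bound: "x \<in> V \<Longrightarrow> nrm (A x) \<le> K * nrm x"
    and B_bound: "x \<in> V \<Longrightarrow> nrm (B x) \<le> K * nrm x"
begin

definition scalar_op :: "real \<Rightarrow> 'a \<Rightarrow> 'a" where
  "scalar_op r = scale_op (of_real r) (id_op H)"

definition A_poly :: "real poly \<Rightarrow> 'a \<Rightarrow> 'a" where
  "A_poly = op_poly scalar_op A"

definition poly_op :: "real poly poly \<Rightarrow> 'a \<Rightarrow> 'a" where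
  "poly_op = op_poly A_poly B"

lemma scalar_op_ops[simp]: "scalar_op r \<in> ops"
  by (simp add: scalar_op_def)

lemma scalar_op_apply[simp]: "x \<in> V \<Longrightarrow> scalar_op r x = hscale H (of_real r) x"
  by (simp add: scalar_op_def)

lemma scalar_op_0: "scalar_op 0 = zero_op"
  by (intro op_eqI) (auto simp: scale_zero)

lemma scalar_op_add: "scalar_op (r + s) = add_op (scalar_op r) (scalar_op s)"
  by (intro op_eqI) (auto simp: scale_add_left)

lemma A_poly_ops[simp]: "A_poly p \<in> ops"
  unfolding A_poly_def by (rule op_poly_in_ops) (auto simp: scalar_op_0)

lemma A_poly_0: "A_poly 0 = zero_op"
  by (simp add: A_poly_def op_poly_0)

lemma A_poly_pCons: "A_poly (pCons a p) = add_op (scalar_op a) (comp_op H A (A_poly p))"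
  unfolding A_poly_def by (rule op_poly_pCons) (auto simp: scalar_op_0)

lemma A_poly_add: "A_poly (p + q) = add_op (A_poly p) (A_poly q)"
  unfolding A_poly_def by (rule op_poly_add) (auto simp: scalar_op_0 scalar_op_add)

lemma poly_op_ops[simp]: "poly_op p \<in> ops"
  unfolding poly_op_def by (rule op_poly_in_ops) (auto simp: A_poly_0)

lemma poly_op_0: "poly_op 0 = zero_op"
  by (simp add: poly_op_def op_poly_0)

lemma poly_op_pCons: "poly_op (pCons a p) = add_op (A_poly a) (comp_op H B (poly_op p))"
  unfolding poly_op_def by (rule op_poly_pCons) (auto simp: A_poly_0)

lemma poly_op_add: "poly_op (p + q) = add_op (poly_op p) (poly_op q)"
  unfolding poly_op_def by (rule op_poly_add) (auto simp: A_poly_0 A_poly_add)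

lemma op_zero: "T \<in> ops \<Longrightarrow> T (hzero H) = hzero H"
  using op_scale[of T "hzero H" 0] scale_zero[of "hzero H"] scale_zero[of "T (hzero H)"] by simp

lemma poly_op_const: "poly_op (const_poly c) = scalar_op c"
  by (intro op_eqI) (auto simp: poly_op_pCons poly_op_0 A_poly_pCons A_poly_0 add_zero op_zero)

lemma poly_op_Y: "poly_op (Y_poly * p) = comp_op H B (poly_op p)"
proof -
  have "Y_poly * p = pCons 0 p" by simp
  then have "poly_op (Y_poly * p) = add_op (A_poly 0) (comp_op H B (poly_op p))" by (simp only: poly_op_pCons)
  also have "\<dots> = comp_op H B (poly_op p)"
    by (intro op_eqI) (auto simp: A_poly_0 add_commute[of "hzero H"] add_zero)
  finally show ?thesis .
qed

lemma poly_op_X: "poly_op (X_poly * p) = comp_op H A (poly_op p)"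
proof (induction p)
  case 0 
  have "comp_op H A zero_op = zero_op" by (intro op_eqI) (auto simp: op_zero)
  then show ?case by (simp add: poly_op_0)
next
  case (pCons a p)
  have "X_poly * pCons a p = pCons ([:0, 1:] * a) (X_poly * p)" by simp
  then have "poly_op (X_poly * pCons a p) = add_op (A_poly ([:0, 1:] * a)) (comp_op H B (comp_op H A (poly_op p)))"
    by (simp only: poly_op_pCons pCons.IH)
  also have "A_poly ([:0, 1:] * a) = comp_op H A (A_poly a)"
    by (intro op_eqI) (auto simp: A_poly_pCons scale_zero add_commute[of "hzero H"] add_zero)
  also have "add_op (comp_op H A (A_poly a)) (comp_op H B (comp_op H A (poly_op p))) = comp_op H A (poly_op (pCons a p))"
    by (intro op_eqI) (auto simp: poly_op_pCons op_add commute)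
  finally show ?case .
qed

lemma poly_op_commute:
  assumes T: "T \<in> ops" "\<And>x. x \<in> V \<Longrightarrow> T (A x) = A (T x)" "\<And>x. x \<in> V \<Longrightarrow> T (B x) = B (T x)" and x: "x \<in> V"
  shows "T (poly_op p x) = poly_op p (T x)"
  using x
proof (induction p arbitrary: x rule: bivariate_poly_induct)
  case (const c) then show ?case using T by (simp add: poly_op_const op_scale)
next
  case (add p q) then show ?case using T by (simp add: poly_op_add op_add)
next
  case (X p) then show ?case using T by (simp add: poly_op_X del: mult_pCons_left)
next
  case (Y p) then show ?case using T by (simp add: poly_op_Y del: mult_pCons_left)
qed

lemma poly_op_sym: "x \<in> V \<Longrightarrow> y \<in> V \<Longrightarrow> ip (poly_op p x) y = ip x (poly_op p y)"
proof (induction p arbitrary: x y rule: bivariate_poly_induct)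
  case (const c) then show ?case by (simp add: poly_op_const inner_simps)
next
  case (add p q) then show ?case by (simp add: poly_op_add inner_simps)
next
  case (X p) then show ?case using poly_op_commute[of A y p]
    by (simp add: poly_op_X A_sym commute del: mult_pCons_left)
next
  case (Y p) then show ?case using poly_op_commute[of B y p]
    by (simp add: poly_op_Y B_sym commute del: mult_pCons_left)
qed

text \<open>Here commutation of \<open>A\<close> and \<open>B\<close> enters, through \<open>poly_op_commute\<close>.\<close>
lemma poly_op_mult: "poly_op (p * q) = comp_op H (poly_op p) (poly_op q)"
proof (induction p rule: bivariate_poly_induct)
  case (const c)
  show ?case
  proof (induction q rule: bivariate_poly_induct)
    case (const d)
    show ?case unfolding const_poly_mult poly_op_const by (intro op_eqI) (auto simp: scale_scale)
  next
    case (add p q) then show ?case unfolding distrib_left poly_op_add by (simp add: comp_add_right)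
  next
    case (X p)
    have "const_poly c * (X_poly * p) = X_poly * (const_poly c * p)" by (simp only: mult_ac)
    then have "poly_op (const_poly c * (X_poly * p)) = comp_op H A (comp_op H (scalar_op c) (poly_op p))"
      by (simp only: poly_op_X X poly_op_const)
    then show ?case unfolding poly_op_const poly_op_X by (intro op_eqI) (auto simp: op_scale)
  next
    case (Y p)
    have "const_poly c * (Y_poly * p) = Y_poly * (const_poly c * p)" by (simp only: mult_ac)
    then have "poly_op (const_poly c * (Y_poly * p)) = comp_op H B (comp_op H (scalar_op c) (poly_op p))"
      by (simp only: poly_op_Y Y poly_op_const)
    then show ?case unfolding poly_op_const poly_op_Y by (intro op_eqI) (auto simp: op_scale)
  qed
next
  case (add p q) then show ?case unfolding distrib_right poly_op_add by (simp add: comp_add_left)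
next
  case (X p) show ?case unfolding mult.assoc poly_op_X X by (intro op_eqI) auto
next
  case (Y p) show ?case unfolding mult.assoc poly_op_Y Y by (intro op_eqI) auto
qed

definition moments :: "'a \<Rightarrow> real poly poly \<Rightarrow> real" where
  "moments x p = Re (ip (poly_op p x) x)"

lemma inner_poly_op_self: "x \<in> V \<Longrightarrow> ip (poly_op p x) x = of_real (moments x p)"
  using poly_op_sym[of x x p] inner_commute[of "poly_op p x" x] by (simp add: moments_def complex_eq_iff)

text \<open>Squares can be moved from the polynomial into the vector. This reduces the inequalities of
  \<open>positive_moments\<close> to the norm bounds on \<open>A\<close> and \<open>B\<close>.\<close>
lemma moments_mult_square: "x \<in> V \<Longrightarrow> moments x (p * (q * q)) = moments (poly_op q x) p"
proof -
  assume x: "x \<in> V"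
  have "p * (q * q) = q * (p * q)" by (simp only: mult_ac)
  then have "poly_op (p * (q * q)) x = poly_op q (poly_op p (poly_op q x))" using x by (simp only: poly_op_mult comp_op_apply poly_op_ops op_closed)
  then show ?thesis unfolding moments_def using x poly_op_sym[of "poly_op p (poly_op q x)" x q] by simp
qed

text \<open>The squares yield norms, and \<open>K\<^sup>2 \<parallel>y\<parallel>\<^sup>2 - \<parallel>A y\<parallel>\<^sup>2\<close> is nonnegative for \<open>y = q(A, B) x\<close>.\<close>
lemma positive_moments: assumes x: "x \<in> V" shows "positive_poly_functional (moments x) K"
proof
  show "0 < K" by (rule K_pos)
  fix p q :: "real poly poly" and c :: real
  show "moments x (p + q) = moments x p + moments x q" using x by (simp add: moments_def poly_op_add inner_simps)
  show "moments x (const_poly c * p) = c * moments x p"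
    unfolding moments_def poly_op_mult poly_op_const using x by (simp add: inner_simps)
  have sq: "moments y (q * q) = (nrm (poly_op q y))\<^sup>2" if "y \<in> V" for y q
    unfolding moments_def poly_op_mult using poly_op_sym[of "poly_op q y" y q] that by (simp add: inner_self)
  show "0 \<le> moments x (q * q)" using sq[OF x] by simp
  have bound: "0 \<le> moments x ((const_poly (K\<^sup>2) - Z * Z) * (q * q))" if Z: "\<And>y. y \<in> V \<Longrightarrow> nrm (poly_op Z y) \<le> K * nrm y" for Z
  proof -
    let ?y = "poly_op q x"
    have y: "?y \<in> V" using x by simp
    have "moments ?y (const_poly (K\<^sup>2)) = moments ?y (const_poly (K\<^sup>2) - Z * Z) + moments ?y (Z * Z)"
      using y poly_op_add[of "const_poly (K\<^sup>2) - Z * Z" "Z * Z"] by (simp add: moments_def inner_simps)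
    moreover have "moments ?y (const_poly (K\<^sup>2)) = K\<^sup>2 * (nrm ?y)\<^sup>2"
      unfolding moments_def poly_op_const using y by (simp add: inner_simps inner_self)
    moreover have "(nrm (poly_op Z ?y))\<^sup>2 \<le> (K * nrm ?y)\<^sup>2" using Z[OF y] y by (intro power_mono) auto
    ultimately have "0 \<le> moments ?y (const_poly (K\<^sup>2) - Z * Z)"
      using sq[OF y, of Z] by (simp add: power_mult_distrib)
    then show ?thesis using moments_mult_square[OF x] by simp
  qed
  have XY: "poly_op X_poly y = A y" "poly_op Y_poly y = B y" if "y \<in> V" for y
    using poly_op_X[of 1] poly_op_Y[of 1] poly_op_const[of 1] that by (simp_all add: one_pCons scale_one)
  show "0 \<le> moments x ((const_poly (K\<^sup>2) - X_poly * X_poly) * (q * q))"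
    by (rule bound) (simp add: XY A_bound)
  show "0 \<le> moments x ((const_poly (K\<^sup>2) - Y_poly * Y_poly) * (q * q))"
    by (rule bound) (simp add: XY B_bound)
qed

definition moment_measure :: "'a \<Rightarrow> complex measure" where
  "moment_measure x = (SOME \<mu>. sets \<mu> = sets borel \<and> finite_measure \<mu> \<and> emeasure \<mu> (- centered_square K) = 0 \<and>
     (\<forall>p. (\<integral>l. eval_poly p l \<partial>\<mu>) = moments x p))"

lemma moment_measure:
  assumes "x \<in> V"
  shows "sets (moment_measure x) = sets borel" "finite_measure (moment_measure x)"
    "emeasure (moment_measure x) (- centered_square K) = 0"
    "(\<integral>l. eval_poly p l \<partial>moment_measure x) = moments x p"
proof -
  have "\<exists>\<mu>. sets \<mu> = sets borel \<and> finite_measure \<mu> \<and> emeasure \<mu> (- centered_square K) = 0 \<and>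
     (\<forall>p. (\<integral>l. eval_poly p l \<partial>\<mu>) = moments x p)"
    using positive_poly_functional.moment_measure_exists[OF positive_moments[OF assms]] .
  from someI_ex[OF this, folded moment_measure_def]
  show "sets (moment_measure x) = sets borel" "finite_measure (moment_measure x)"
    "emeasure (moment_measure x) (- centered_square K) = 0"
    "(\<integral>l. eval_poly p l \<partial>moment_measure x) = moments x p" by auto
qed

lemma moments_one: "x \<in> V \<Longrightarrow> moments x 1 = (nrm x)\<^sup>2"
  using poly_op_const[of 1] by (simp add: moments_def one_pCons scale_one hnorm_sq)

sublocale M: spectral_family H borel moment_measure "centered_square K"
proof (intro spectral_family.intro spectral_family_axioms.intro hilbert_space_axioms)
  fix x assume x: "x \<in> V"
  show "sets (moment_measure x) = sets borel" "finite_measure (moment_measure x)"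
    using moment_measure[OF x] by auto
  have sp: "space (moment_measure x) = UNIV" using sets_eq_imp_space_eq[OF moment_measure(1)[OF x]] by simp
  show "measure (moment_measure x) (space borel) = (nrm x)\<^sup>2"
    using moment_measure(4)[OF x, of 1] moments_one[OF x] sp by simp
  show "AE l in moment_measure x. l \<in> centered_square K"
    using moment_measure(1,3)[OF x] compact_centered_square sp
    by (intro AE_I[of _ _ "- centered_square K"]) (auto intro: borel_comp borel_compact)
qed simp

lemma bounded_square: "bounded (centered_square K)"
  by (rule compact_imp_bounded[OF compact_centered_square])

lemma eval_poly_measurable[measurable]: "eval_poly p \<in> borel_measurable borel"
  by (rule borel_measurable_continuous_onI[OF continuous_eval_poly])

lemma eval_poly_admissible: "M.adm (\<lambda>l. of_real (eval_poly p l))"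
proof -
  have "bounded (eval_poly p ` centered_square K)"
    by (intro compact_imp_bounded compact_continuous_image compact_centered_square
        continuous_on_subset[OF continuous_eval_poly]) auto
  then obtain C where "\<forall>l\<in>centered_square K. \<bar>eval_poly p l\<bar> \<le> C" by (auto simp: bounded_iff)
  then show ?thesis by (intro admissibleI[where B=C]) auto
qed

lemma represents_poly_op: "represents moment_measure (poly_op p) (\<lambda>l. of_real (eval_poly p l))"
  unfolding represents_def using inner_poly_op_self moment_measure(4) by simp

text \<open>Polynomials are represented by the definition of the moment measures; \<open>represents_limit\<close> does the
  rest.\<close>
lemma represents_bounded_borel: "M.adm f \<Longrightarrow> \<exists>R. represents moment_measure R f"
proof (erule bounded_borel_induct_polynomial[OF bounded_square, where P="\<lambda>f. \<exists>R. represents moment_measure R f", rotated -1])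
  show "\<exists>R. represents moment_measure R (\<lambda>l. of_real (p l))" if "real_polynomial_function p" for p
    using real_polynomial_function_eval_poly[OF that] represents_poly_op by blast
  show "\<exists>R. represents moment_measure R f"
    if F: "bounded_limit borel (centered_square K) F f" "\<And>n. \<exists>R. represents moment_measure R (F n)" for F f
  proof -
    obtain R where "\<And>n. represents moment_measure (R n) (F n)" using F(2) by metis
    then show ?thesis using M.represents_limit[of R F f] F(1) by blast
  qed
qed (blast intro: M.represents_add M.represents_scale)+

lemma multiplicativeI:
  assumes T: "T \<in> ops" and h: "M.adm h" and poly: "\<And>p. M.multiplicative T h (\<lambda>l. of_real (eval_poly p l))" and f: "M.adm f"
  shows "M.multiplicative T h f"
  using f
proof (rule bounded_borel_induct_polynomial[OF bounded_square, where P="M.multiplicative T h", rotated -1])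
  show "M.multiplicative T h (\<lambda>l. of_real (p l))" if "real_polynomial_function p" for p
    using real_polynomial_function_eval_poly[OF that] poly by auto
  show "M.multiplicative T h f"
    if "bounded_limit borel (centered_square K) F f" "\<And>n. M.multiplicative T h (F n)" for F f
    by (rule M.multiplicative_limit[OF T h that])
qed (simp_all add: M.multiplicative_add[OF T h] M.multiplicative_scale[OF T h])

definition E :: "complex set \<Rightarrow> 'a \<Rightarrow> 'a" where
  "E = (\<lambda>S\<in>sets borel. SOME R. represents moment_measure R (indicator S))"

lemma represents_E: "S \<in> sets borel \<Longrightarrow> represents moment_measure (E S) (indicator S)"
  using someI_ex[OF represents_bounded_borel[OF admissible_indicator, of S]] by (simp add: E_def)

lemma E_eqI: "S \<in> sets borel \<Longrightarrow> represents moment_measure R (indicator S) \<Longrightarrow> E S = R"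
  using represents_E represents_unique by blast

lemma E_adjoint: assumes S: "S \<in> sets borel" shows "adjoint_op H (E S) = E S"
proof -
  have "represents moment_measure (adjoint_op H (E S)) (\<lambda>l. cnj (indicator S l))"
    by (rule M.represents_adjoint[OF represents_E[OF S]])
  moreover have "(\<lambda>l. cnj (indicator S l)) = indicator S" by (auto simp: indicator_def)
  ultimately have "represents moment_measure (adjoint_op H (E S)) (indicator S)" by simp
  then show ?thesis by (rule E_eqI[OF S, symmetric])
qed

text \<open>Again by two inductions: multiplicativity of polynomials of operators extends to indicators in one
  factor, and after swapping the factors to indicators in the other.\<close>
lemma E_Int: assumes S: "S \<in> sets borel" and S': "S' \<in> sets borel"
  shows "E (S \<inter> S') = comp_op H (E S) (E S')"
proof (rule E_eqI)
  have ES: "E S \<in> ops" using represents_E[OF S] by (rule representsD)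
  have ind: "M.adm (indicator S)" using S by (rule admissible_indicator)
  have cnj: "(\<lambda>l. cnj (indicator S l)) = indicator S" by (auto simp: indicator_def)
  have poly: "M.multiplicative (E S) (indicator S) (\<lambda>l. of_real (eval_poly p l))" for p
  proof -
    let ?h = "\<lambda>l. complex_of_real (eval_poly p l)"
    have poly_op_adj: "adjoint_op H (poly_op p) = poly_op p" by (intro adjoint_eqI) (simp_all add: poly_op_sym)
    have "M.multiplicative (poly_op p) ?h (indicator S)"
    proof (rule multiplicativeI[OF poly_op_ops eval_poly_admissible _ ind])
      show "M.multiplicative (poly_op p) ?h (\<lambda>l. of_real (eval_poly q l))" for q
        using represents_poly_op[of "p * q"] represents_poly_op[of q] by (auto simp: M.multiplicative_def poly_op_mult)
    qed
    then have "represents moment_measure (comp_op H (E S) (poly_op p)) (\<lambda>l. indicator S l * ?h l)"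
      using represents_E[OF S] by (intro M.represents_swap poly_op_ops) (simp_all add: poly_op_adj cnj)
    then show ?thesis using represents_poly_op[of p] by (auto simp: M.multiplicative_def)
  qed
  show "represents moment_measure (comp_op H (E S) (E S')) (indicator (S \<inter> S'))"
    using M.multiplicativeD[OF multiplicativeI[OF ES ind poly admissible_indicator[OF S']] represents_E[OF S']]
    by (simp add: indicator_inter_arith[abs_def])
qed (use S S' in auto)

lemma E_inner_self: "S \<in> sets borel \<Longrightarrow> x \<in> V \<Longrightarrow> ip (E S x) x = of_real (measure (moment_measure x) S)"
proof -
  assume S: "S \<in> sets borel" and x: "x \<in> V"
  interpret finite_measure "moment_measure x" by (rule moment_measure(2)[OF x])
  have "(\<integral>l. complex_of_real (indicator S l) \<partial>moment_measure x) = of_real (measure (moment_measure x) S)"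
    using S moment_measure(1)[OF x] by (simp add: integral_complex_of_real)
  moreover have "(\<lambda>l. complex_of_real (indicator S l)) = indicator S" by (auto simp: indicator_def)
  ultimately show ?thesis using representsD(2)[OF represents_E[OF S] x] by simp
qed

text \<open>Countable additivity on the diagonal is that of the moment measures, and polarization gives it off
  the diagonal.\<close>
lemma E_proj_valued: "proj_valued_measure H borel E"
  unfolding proj_valued_measure_def
proof (intro conjI allI ballI impI)
  show "E \<in> extensional (sets borel)" by (simp add: E_def)
  show "E {} = (\<lambda>x\<in>V. hzero H)"
    using M.represents_zero unfolding zero_op_def[symmetric] by (intro E_eqI) (simp_all add: indicator_def[abs_def])
  show "E (space borel) = id_op H"
    using M.represents_id by (intro E_eqI) (simp_all add: indicator_def[abs_def])
  fix S :: "complex set" assume S: "S \<in> sets borel"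
  have ES: "E S \<in> ops" using represents_E[OF S] by (rule representsD)
  have "comp_op H (E S) (E S) = E S" using E_Int[OF S S, symmetric] by simp
  then show "orth_projection H (E S)"
    using ES E_adjoint[OF S] by (simp add: orth_projection_def)
  show "E (S \<inter> S') = comp_op H (E S) (E S')" if "S' \<in> sets borel" for S' by (rule E_Int[OF S that])
next
  fix F :: "nat \<Rightarrow> complex set" and x y
  assume F: "range F \<subseteq> sets borel" "disjoint_family F" and x: "x \<in> V" and y: "y \<in> V"
  have Fn: "F n \<in> sets borel" for n using F by auto
  have UF: "(\<Union>n. F n) \<in> sets borel" using Fn by auto
  have ops: "E S \<in> ops" if "S \<in> sets borel" for S using represents_E[OF that] by (rule representsD)
  have diag: "(\<lambda>n. ip (E (F n) z) z) sums ip (E (\<Union>n. F n) z) z" if z: "z \<in> V" for z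
  proof -
    interpret finite_measure "moment_measure z" by (rule moment_measure(2)[OF z])
    have "(\<lambda>n. measure (moment_measure z) (F n)) sums measure (moment_measure z) (\<Union>n. F n)"
      using F moment_measure(1)[OF z] by (intro finite_measure_UNION) auto
    then show ?thesis using E_inner_self[OF Fn z] E_inner_self[OF UF z] by (simp add: sums_of_real)
  qed
  define q where "q T c = ip (T (hadd H x (hscale H c y))) (hadd H x (hscale H c y))" for T c
  have pol: "ip (T x) y = (q T 1 - q T (-1) + \<i> * q T \<i> - \<i> * q T (-\<i>)) / 4" if "T \<in> ops" for T
    using polarization[OF that x y] by (simp add: q_def mult.commute)
  have qs: "(\<lambda>n. q (E (F n)) c) sums q (E (\<Union>n. F n)) c" for c
    unfolding q_def using x y by (intro diag) auto
  show "(\<lambda>n. ip (E (F n) x) y) sums ip (E (\<Union>n. F n) x) y"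
    unfolding pol[OF ops[OF Fn]] pol[OF ops[OF UF]]
    by (intro sums_divide sums_diff sums_add sums_mult qs)
qed

text \<open>The set \<open>UNIV\<close> serves as a provisional carrier; that the square carries \<open>E\<close> is shown in
  \<open>spectral_pvm\<close>.\<close>
lemma scalar_measure_E: assumes x: "x \<in> V" shows "scalar_measure H borel E x = moment_measure x"
proof -
  interpret P: pvm H borel E UNIV
  proof
    show "proj_valued_measure H borel E" by (rule E_proj_valued)
    show "E (space borel - UNIV) = zero_op"
      using E_proj_valued by (simp add: proj_valued_measure_def zero_op_def)
  qed simp
  interpret finite_measure "moment_measure x" by (rule moment_measure(2)[OF x])
  show ?thesis
  proof (rule measure_eqI)
    show "sets (scalar_measure H borel E x) = sets (moment_measure x)"
      using moment_measure(1)[OF x] by simp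
    fix S assume "S \<in> sets (scalar_measure H borel E x)"
    then have S: "S \<in> sets borel" by simp
    show "emeasure (scalar_measure H borel E x) S = emeasure (moment_measure x) S"
      unfolding P.emeasure_scalar[OF x S] E_inner_self[OF S x] by (simp add: emeasure_eq_measure)
  qed
qed

theorem spectral_pvm:
  "pvm H borel E (centered_square K)" "represents (scalar_measure H borel E) (add_op A (scale_op \<i> B)) (\<lambda>l. l)"
proof -
  have cs: "centered_square K \<in> sets borel" by (rule borel_compact[OF compact_centered_square])
  show "pvm H borel E (centered_square K)"
  proof
    show "proj_valued_measure H borel E" by (rule E_proj_valued)
    show "centered_square K \<in> sets borel" by (rule cs)
    show "E (space borel - centered_square K) = zero_op"
    proof (rule op_eqI_diagonal)
      have S: "space borel - centered_square K \<in> sets borel" using cs by auto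
      show "E (space borel - centered_square K) \<in> ops" using represents_E[OF S] by (rule representsD)
      fix x assume x: "x \<in> V"
      show "ip (E (space borel - centered_square K) x) x = ip (zero_op x) x"
        unfolding E_inner_self[OF S x] using moment_measure(3)[OF x] x
        by (simp add: measure_def Compl_eq_Diff_UNIV[symmetric] inner_simps)
    qed simp
  qed
  have J1: "poly_op 1 = id_op H" using poly_op_const[of 1] by (intro op_eqI) (auto simp: one_pCons scale_one)
  have "represents moment_measure (poly_op X_poly) (\<lambda>l. of_real (Re l))"
    using represents_poly_op[of X_poly] by (simp only: eval_poly_simps)
  moreover have "poly_op X_poly = A" using poly_op_X[of 1] J1 by (intro op_eqI) auto
  ultimately have RA: "represents moment_measure A (\<lambda>l. of_real (Re l))" by simp
  have "represents moment_measure (poly_op Y_poly) (\<lambda>l. of_real (Im l))"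
    using represents_poly_op[of Y_poly] by (simp only: eval_poly_simps)
  moreover have "poly_op Y_poly = B" using poly_op_Y[of 1] J1 by (intro op_eqI) auto
  ultimately have RB: "represents moment_measure B (\<lambda>l. of_real (Im l))" by simp
  have adm: "M.adm (\<lambda>l. of_real (Re l))" "M.adm (\<lambda>l. of_real (Im l))"
    using eval_poly_admissible[of X_poly] eval_poly_admissible[of Y_poly] by (simp_all only: eval_poly_simps)
  have "represents moment_measure (add_op A (scale_op \<i> B)) (\<lambda>l. of_real (Re l) + \<i> * of_real (Im l))"
    by (intro M.represents_add M.represents_scale RA RB admissible_scale adm)
  then show "represents (scalar_measure H borel E) (add_op A (scale_op \<i> B)) (\<lambda>l. l)"
    unfolding represents_def complex_eq[symmetric] by (auto simp: scalar_measure_E)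
qed

end

context hilbert_space
begin

text \<open>Real part \<open>A = 1/2 (T + T')\<close> and imaginary part \<open>B = 1/(2 i) (T - T')\<close> of a normal operator
  \<open>T\<close> with adjoint \<open>T'\<close> commute.\<close>
theorem normal_operator_pvm:
  assumes "normal_op H T"
  shows "\<exists>E Q. bounded Q \<and> pvm H borel E Q \<and> represents (scalar_measure H borel E) T (\<lambda>l. l)"
proof -
  have T: "T \<in> ops" and TT: "comp_op H T (adjoint_op H T) = comp_op H (adjoint_op H T) T"
    using assms by (auto simp: normal_op_def)
  define T' where "T' = adjoint_op H T"
  have T': "T' \<in> ops" using T by (simp add: T'_def)
  have comm: "T (T' x) = T' (T x)" if "x \<in> V" for x
    using fun_cong[OF TT, of x] that by (simp add: T'_def)
  have adj: "ip (T x) y = ip x (T' y)" "ip (T' x) y = ip x (T y)" if "x \<in> V" "y \<in> V" for x y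
    unfolding T'_def using adjoint_inner[OF T that] adjoint_inner_left[OF T that] by simp_all
  define A where "A = scale_op (1/2) (add_op T T')"
  define B where "B = scale_op (- \<i> / 2) (add_op T (scale_op (-1) T'))"
  have A: "A \<in> ops" and B: "B \<in> ops" using T T' by (simp_all add: A_def B_def)
  have T_eq: "T = add_op A (scale_op \<i> B)"
    using T T' A B by (intro op_eqI_inner) (auto simp: A_def B_def inner_simps field_simps)
  obtain K1 where K1: "0 \<le> K1" "\<And>x. x \<in> V \<Longrightarrow> nrm (A x) \<le> K1 * nrm x" by (rule op_bound[OF A]) blast
  obtain K2 where K2: "0 \<le> K2" "\<And>x. x \<in> V \<Longrightarrow> nrm (B x) \<le> K2 * nrm x" by (rule op_bound[OF B]) blast
  define K where "K = K1 + K2 + 1"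
  have K: "nrm (A x) \<le> K * nrm x" "nrm (B x) \<le> K * nrm x" if "x \<in> V" for x
    using K1(2)[OF that] K2(2)[OF that] K1(1) K2(1) mult_right_mono[of K1 K "nrm x"] mult_right_mono[of K2 K "nrm x"] that
    by (auto simp: K_def)
  interpret commuting_pair H A B K
  proof
    fix x y assume x: "x \<in> V" and y: "y \<in> V"
    show "ip (A x) y = ip x (A y)" "ip (B x) y = ip x (B y)"
      using x y T T' by (simp_all add: A_def B_def inner_simps adj algebra_simps)
    show "nrm (A x) \<le> K * nrm x" "nrm (B x) \<le> K * nrm x" using K[OF x] by auto
    show "A (B x) = B (A x)"
      using x T T' by (intro vector_eqI) (auto simp: A_def B_def op_add op_scale comm inner_simps algebra_simps)
  qed (use A B K1 K2 in \<open>auto simp: K_def\<close>)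
  show ?thesis
    using spectral_pvm compact_imp_bounded[OF compact_centered_square] unfolding T_eq[symmetric] by blast
qed

end

section \<open>Spectrum, spectral measure and Borel functional calculus\<close>

text \<open>The projection-valued measure is still defined on all Borel sets of the plane; that it lives on the
  spectrum of \<open>T\<close> is to be shown.\<close>

locale borel_pvm = pvm H "borel :: complex measure" E Q
  for H :: "'a hspace" and E :: "complex set \<Rightarrow> 'a \<Rightarrow> 'a" and Q :: "complex set" +
  fixes T :: "'a \<Rightarrow> 'a"
  assumes Q_bounded: "bounded Q" and represents_T: "represents \<mu> T (\<lambda>l. l)"
begin

lemma adm_id: "adm (\<lambda>l. l)"
  by (rule admissible_id[OF Q_bounded])

definition shift :: "complex \<Rightarrow> 'a \<Rightarrow> 'a" where
  "shift c = (\<lambda>x\<in>V. hdiff H (T x) (hscale H c x))"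

lemma represents_shift: "represents \<mu> (shift c) (\<lambda>l. l - c)"
proof -
  have "shift c = (\<lambda>x\<in>V. hdiff H (T x) (scale_op c (id_op H) x))"
    by (auto simp: shift_def)
  then show ?thesis
    using represents_diff[OF represents_T represents_const[of c] adm_id admissible_const] by simp
qed

lemma adm_shift: "adm (\<lambda>l. l - c)"
  using admissible_add[OF adm_id admissible_const, of "- c"] by simp

lemma shift_ops: "shift c \<in> ops"
  using represents_shift by (rule representsD)

lemma not_in_spectrum_iff: "c \<notin> spectrum H T \<longleftrightarrow> (\<exists>B\<in>ops. comp_op H (shift c) B = id_op H \<and> comp_op H B (shift c) = id_op H)"
  by (simp add: spectrum_def shift_def)

text \<open>The resolvent at \<open>c\<close> is represented by \<open>1 / (l - c)\<close>, cut off to a bounded function on a ball that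
  \<open>E\<close> does not see.\<close>
lemma null_ball_not_in_spectrum:
  assumes r: "0 < r" and null: "E (ball c r) = zero_op"
  shows "c \<notin> spectrum H T"
proof -
  define g where "g l = indicator (- ball c r) l * inverse (l - c)" for l
  have gm: "g \<in> borel_measurable borel" unfolding g_def by measurable
  have adm: "adm g"
  proof (rule admissibleI[OF gm])
    show "cmod (g l) \<le> inverse r" for l
    proof (cases "l \<in> ball c r")
      case False
      then have "r \<le> cmod (l - c)" by (simp add: dist_norm norm_minus_commute)
      then show ?thesis using False r by (simp add: g_def norm_inverse norm_mult le_imp_inverse_le)
    qed (use r in \<open>simp add: g_def\<close>)
  qed
  obtain R where R: "represents \<mu> R g" using represents_exists[OF adm] by blast
  have one: "S = id_op H" if "represents \<mu> S (\<lambda>l. indicator (- ball c r) l)" for S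
  proof (rule op_eqI_diagonal)
    show "S \<in> ops" using that by (rule representsD)
    fix x assume x: "x \<in> V"
    have "AE l in \<mu> x. l \<notin> ball c r"
      using E_zero_iff[of "ball c r"] null x by (intro AE_I[of _ _ "ball c r"]) auto
    then have "(\<integral>l. indicator (- ball c r) l \<partial>\<mu> x) = (\<integral>l. 1 \<partial>\<mu> x :: complex)"
      by (intro integral_cong_AE) (auto simp: measurable_family[OF x] indicator_def elim: eventually_mono)
    then show "ip (S x) x = ip (id_op H x) x"
      using representsD(2)[OF that x] representsD(2)[OF represents_id x] by simp
  qed simp
  have eq: "(l - c) * g l = indicator (- ball c r) l" "g l * (l - c) = indicator (- ball c r) l" for l
    using r by (cases "l = c"; simp add: g_def indicator_def)+
  have "comp_op H (shift c) R = id_op H" "comp_op H R (shift c) = id_op H"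
    using represents_comp[OF represents_shift[of c] R adm_shift adm, unfolded eq]
      represents_comp[OF R represents_shift[of c] adm adm_shift, unfolded eq] by (blast intro: one)+
  then show ?thesis using representsD(1)[OF R] by (auto simp: not_in_spectrum_iff)
qed

text \<open>A vector \<open>y\<close> in the range of the projection of a ball of radius \<open>r\<close> satisfies
  \<open>\<parallel>(T - c) y\<parallel> \<le> r \<parallel>y\<parallel>\<close>. If \<open>T - c\<close> has an inverse bounded by \<open>K\<close>, then
  \<open>\<parallel>y\<parallel> \<le> K r \<parallel>y\<parallel>\<close>, which forces \<open>y = 0\<close> once \<open>K r < 1\<close>.\<close>
lemma not_in_spectrum_null_ball:
  assumes "c \<notin> spectrum H T"
  shows "\<exists>r>0. E (ball c r) = zero_op"
proof -
  obtain B where B: "B \<in> ops" "comp_op H B (shift c) = id_op H" using assms by (auto simp: not_in_spectrum_iff)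
  obtain K where K: "0 \<le> K" "\<And>x. x \<in> V \<Longrightarrow> nrm (B x) \<le> K * nrm x" by (rule op_bound[OF B(1)]) blast
  define r where "r = 1 / (2 * (K + 1))"
  have r: "0 < r" "K * r < 1" using K(1) by (auto simp: r_def field_simps)
  let ?b = "ball c r"
  have bs: "?b \<in> sets borel" by simp
  have "E ?b = zero_op"
  proof (rule op_eqI)
    fix x assume x: "x \<in> V"
    define y where "y = E ?b x"
    have y: "y \<in> V" using x by (simp add: y_def)
    have Ey: "E ?b y = y" using E_Int[OF bs bs] x comp_op_apply[of x "E ?b" "E ?b"] by (simp add: y_def)
    have "represents \<mu> (comp_op H (shift c) (E ?b)) (\<lambda>l. (l - c) * indicator ?b l)"
      by (intro represents_comp represents_shift represents_indicator adm_shift admissible_indicator) simp_all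
    then have "nrm (comp_op H (shift c) (E ?b) y) \<le> r * nrm y"
    proof (rule represents_contraction[OF _ admissible_mult[OF adm_shift admissible_indicator[OF bs]] _ _ y])
      show "0 \<le> r" using r by simp
      show "cmod ((l - c) * indicator ?b l) \<le> r" for l
        using r by (auto simp: indicator_def dist_norm norm_minus_commute)
    qed
    then have "nrm (shift c y) \<le> r * nrm y" using y Ey by simp
    then have "K * nrm (shift c y) \<le> K * (r * nrm y)" using K(1) by (rule mult_left_mono)
    moreover have "nrm y \<le> K * nrm (shift c y)"
      using K(2)[of "shift c y"] fun_cong[OF B(2), of y] y shift_ops by simp
    ultimately have "nrm y \<le> (K * r) * nrm y" by simp
    then have "(1 - K * r) * nrm y \<le> 0" by (simp add: algebra_simps)
    then have "nrm y \<le> 0" using r(2) by (simp add: mult_le_0_iff)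
    then have "nrm y = 0" using hnorm_nonneg[OF y] by linarith
    then show "E ?b x = zero_op x" using x hnorm_eq_zero[OF y] by (simp add: y_def)
  qed simp_all
  then show ?thesis using r by blast
qed

lemma E_null_subset: assumes "E A = zero_op" "A \<in> sets borel" "B \<in> sets borel" "B \<subseteq> A" shows "E B = zero_op"
proof -
  have "E B = comp_op H (E A) (E B)" using E_Int[of A B] assms by (simp add: Int_absorb1)
  also have "\<dots> = zero_op" using assms by (intro op_eqI) auto
  finally show ?thesis .
qed

lemma spectrum_eq: "- spectrum H T = \<Union> {ball c r | c r. 0 < r \<and> E (ball c r) = zero_op}"
proof (intro equalityI subsetI)
  fix c assume "c \<in> - spectrum H T"
  then obtain r where "0 < r" "E (ball c r) = zero_op" using not_in_spectrum_null_ball by auto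
  then have "ball c r \<in> {ball c r | c r. 0 < r \<and> E (ball c r) = zero_op}" "c \<in> ball c r"
    by (blast, simp)
  then show "c \<in> \<Union> {ball c r | c r. 0 < r \<and> E (ball c r) = zero_op}" by (rule UnionI)
next
  fix d assume "d \<in> \<Union> {ball c r | c r. 0 < r \<and> E (ball c r) = zero_op}"
  then obtain c r where cr: "0 < r" "E (ball c r) = zero_op" "d \<in> ball c r" by auto
  have "E (ball d (r - dist c d)) = zero_op"
  proof (rule E_null_subset[OF cr(2)])
    show "ball d (r - dist c d) \<subseteq> ball c r"
    proof
      fix l assume "l \<in> ball d (r - dist c d)"
      then show "l \<in> ball c r" using dist_triangle[of c l d] by simp
    qed
  qed simp_all
  then show "d \<in> - spectrum H T"
    using null_ball_not_in_spectrum[of "r - dist c d" d] cr by simp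
qed

lemma closed_spectrum: "closed (spectrum H T)"
  unfolding closed_def spectrum_eq by auto

lemma bounded_spectrum: "bounded (spectrum H T)"
proof (rule bounded_subset)
  show "bounded (closure Q)" by (rule bounded_closure[OF Q_bounded])
  show "spectrum H T \<subseteq> closure Q"
  proof
    fix c assume c: "c \<in> spectrum H T"
    show "c \<in> closure Q"
    proof (rule ccontr)
      assume "c \<notin> closure Q"
      then obtain r where r: "0 < r" "ball c r \<subseteq> - closure Q"
        using open_contains_ball[of "- closure Q"] by auto
      then have "ball c r \<subseteq> space borel - Q" using closure_subset[of Q] by auto
      then have "E (ball c r) = zero_op"
        using E_null_subset[OF Q_full] Q_sets by auto
      then show False using null_ball_not_in_spectrum[OF r(1)] c by blast
    qed
  qed
qed

text \<open>The complement of the spectrum is a union of null balls, of which countably many suffice by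
  Lindelof.\<close>
lemma E_spectrum: "E (- spectrum H T) = zero_op"
proof -
  let ?F = "{ball c r | c r. 0 < r \<and> E (ball c r) = zero_op}"
  obtain F where F: "F \<subseteq> ?F" "countable F" "\<Union>F = \<Union>?F"
    using Lindelof[of ?F] by blast
  have sm: "- spectrum H T \<in> sets borel" using closed_spectrum by auto
  show ?thesis
    unfolding E_zero_iff[OF sm]
  proof
    fix x assume x: "x \<in> V"
    have "(\<Union>S\<in>F. S) \<in> null_sets (\<mu> x)"
    proof (rule null_sets_UN'[OF F(2)])
      fix S assume "S \<in> F"
      then have "S \<in> sets borel" "E S = zero_op" using F(1) by auto
      then show "S \<in> null_sets (\<mu> x)" using x E_zero_iff[of S] by (auto simp: null_sets_def)
    qed
    then show "emeasure (\<mu> x) (- spectrum H T) = 0"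
      unfolding spectrum_eq F(3)[symmetric] by (simp add: null_sets_def)
  qed
qed

abbreviation \<sigma> :: "complex set" where "\<sigma> \<equiv> spectrum H T"

definition E_restrict :: "complex set \<Rightarrow> 'a \<Rightarrow> 'a" where
  "E_restrict = restrict E (sets (spectrum_borel H T))"

lemma spectrum_borel_set[measurable]: "\<sigma> \<in> sets borel"
  using closed_spectrum by (rule borel_closed)

lemma sets_spectrum_borel: "A \<in> sets (spectrum_borel H T) \<longleftrightarrow> A \<in> sets borel \<and> A \<subseteq> \<sigma>"
  using sets_restrict_space_iff[of \<sigma> borel A] by (auto)

lemma E_restrict_eq: "A \<in> sets borel \<Longrightarrow> A \<subseteq> \<sigma> \<Longrightarrow> E_restrict A = E A"
  by (simp add: E_restrict_def sets_spectrum_borel)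

lemma pvm_E_restrict: "pvm H (spectrum_borel H T) E_restrict \<sigma>"
proof
  have sp: "space (spectrum_borel H T) = \<sigma>" by (simp add: space_restrict_space)
  show "\<sigma> \<in> sets (spectrum_borel H T)" by (simp add: sets_spectrum_borel)
  have e: "E_restrict {} = zero_op" by (simp add: E_restrict_eq E_empty)
  then show "E_restrict (space (spectrum_borel H T) - \<sigma>) = zero_op" by (simp add: sp)
  show "proj_valued_measure H (spectrum_borel H T) E_restrict"
    unfolding proj_valued_measure_def
  proof (intro conjI allI ballI impI)
    show "E_restrict \<in> extensional (sets (spectrum_borel H T))" by (simp add: E_restrict_def)
    show "E_restrict {} = (\<lambda>x\<in>V. hzero H)" using e by (simp add: zero_op_def)
    have "E \<sigma> = id_op H"
    proof (rule op_eqI_diagonal)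
      fix x assume x: "x \<in> V"
      interpret finite_measure "\<mu> x" by (rule finite_family[OF x])
      have "measure (\<mu> x) (- \<sigma>) = 0"
        using E_spectrum E_zero_iff[of "- \<sigma>"] x by (simp add: measure_def)
      then have "measure (\<mu> x) \<sigma> = measure (\<mu> x) UNIV"
        using finite_measure_compl[of \<sigma>] by (simp add: Compl_eq_Diff_UNIV)
      then show "ip (E \<sigma> x) x = ip (id_op H x) x"
        using measure_scalar[OF x, of \<sigma>] total_mass[OF x] x by (simp add: inner_self)
    qed simp_all
    then show "E_restrict (space (spectrum_borel H T)) = id_op H" by (simp add: sp E_restrict_eq)
    fix A assume A: "A \<in> sets (spectrum_borel H T)"
    then have A': "A \<in> sets borel" "A \<subseteq> \<sigma>" by (auto simp: sets_spectrum_borel)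
    show "orth_projection H (E_restrict A)" using A' by (simp add: E_restrict_eq E_proj)
    fix B assume "B \<in> sets (spectrum_borel H T)"
    then have B': "B \<in> sets borel" "B \<subseteq> \<sigma>" by (auto simp: sets_spectrum_borel)
    show "E_restrict (A \<inter> B) = comp_op H (E_restrict A) (E_restrict B)"
      using A' B' E_restrict_eq[of "A \<inter> B"] by (simp add: E_restrict_eq E_Int le_infI1)
  next
    fix F :: "nat \<Rightarrow> complex set" and x y
    assume F: "range F \<subseteq> sets (spectrum_borel H T)" "disjoint_family F" and xy: "x \<in> V" "y \<in> V"
    have F': "F n \<in> sets borel" "F n \<subseteq> \<sigma>" for n using range_subsetD[OF F(1), of n] by (simp_all add: sets_spectrum_borel)
    have "E_restrict (F n) = E (F n)" for n using F' by (rule E_restrict_eq)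
    moreover have "E_restrict (\<Union>n. F n) = E (\<Union>n. F n)" using F' by (intro E_restrict_eq) auto
    ultimately show "(\<lambda>n. ip (E_restrict (F n) x) y) sums ip (E_restrict (\<Union>n. F n) x) y"
      using E_sums[of F x y] F' F(2) xy by auto
  qed
qed

lemma scalar_measure_E_restrict:
  assumes x: "x \<in> V"
  shows "scalar_measure H (spectrum_borel H T) E_restrict x = restrict_space (\<mu> x) \<sigma>"
proof -
  interpret P: pvm H "spectrum_borel H T" E_restrict \<sigma> by (rule pvm_E_restrict)
  have st: "sets (restrict_space (\<mu> x) \<sigma>) = sets (spectrum_borel H T)"
    by (intro sets_restrict_space_cong) simp
  show ?thesis
  proof (rule measure_eqI)
    show "sets (scalar_measure H (spectrum_borel H T) E_restrict x) = sets (restrict_space (\<mu> x) \<sigma>)"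
      using st by simp
    fix A assume "A \<in> sets (scalar_measure H (spectrum_borel H T) E_restrict x)"
    then have A: "A \<in> sets (spectrum_borel H T)" by simp
    then have A': "A \<in> sets borel" "A \<subseteq> \<sigma>" by (auto simp: sets_spectrum_borel)
    show "emeasure (scalar_measure H (spectrum_borel H T) E_restrict x) A = emeasure (restrict_space (\<mu> x) \<sigma>) A"
      using A' P.emeasure_scalar[OF x A] emeasure_scalar[OF x A'(1)]
      by (simp add: emeasure_restrict_space E_restrict_eq)
  qed
qed

lemma represents_T_restrict: "represents (scalar_measure H (spectrum_borel H T) E_restrict) T (\<lambda>l. l)"
proof -
  have "(\<integral>l. l \<partial>restrict_space (\<mu> x) \<sigma>) = (\<integral>l. l \<partial>\<mu> x)" if x: "x \<in> V" for x
  proof -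
    have "(\<integral>l. l \<partial>restrict_space (\<mu> x) \<sigma>) = (\<integral>l. indicator \<sigma> l *\<^sub>R l \<partial>\<mu> x)"
      by (rule integral_restrict_space) simp
    also have "\<dots> = (\<integral>l. l \<partial>\<mu> x)"
    proof (rule integral_cong_AE)
      have "AE l in \<mu> x. l \<notin> - \<sigma>"
        using E_zero_iff[of "- \<sigma>"] E_spectrum x by (intro AE_I[of _ _ "- \<sigma>"]) auto
      then show "AE l in \<mu> x. indicator \<sigma> l *\<^sub>R l = l" by eventually_elim simp
    qed (auto simp: measurable_family[OF x])
    finally show ?thesis .
  qed
  then show ?thesis
    using represents_T by (simp add: represents_def scalar_measure_E_restrict)
qed

end

locale normal_operator = hilbert_space H
  for H :: "'a hspace" +
  fixes T :: "'a \<Rightarrow> 'a"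
  assumes normal: "normal_op H T"
begin

abbreviation \<sigma> :: "complex set" where "\<sigma> \<equiv> spectrum H T"

lemma spectral_pvm_exists:
  "\<exists>E. pvm H (spectrum_borel H T) E \<sigma> \<and> represents (scalar_measure H (spectrum_borel H T) E) T (\<lambda>l. l)"
  and spectrum_closed: "closed \<sigma>" and spectrum_bounded: "bounded \<sigma>"
proof -
  obtain E Q where E: "bounded Q" "pvm H borel E Q" "represents (scalar_measure H borel E) T (\<lambda>l. l)"
    using normal_operator_pvm[OF normal] by blast
  interpret P: borel_pvm H E Q T by (intro borel_pvm.intro borel_pvm_axioms.intro E)
  show "closed \<sigma>" by (rule P.closed_spectrum)
  show "bounded \<sigma>" by (rule P.bounded_spectrum)
  show "\<exists>E. pvm H (spectrum_borel H T) E \<sigma> \<and> represents (scalar_measure H (spectrum_borel H T) E) T (\<lambda>l. l)"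
    using P.pvm_E_restrict P.represents_T_restrict by blast
qed

lemma spectrum_measurable: "\<sigma> \<in> sets borel"
  using spectrum_closed by (rule borel_closed)

lemma restrict_measurable: "f \<in> borel_measurable borel \<Longrightarrow> f \<in> borel_measurable (spectrum_borel H T)"
  by (rule measurable_restrict_space1)

text \<open>The functions that both measures represent by the same operator contain 1, are closed under
  multiplication with \<open>l\<close> and \<open>cnj l\<close> (composition with \<open>T\<close> and its adjoint) and under
  bounded limits; so they contain all indicators.\<close>
lemma spectral_pvm_unique:
  assumes E: "pvm H (spectrum_borel H T) E \<sigma>" "represents (scalar_measure H (spectrum_borel H T) E) T (\<lambda>l. l)"
    and F: "pvm H (spectrum_borel H T) F \<sigma>" "represents (scalar_measure H (spectrum_borel H T) F) T (\<lambda>l. l)"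
  shows "E = F"
proof -
  interpret E: pvm H "spectrum_borel H T" E \<sigma> by (rule E(1))
  interpret F: pvm H "spectrum_borel H T" F \<sigma> by (rule F(1))
  let ?P = "\<lambda>f. \<exists>R. represents E.\<mu> R f \<and> represents F.\<mu> R f"
  have adm: "E.adm f" if "admissible borel \<sigma> f" for f
    using that by (simp add: admissible_def restrict_measurable)
  have lim: "bounded_limit (spectrum_borel H T) \<sigma> G f" if "bounded_limit borel \<sigma> G f" for G f
    using that by (simp add: bounded_limit_def restrict_measurable)
  have idm: "E.adm (\<lambda>l. l)" by (rule adm[OF admissible_id[OF spectrum_bounded]])
  have all: "?P f" if "admissible borel \<sigma> f" for f
    using that
  proof (rule bounded_borel_induct[OF spectrum_bounded, where P="?P", rotated -1])
    show "?P (\<lambda>l. 1)" using E.represents_id F.represents_id by blast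
    show "?P (\<lambda>l. l * f l)" if "admissible borel \<sigma> f" "?P f" for f
      using that(2) E.represents_comp[OF E(2) _ idm adm[OF that(1)]] F.represents_comp[OF F(2) _ idm adm[OF that(1)]] by blast
    show "?P (\<lambda>l. cnj l * f l)" if "admissible borel \<sigma> f" "?P f" for f
      using that(2) E.represents_comp[OF E.represents_adjoint[OF E(2)] _ admissible_cnj[OF idm] adm[OF that(1)]]
        F.represents_comp[OF F.represents_adjoint[OF F(2)] _ admissible_cnj[OF idm] adm[OF that(1)]] by blast
    show "?P (\<lambda>x. f x + g x)" if "admissible borel \<sigma> f" "?P f" "admissible borel \<sigma> g" "?P g" for f g
      using that(2,4) E.represents_add[OF _ _ adm[OF that(1)] adm[OF that(3)]]
        F.represents_add[OF _ _ adm[OF that(1)] adm[OF that(3)]] by blast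
    show "?P (\<lambda>x. c * f x)" if "admissible borel \<sigma> f" "?P f" for c f
      using that(2) E.represents_scale[OF _ adm[OF that(1)]] F.represents_scale[OF _ adm[OF that(1)]] by blast
    show "?P f" if G: "bounded_limit borel \<sigma> G f" "\<And>n. ?P (G n)" for G f
    proof -
      obtain R where R: "\<And>n. represents E.\<mu> (R n) (G n)" "\<And>n. represents F.\<mu> (R n) (G n)" using G(2) by metis
      obtain S where S: "represents E.\<mu> S f" "\<And>x y. x \<in> V \<Longrightarrow> y \<in> V \<Longrightarrow> (\<lambda>n. ip (R n x) y) \<longlonglongrightarrow> ip (S x) y"
        using E.represents_limit[OF R(1) lim[OF G(1)]] by blast
      have "ip (S x) x = (\<integral>l. f l \<partial>F.\<mu> x)" if x: "x \<in> V" for x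
      proof (rule LIMSEQ_unique[OF S(2)[OF x x]])
        show "(\<lambda>n. ip (R n x) x) \<longlonglongrightarrow> (\<integral>l. f l \<partial>F.\<mu> x)"
          using F.tendsto_integral_family[OF lim[OF G(1)] x] representsD(2)[OF R(2) x] by simp
      qed
      then show ?thesis using S(1) by (auto simp: represents_def)
    qed
  qed
  show "E = F"
  proof (rule extensionalityI[OF E.E_extensional F.E_extensional])
    fix A assume A: "A \<in> sets (spectrum_borel H T)"
    then have "A \<in> sets borel" using spectrum_measurable sets_restrict_space_iff[of \<sigma> borel A] by auto
    then obtain R where R: "represents E.\<mu> R (indicator A)" "represents F.\<mu> R (indicator A)"
      using all[OF admissible_indicator] by blast
    show "E A = F A"
      using represents_unique[OF R(1) E.represents_indicator[OF A]]
        represents_unique[OF R(2) F.represents_indicator[OF A]] by simp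
  qed
qed

abbreviation E :: "complex set \<Rightarrow> 'a \<Rightarrow> 'a" where "E \<equiv> spectral_measure H T"

text \<open>The definite description for the spectral measure is met by exactly one measure; the
  integral occurring in it is itself a definite description and is first put into terms of
  \<open>represents\<close>.\<close>
lemma spectral_measure_props:
  "pvm H (spectrum_borel H T) E \<sigma>" "represents (scalar_measure H (spectrum_borel H T) E) T (\<lambda>l. l)"
proof -
  let ?S = "\<lambda>E. pvm H (spectrum_borel H T) E \<sigma> \<and> represents (scalar_measure H (spectrum_borel H T) E) T (\<lambda>l. l)"
  obtain F where F: "?S F" using spectral_pvm_exists by blast
  have iff: "proj_valued_measure H (spectrum_borel H T) G \<and> pvm_integral H (spectrum_borel H T) G (\<lambda>l. l) = T \<longleftrightarrow> ?S G" for G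
  proof
    assume G: "proj_valued_measure H (spectrum_borel H T) G \<and> pvm_integral H (spectrum_borel H T) G (\<lambda>l. l) = T"
    interpret G: pvm H "spectrum_borel H T" G \<sigma>
    proof
      have sp: "space (spectrum_borel H T) = \<sigma>" by (simp add: space_restrict_space)
      show "proj_valued_measure H (spectrum_borel H T) G" using G by blast
      show "\<sigma> \<in> sets (spectrum_borel H T)" using sets.top[of "spectrum_borel H T"] unfolding sp .
      show "G (space (spectrum_borel H T) - \<sigma>) = zero_op"
        using G by (simp add: sp proj_valued_measure_def zero_op_def)
    qed
    have "G.adm (\<lambda>l. l)"
      using admissible_id[OF spectrum_bounded] by (simp add: admissible_def restrict_measurable)
    then show "?S G" using G.represents_pvm_integral[of "\<lambda>l. l"] G G.pvm_axioms by auto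
  next
    assume "?S G"
    then interpret G: pvm H "spectrum_borel H T" G \<sigma> by blast
    show "proj_valued_measure H (spectrum_borel H T) G \<and> pvm_integral H (spectrum_borel H T) G (\<lambda>l. l) = T"
      using \<open>?S G\<close> G.pvm G.pvm_integral_eqI by blast
  qed
  have "E = F"
    unfolding spectral_measure_def iff
    by (rule the_equality) (use F spectral_pvm_unique in blast)+
  then show "pvm H (spectrum_borel H T) E \<sigma>" "represents (scalar_measure H (spectrum_borel H T) E) T (\<lambda>l. l)"
    using F by auto
qed

sublocale S: pvm H "spectrum_borel H T" "spectral_measure H T" "spectrum H T"
  by (rule spectral_measure_props)

lemma represents_T: "represents S.\<mu> T (\<lambda>l. l)"
  by (rule spectral_measure_props)

lemma represents_borel_calculus: "S.adm f \<Longrightarrow> represents S.\<mu> (borel_calculus H f T) f"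
  unfolding borel_calculus_def by (rule S.represents_pvm_integral)

abbreviation calc :: "(complex \<Rightarrow> complex) \<Rightarrow> 'a \<Rightarrow> 'a" where "calc f \<equiv> borel_calculus H f T"

lemma admissible_restrict:
  assumes "admissible borel Q f" "\<sigma> \<subseteq> Q" shows "S.adm f"
  using assms bounded_subset[OF _ image_mono[OF assms(2)]]
  by (auto simp: admissible_def intro: restrict_measurable)

lemma adm_id: "S.adm (\<lambda>l. l)"
  by (rule admissible_restrict[OF admissible_id[OF spectrum_bounded] order_refl])

lemma calc_eqI: "S.adm f \<Longrightarrow> represents S.\<mu> R f \<Longrightarrow> calc f = R"
  using represents_borel_calculus represents_unique by blast

lemma calc_ops: "S.adm f \<Longrightarrow> calc f \<in> ops"
  using represents_borel_calculus by (rule representsD)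

lemma calc_one: "calc (\<lambda>l. 1) = id_op H"
  by (rule calc_eqI[OF admissible_const S.represents_id])

text \<open>In \<open>calc_mult_id\<close> the operator is applied first, in \<open>calc_mult_cnj\<close> the adjoint is applied last. The
  two orders suit decomposability: in an inner product the operator then acts on the first vector, or,
  across the inner product, on the second one.\<close>
lemma calc_mult_id: "S.adm f \<Longrightarrow> calc (\<lambda>l. l * f l) = comp_op H (calc f) T"
  using S.represents_comp[OF represents_borel_calculus represents_T _ adm_id, of f]
    admissible_mult[OF adm_id, of f]
  by (intro calc_eqI) (simp_all add: mult.commute)

lemma calc_mult_cnj: "S.adm f \<Longrightarrow> calc (\<lambda>l. cnj l * f l) = comp_op H (adjoint_op H T) (calc f)"
  by (intro calc_eqI S.represents_comp S.represents_adjoint represents_T represents_borel_calculus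
      admissible_mult admissible_cnj adm_id)

lemma calc_add: "S.adm f \<Longrightarrow> S.adm g \<Longrightarrow> calc (\<lambda>l. f l + g l) = add_op (calc f) (calc g)"
  by (intro calc_eqI S.represents_add represents_borel_calculus admissible_add)

lemma calc_scale: "S.adm f \<Longrightarrow> calc (\<lambda>l. c * f l) = scale_op c (calc f)"
  by (intro calc_eqI S.represents_scale represents_borel_calculus admissible_scale)

lemma calc_cong:
  assumes f: "S.adm f" and g: "S.adm g" and eq: "\<And>l. l \<in> \<sigma> \<Longrightarrow> f l = g l"
  shows "calc f = calc g"
  using S.represents_cong[OF represents_borel_calculus[OF g] admissibleD(1)[OF g] admissibleD(1)[OF f]] eq
  by (intro calc_eqI f) simp

lemma calc_limit:
  assumes F: "bounded_limit borel Q F f" "\<sigma> \<subseteq> Q" and x: "x \<in> V" and y: "y \<in> V"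
  shows "(\<lambda>n. ip (calc (F n) x) y) \<longlonglongrightarrow> ip (calc f x) y"
proof -
  have F': "bounded_limit (spectrum_borel H T) \<sigma> F f"
    using F unfolding bounded_limit_def by (blast intro: restrict_measurable)
  obtain R where R: "represents S.\<mu> R f" "\<And>x y. x \<in> V \<Longrightarrow> y \<in> V \<Longrightarrow> (\<lambda>n. ip (calc (F n) x) y) \<longlonglongrightarrow> ip (R x) y"
    using S.represents_limit[OF represents_borel_calculus[OF bounded_limit_admissible(1)[OF F']] F'] by blast
  show ?thesis using R(2)[OF x y] calc_eqI[OF bounded_limit_admissible(2)[OF F'] R(1)] by simp
qed

lemma calc_contraction:
  "\<lbrakk>S.adm f; 0 \<le> B; \<And>l. l \<in> \<sigma> \<Longrightarrow> cmod (f l) \<le> B; x \<in> V\<rbrakk> \<Longrightarrow> nrm (calc f x) \<le> B * nrm x"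
  by (rule S.represents_contraction[OF represents_borel_calculus])

end

section \<open>The direct integral is a Hilbert space\<close>

context measurable_hilbert_field
begin

sublocale fib: hilbert_space "H z" for z
  by (rule fibre_hilbert)

abbreviation L2 :: "('z \<Rightarrow> 'h) set" where "L2 \<equiv> sq_integrable_fields M H S"
abbreviation DI :: "('z \<Rightarrow> 'h) set hspace" where "DI \<equiv> direct_integral M H S"
abbreviation cls :: "('z \<Rightarrow> 'h) \<Rightarrow> ('z \<Rightarrow> 'h) set" where "cls \<equiv> ae_class M H S"

lemma field_closed[simp]: "x \<in> S \<Longrightarrow> x z \<in> hcarrier (H z)"
  using fields_subset by (auto simp: vector_fields_def)

lemma cnj_measurable: "f \<in> borel_measurable M \<Longrightarrow> (\<lambda>z. cnj (f z)) \<in> borel_measurable M"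
  by (rule measurable_compose[where N=borel]) (auto intro!: borel_measurable_continuous_onI continuous_on_cnj continuous_on_id)

text \<open>The main tool for measurability of fields: maximality of \<open>S\<close> makes weak measurability
  sufficient.\<close>
lemma fieldI:
  assumes v: "\<And>z. v z \<in> hcarrier (H z)" and m: "\<And>y. y \<in> S \<Longrightarrow> (\<lambda>z. hinner (H z) (v z) (y z)) \<in> borel_measurable M"
  shows "v \<in> S"
proof (rule fields_maximal)
  show "v \<in> vector_fields H" using v by (simp add: vector_fields_def)
  fix y assume y: "y \<in> S"
  have "(\<lambda>z. hinner (H z) (y z) (v z)) = (\<lambda>z. cnj (hinner (H z) (v z) (y z)))"
    using v y by (auto simp: fun_eq_iff intro: fib.inner_commute)
  then show "(\<lambda>z. hinner (H z) (y z) (v z)) \<in> borel_measurable M"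
    using cnj_measurable[OF m[OF y]] by simp
qed

lemma zero_field: "(\<lambda>z. hzero (H z)) \<in> S"
  by (rule fieldI) (auto simp: fib.inner_simps)

lemma add_field: "x \<in> S \<Longrightarrow> y \<in> S \<Longrightarrow> (\<lambda>z. hadd (H z) (x z) (y z)) \<in> S"
  by (rule fieldI) (auto simp: fib.inner_simps intro!: borel_measurable_add inner_measurable)

lemma scale_field: "x \<in> S \<Longrightarrow> (\<lambda>z. hscale (H z) c (x z)) \<in> S"
  by (rule fieldI) (auto simp: fib.inner_simps intro!: borel_measurable_times inner_measurable)

lemma diff_field: "x \<in> S \<Longrightarrow> y \<in> S \<Longrightarrow> (\<lambda>z. hdiff (H z) (x z) (y z)) \<in> S"
  unfolding hdiff_def by (intro add_field scale_field)

lemma norm_measurable: "x \<in> S \<Longrightarrow> (\<lambda>z. hnorm (H z) (x z)) \<in> borel_measurable M"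
  unfolding hnorm_def using inner_measurable[of x x] by measurable

lemma L2D: "x \<in> L2 \<Longrightarrow> x \<in> S" "x \<in> L2 \<Longrightarrow> integrable M (\<lambda>z. (hnorm (H z) (x z))\<^sup>2)"
  by (auto simp: sq_integrable_fields_def)

lemma L2_bound:
  assumes "x \<in> S" "integrable M g" "\<And>z. (hnorm (H z) (x z))\<^sup>2 \<le> g z" shows "x \<in> L2"
  unfolding sq_integrable_fields_def
proof (intro CollectI conjI assms(1) Bochner_Integration.integrable_bound[OF assms(2)])
  show "AE z in M. norm ((hnorm (H z) (x z))\<^sup>2) \<le> norm (g z)"
    using assms(3) by (intro always_eventually allI) (metis abs_ge_self abs_of_nonneg order_trans real_norm_def zero_le_power2)
qed (use norm_measurable[OF assms(1)] in measurable)

lemma zero_L2: "(\<lambda>z. hzero (H z)) \<in> L2"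
  by (rule L2_bound[OF zero_field, of "\<lambda>_. 0"]) (auto simp: fib.hnorm_zero)

lemma scale_L2: "x \<in> L2 \<Longrightarrow> (\<lambda>z. hscale (H z) c (x z)) \<in> L2"
  by (rule L2_bound[OF scale_field, of _ "\<lambda>z. (cmod c)\<^sup>2 * (hnorm (H z) (x z))\<^sup>2"])
    (auto dest: L2D simp: fib.hnorm_scale power_mult_distrib)

lemma add_L2: assumes x: "x \<in> L2" and y: "y \<in> L2" shows "(\<lambda>z. hadd (H z) (x z) (y z)) \<in> L2"
proof (rule L2_bound[OF add_field])
  show "x \<in> S" "y \<in> S" using x y by (auto dest: L2D)
  then have c: "x z \<in> hcarrier (H z)" "y z \<in> hcarrier (H z)" for z by auto
  show "integrable M (\<lambda>z. 2 * (hnorm (H z) (x z))\<^sup>2 + 2 * (hnorm (H z) (y z))\<^sup>2)"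
    using L2D(2)[OF x] L2D(2)[OF y] by simp
  fix z
  have "0 \<le> (hnorm (H z) (hdiff (H z) (x z) (y z)))\<^sup>2" by simp
  then show "(hnorm (H z) (hadd (H z) (x z) (y z)))\<^sup>2 \<le> 2 * (hnorm (H z) (x z))\<^sup>2 + 2 * (hnorm (H z) (y z))\<^sup>2"
    unfolding fib.hnorm_add_sq[OF c] fib.hnorm_diff_sq[OF c] by simp
qed

lemma diff_L2: "x \<in> L2 \<Longrightarrow> y \<in> L2 \<Longrightarrow> (\<lambda>z. hdiff (H z) (x z) (y z)) \<in> L2"
  unfolding hdiff_def by (intro add_L2 scale_L2)

lemma inner_le_squares:
  assumes "x \<in> hcarrier (H z)" "y \<in> hcarrier (H z)"
  shows "cmod (hinner (H z) x y) \<le> (hnorm (H z) x)\<^sup>2 + (hnorm (H z) y)\<^sup>2"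
proof -
  have "cmod (hinner (H z) x y) \<le> hnorm (H z) x * hnorm (H z) y" using assms by (rule fib.Cauchy_Schwarz)
  moreover have "0 \<le> (hnorm (H z) x - hnorm (H z) y)\<^sup>2" by simp
  moreover have "0 \<le> hnorm (H z) x * hnorm (H z) y" using assms by simp
  ultimately show ?thesis unfolding power2_diff by linarith
qed

lemma inner_integrable:
  assumes x: "x \<in> L2" and y: "y \<in> L2" shows "integrable M (\<lambda>z. hinner (H z) (x z) (y z))"
proof (rule Bochner_Integration.integrable_bound)
  show "integrable M (\<lambda>z. (hnorm (H z) (x z))\<^sup>2 + (hnorm (H z) (y z))\<^sup>2)"
    using L2D(2)[OF x] L2D(2)[OF y] by simp
  show "(\<lambda>z. hinner (H z) (x z) (y z)) \<in> borel_measurable M"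
    using L2D(1)[OF x] L2D(1)[OF y] by (rule inner_measurable)
  show "AE z in M. cmod (hinner (H z) (x z) (y z)) \<le> norm ((hnorm (H z) (x z))\<^sup>2 + (hnorm (H z) (y z))\<^sup>2)"
    using inner_le_squares L2D(1)[OF x] L2D(1)[OF y] by (intro always_eventually) simp
qed

lemma in_cls: "x \<in> L2 \<Longrightarrow> y \<in> cls x \<longleftrightarrow> y \<in> L2 \<and> (AE z in M. x z = y z)"
  by (auto simp: ae_equal_def)

lemma cls_eqI: assumes "x \<in> L2" "y \<in> L2" "AE z in M. x z = y z" shows "cls x = cls y"
proof (rule set_eqI)
  fix w
  have "(AE z in M. x z = w z) \<longleftrightarrow> (AE z in M. y z = w z)"
  proof
    assume "AE z in M. x z = w z" with assms(3) show "AE z in M. y z = w z" by eventually_elim simp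
  next
    assume "AE z in M. y z = w z" with assms(3) show "AE z in M. x z = w z" by eventually_elim simp
  qed
  then show "w \<in> cls x \<longleftrightarrow> w \<in> cls y" using assms by (simp only: in_cls)
qed

lemma self_in_cls: "x \<in> L2 \<Longrightarrow> x \<in> cls x"
  by (simp add: in_cls del: Image_singleton_iff)

lemma cls_empty: "x \<notin> L2 \<Longrightarrow> cls x = {}"
  by (auto simp: ae_equal_def)

lemma representative_cls: "x \<in> L2 \<Longrightarrow> representative (cls x) \<in> L2 \<and> (AE z in M. x z = representative (cls x) z)"
  using in_cls[of x] someI[of "\<lambda>y. y \<in> cls x", OF self_in_cls[of x]] by (simp add: representative_def)

lemma DI_carrier: "hcarrier DI = cls ` L2"
  by (auto simp: direct_integral_def quotient_def)

lemma cls_closed: "x \<in> L2 \<Longrightarrow> cls x \<in> hcarrier DI"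
  by (simp add: DI_carrier)

lemma representative_carrier:
  assumes "A \<in> hcarrier DI" shows "representative A \<in> L2" "cls (representative A) = A"
proof -
  obtain x where x: "x \<in> L2" "A = cls x" using assms by (auto simp: DI_carrier)
  show "representative A \<in> L2" using representative_cls[OF x(1)] x(2) by simp
  show "cls (representative A) = A"
    using representative_cls[OF x(1)] x by (intro cls_eqI[symmetric, of x, folded x(2)]) auto
qed

lemma DI_zero: "hzero DI = cls (\<lambda>z. hzero (H z))"
  by (simp add: direct_integral_def)

lemma DI_add: assumes "x \<in> L2" "y \<in> L2" shows "hadd DI (cls x) (cls y) = cls (\<lambda>z. hadd (H z) (x z) (y z))"
proof -
  note r = representative_cls[OF assms(1)] representative_cls[OF assms(2)]
  from r(1)[THEN conjunct2] r(2)[THEN conjunct2]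
  have "AE z in M. hadd (H z) (representative (cls x) z) (representative (cls y) z) = hadd (H z) (x z) (y z)"
    by eventually_elim simp
  then have "cls (\<lambda>z. hadd (H z) (representative (cls x) z) (representative (cls y) z)) = cls (\<lambda>z. hadd (H z) (x z) (y z))"
    using r assms by (intro cls_eqI add_L2) auto
  then show ?thesis by (simp add: direct_integral_def)
qed

lemma DI_scale: assumes "x \<in> L2" shows "hscale DI c (cls x) = cls (\<lambda>z. hscale (H z) c (x z))"
proof -
  note r = representative_cls[OF assms(1)]
  from r(1)[THEN conjunct2]
  have "AE z in M. hscale (H z) c (representative (cls x) z) = hscale (H z) c (x z)"
    by eventually_elim simp
  then have "cls (\<lambda>z. hscale (H z) c (representative (cls x) z)) = cls (\<lambda>z. hscale (H z) c (x z))"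
    using r assms by (intro cls_eqI scale_L2) auto
  then show ?thesis by (simp add: direct_integral_def)
qed

lemma DI_inner: assumes "x \<in> L2" "y \<in> L2" shows "hinner DI (cls x) (cls y) = (\<integral>z. hinner (H z) (x z) (y z) \<partial>M)"
proof -
  note r = representative_cls[OF assms(1)] representative_cls[OF assms(2)]
  have "(\<integral>z. hinner (H z) (representative (cls x) z) (representative (cls y) z) \<partial>M) = (\<integral>z. hinner (H z) (x z) (y z) \<partial>M)"
  proof (rule integral_cong_AE)
    from r(1)[THEN conjunct2] r(2)[THEN conjunct2]
    show "AE z in M. hinner (H z) (representative (cls x) z) (representative (cls y) z) = hinner (H z) (x z) (y z)"
      by eventually_elim simp
  qed (use r assms L2D(1) in \<open>auto intro!: inner_measurable\<close>)
  then show ?thesis by (simp add: direct_integral_def)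
qed

lemma DI_diff: assumes "x \<in> L2" "y \<in> L2" shows "hdiff DI (cls x) (cls y) = cls (\<lambda>z. hdiff (H z) (x z) (y z))"
  unfolding hdiff_def DI_scale[OF assms(2)] by (rule DI_add[OF assms(1) scale_L2[OF assms(2)]])

lemma DI_inner_self: assumes "x \<in> L2" shows "hinner DI (cls x) (cls x) = of_real (\<integral>z. (hnorm (H z) (x z))\<^sup>2 \<partial>M)"
proof -
  have "(\<lambda>z. hinner (H z) (x z) (x z)) = (\<lambda>z. of_real ((hnorm (H z) (x z))\<^sup>2))"
    using L2D(1)[OF assms] by (auto simp: fun_eq_iff fib.inner_self)
  then show ?thesis unfolding DI_inner[OF assms assms] by (simp only: integral_complex_of_real)
qed

lemma DI_norm: assumes "x \<in> L2" shows "(hnorm DI (cls x))\<^sup>2 = (\<integral>z. (hnorm (H z) (x z))\<^sup>2 \<partial>M)"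
  by (simp add: hnorm_def[of DI] DI_inner_self[OF assms])

text \<open>Weighting the squares by \<open>2\<^sup>k\<close> turns a bound on them into geometric decay of the norms
  themselves. It allows working in \<open>DI_complete\<close> with a series of squares, where monotone convergence
  applies, instead of an infinite Minkowski inequality.\<close>
lemma pointwise_limit_exists:
  assumes x: "\<And>k. x k \<in> hcarrier (H z)" and C: "\<And>k. 2 ^ k * (hnorm (H z) (hdiff (H z) (x (Suc k)) (x k)))\<^sup>2 \<le> C"
  shows "\<exists>l\<in>hcarrier (H z). (\<lambda>k. hnorm (H z) (hdiff (H z) (x k) l)) \<longlonglongrightarrow> 0"
proof (rule fib.complete[OF x])
  let ?N = "hnorm (H z)" and ?d = "\<lambda>k. hnorm (H z) (hdiff (H z) (x (Suc k)) (x k))"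
  have dn: "0 \<le> ?d k" for k using x by simp
  define q where "q = sqrt (1/2)"
  have q: "0 \<le> q" "q < 1" "q\<^sup>2 = 1/2" by (auto simp: q_def real_less_lsqrt)
  have C0: "0 \<le> C" using C[of 0] by (meson mult_nonneg_nonneg order_trans zero_le_numeral zero_le_power zero_le_power2)
  have d: "?d k \<le> sqrt C * q ^ k" for k
  proof (rule power2_le_imp_le)
    have "(sqrt C * q ^ k)\<^sup>2 = C * (q\<^sup>2) ^ k" using C0 by (simp add: power_mult_distrib power_mult[symmetric] mult.commute)
    also have "\<dots> = C / 2 ^ k" by (simp add: q(3) power_divide)
    finally have "(sqrt C * q ^ k)\<^sup>2 = C / 2 ^ k" .
    then show "(?d k)\<^sup>2 \<le> (sqrt C * q ^ k)\<^sup>2" using C[of k] by (simp only: pos_le_divide_eq zero_less_power zero_less_numeral mult.commute)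
  qed (use C0 q in simp)
  have "summable (\<lambda>k. sqrt C * q ^ k)" using q by (intro summable_mult summable_geometric) simp
  then have sum: "summable ?d" by (rule summable_comparison_test') (use d dn in auto)
  have tele: "?N (hdiff (H z) (x (m + j)) (x m)) \<le> (\<Sum>k\<in>{m..<m + j}. ?d k)" for m j
  proof (induction j)
    case 0
    then show ?case using x by (simp add: fib.add_minus fib.hnorm_zero)
  next
    case (Suc j)
    have "hdiff (H z) (x (m + Suc j)) (x m) = hadd (H z) (hdiff (H z) (x (Suc (m + j))) (x (m + j))) (hdiff (H z) (x (m + j)) (x m))"
      using x by (intro fib.vector_eqI[of _ z]) (simp_all add: fib.inner_simps)
    then have "?N (hdiff (H z) (x (m + Suc j)) (x m)) \<le> ?d (m + j) + ?N (hdiff (H z) (x (m + j)) (x m))"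
      using x fib.hnorm_triangle by simp
    then show ?case using Suc by simp
  qed
  fix e :: real assume e: "0 < e"
  obtain N where N: "\<And>m n. m \<ge> N \<Longrightarrow> norm (\<Sum>k\<in>{m..<n}. ?d k) < e"
    using sum e unfolding summable_Cauchy by meson
  have le: "?N (hdiff (H z) (x n) (x m)) < e" if mn: "m \<ge> N" "m \<le> n" for m n
  proof -
    obtain j where n: "n = m + j" using mn(2) le_Suc_ex by blast
    have "?N (hdiff (H z) (x n) (x m)) \<le> (\<Sum>k\<in>{m..<n}. ?d k)" unfolding n by (rule tele)
    also have "\<dots> < e" using N[OF mn(1), of n] by simp
    finally show ?thesis .
  qed
  show "\<exists>N. \<forall>m\<ge>N. \<forall>n\<ge>N. ?N (hdiff (H z) (x m) (x n)) < e"
  proof (intro exI allI impI)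
    fix m n assume "N \<le> m" "N \<le> n"
    then show "?N (hdiff (H z) (x m) (x n)) < e"
      using le[of m n] le[of n m] fib.hnorm_minus_commute[of "x m" z "x n"] x by (cases "m \<le> n") auto
  qed
qed

text \<open>Riesz-Fischer. A subsequence with increments at most \<open>2\<^sup>-\<^sup>k\<close> in norm converges in almost every
  fibre, and Fatou's lemma turns this into convergence of the whole sequence in the direct integral.\<close>
lemma DI_complete:
  assumes s: "\<And>n. s n \<in> hcarrier DI"
    and Cauchy: "\<And>e. 0 < e \<Longrightarrow> \<exists>N. \<forall>m\<ge>N. \<forall>n\<ge>N. hnorm DI (hdiff DI (s m) (s n)) < e"
  shows "\<exists>l\<in>hcarrier DI. (\<lambda>n. hnorm DI (hdiff DI (s n) l)) \<longlonglongrightarrow> 0"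
proof -
  define x where "x n = representative (s n)" for n
  have x: "x n \<in> L2" and sx: "s n = cls (x n)" for n
    using representative_carrier[OF s] by (simp_all add: x_def)
  have xS: "x n \<in> S" for n using x by (rule L2D)
  define I where "I u v = (\<integral>\<^sup>+ z. ennreal ((hnorm (H z) (hdiff (H z) (u z) (v z)))\<^sup>2) \<partial>M)" for u v
  have I_L2: "I u v = ennreal ((hnorm DI (hdiff DI (cls u) (cls v)))\<^sup>2)" if "u \<in> L2" "v \<in> L2" for u v
    unfolding I_def DI_diff[OF that] DI_norm[OF diff_L2[OF that]]
    by (rule nn_integral_eq_integral) (use L2D(2)[OF diff_L2[OF that]] in auto)
  have I_small: "\<exists>N. \<forall>m\<ge>N. \<forall>n\<ge>N. I (x m) (x n) \<le> ennreal (e\<^sup>2)" if "0 < e" for e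
  proof -
    obtain N where N: "\<And>m n. m \<ge> N \<Longrightarrow> n \<ge> N \<Longrightarrow> hnorm DI (hdiff DI (s m) (s n)) < e" using Cauchy[OF \<open>0 < e\<close>] by blast
    have "I (x m) (x n) \<le> ennreal (e\<^sup>2)" if "m \<ge> N" "n \<ge> N" for m n
    proof -
      have "0 \<le> hnorm DI (hdiff DI (s m) (s n))"
        unfolding sx DI_diff[OF x x] by (simp add: hnorm_def[of DI] DI_inner_self[OF diff_L2[OF x x]])
      then have "(hnorm DI (hdiff DI (s m) (s n)))\<^sup>2 \<le> e\<^sup>2" using N[OF that] by (intro power_mono) auto
      then show ?thesis unfolding I_L2[OF x x] sx[symmetric] by (rule ennreal_leI)
    qed
    then show ?thesis by blast
  qed
  have "\<exists>N. \<forall>m\<ge>N. \<forall>n\<ge>N. I (x m) (x n) \<le> ennreal (((1/2) ^ k)\<^sup>2)" for k :: nat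
    by (rule I_small) simp
  then obtain N where N: "\<And>k m n. m \<ge> N k \<Longrightarrow> n \<ge> N k \<Longrightarrow> I (x m) (x n) \<le> ennreal (((1/2) ^ k)\<^sup>2)" by metis
  define r where "r k = k + (\<Sum>i\<le>k. N i)" for k
  have r_N: "r k \<ge> N k" for k unfolding r_def by (simp add: member_le_sum trans_le_add2)
  have r_Suc: "r k \<le> r (Suc k)" for k by (simp add: r_def)
  have r_k: "r k \<ge> k" for k by (simp add: r_def)
  define d where "d k z = hdiff (H z) (x (r (Suc k)) z) (x (r k) z)" for k z
  have dS: "d k \<in> S" for k unfolding d_def using diff_field[OF xS xS] .
  define g where "g z = (\<Sum>k. ennreal (2 ^ k * (hnorm (H z) (d k z))\<^sup>2))" for z
  have gm: "g \<in> borel_measurable M" unfolding g_def using norm_measurable[OF dS] by measurable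
  have "(\<integral>\<^sup>+ z. g z \<partial>M) = (\<Sum>k. \<integral>\<^sup>+ z. ennreal (2 ^ k * (hnorm (H z) (d k z))\<^sup>2) \<partial>M)"
    unfolding g_def using norm_measurable[OF dS] by (intro nn_integral_suminf) measurable
  also have "\<dots> \<le> (\<Sum>k. ennreal ((1/2) ^ k))"
  proof (rule suminf_le)
    fix k
    have "(\<integral>\<^sup>+ z. ennreal (2 ^ k * (hnorm (H z) (d k z))\<^sup>2) \<partial>M) = ennreal (2 ^ k) * I (x (r (Suc k))) (x (r k))"
      unfolding I_def d_def[symmetric] using norm_measurable[OF dS[of k]]
      by (subst nn_integral_cmult[symmetric]) (auto simp: ennreal_mult)
    also have "\<dots> \<le> ennreal (2 ^ k) * ennreal (((1/2) ^ k)\<^sup>2)"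
      by (intro mult_left_mono N order_trans[OF r_N r_Suc] r_N) simp
    also have "\<dots> = ennreal ((1/2) ^ k)"
      by (simp add: ennreal_mult[symmetric] power2_eq_square power_mult_distrib[symmetric])
    finally show "(\<integral>\<^sup>+ z. ennreal (2 ^ k * (hnorm (H z) (d k z))\<^sup>2) \<partial>M) \<le> ennreal ((1/2) ^ k)" .
  qed auto
  also have "\<dots> = ennreal (\<Sum>k. (1/2) ^ k)"
    by (rule suminf_ennreal2) (auto intro: summable_geometric)
  also have "\<dots> < \<infinity>" by simp
  finally have g_fin: "AE z in M. g z \<noteq> \<infinity>"
    using gm by (intro nn_integral_noteq_infinite) auto
  \<comment> \<open>The limit field is set to zero off the measurable set \<open>G\<close> of convergence, so that it is a limit
    of measurable functions at every point.\<close>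
  define G where "G = {z \<in> space M. g z \<noteq> \<infinity>}"
  have "G = space M - (g -` {\<infinity>} \<inter> space M)" by (auto simp: G_def)
  then have G: "G \<in> sets M" using measurable_sets[OF gm, of "{\<infinity>}"] by simp
  have "\<exists>l\<in>hcarrier (H z). (\<lambda>k. hnorm (H z) (hdiff (H z) (x (r k) z) l)) \<longlonglongrightarrow> 0" if "z \<in> G" for z
  proof (rule pointwise_limit_exists[where x="\<lambda>k. x (r k) z" and z=z and C="enn2real (g z)"])
    fix k
    define F where "F k = ennreal (2 ^ k * (hnorm (H z) (d k z))\<^sup>2)" for k
    have "sum F {k} \<le> suminf F" by (rule sum_le_suminf) auto
    then have "ennreal (2 ^ k * (hnorm (H z) (d k z))\<^sup>2) \<le> g z"
      by (simp only: F_def[symmetric] g_def sum.insert finite.emptyI empty_iff sum.empty add_0_right simp_thms)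
    moreover have "g z < \<infinity>" using that by (simp add: G_def less_top)
    ultimately have "enn2real (ennreal (2 ^ k * (hnorm (H z) (d k z))\<^sup>2)) \<le> enn2real (g z)"
      by (intro enn2real_mono) auto
    then show "2 ^ k * (hnorm (H z) (hdiff (H z) (x (r (Suc k)) z) (x (r k) z)))\<^sup>2 \<le> enn2real (g z)"
      unfolding d_def by simp
  qed (use xS in auto)
  then obtain l0 where l0: "\<And>z. z \<in> G \<Longrightarrow> l0 z \<in> hcarrier (H z)"
      "\<And>z. z \<in> G \<Longrightarrow> (\<lambda>k. hnorm (H z) (hdiff (H z) (x (r k) z) (l0 z))) \<longlonglongrightarrow> 0" by metis
  define l where "l z = (if z \<in> G then l0 z else hzero (H z))" for z
  have lc: "l z \<in> hcarrier (H z)" for z using l0 by (auto simp: l_def)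
  have inner_lim: "(\<lambda>k. hinner (H z) (x (r k) z) y) \<longlonglongrightarrow> hinner (H z) (l z) y" if "z \<in> G" "y \<in> hcarrier (H z)" for z y
    using that l0(1,2)[OF that(1)] xS by (intro fib.tendsto_inner) (auto simp: l_def)
  have lS: "l \<in> S"
  proof (rule fieldI[OF lc])
    fix y assume y: "y \<in> S"
    show "(\<lambda>z. hinner (H z) (l z) (y z)) \<in> borel_measurable M"
    proof (rule borel_measurable_LIMSEQ_metric)
      show "(\<lambda>z. indicator G z *\<^sub>R hinner (H z) (x (r k) z) (y z)) \<in> borel_measurable M" for k
        using inner_measurable[OF xS y] G by measurable
      show "(\<lambda>k. indicator G z *\<^sub>R hinner (H z) (x (r k) z) (y z)) \<longlonglongrightarrow> hinner (H z) (l z) (y z)" for z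
        using inner_lim[of z "y z"] y by (cases "z \<in> G") (auto simp: l_def fib.inner_simps)
    qed
  qed
  have Fatou: "I (x m) l \<le> ennreal (e\<^sup>2)" if m: "m \<ge> K" and K: "\<forall>m\<ge>K. \<forall>n\<ge>K. I (x m) (x n) \<le> ennreal (e\<^sup>2)" for m K e
  proof -
    have "I (x m) l \<le> (\<integral>\<^sup>+ z. liminf (\<lambda>k. ennreal ((hnorm (H z) (hdiff (H z) (x m z) (x (r k) z)))\<^sup>2)) \<partial>M)"
      unfolding I_def
    proof (rule nn_integral_mono_AE)
      have "AE z in M. z \<in> G" using g_fin by (auto simp: G_def)
      then show "AE z in M. ennreal ((hnorm (H z) (hdiff (H z) (x m z) (l z)))\<^sup>2)
          \<le> liminf (\<lambda>k. ennreal ((hnorm (H z) (hdiff (H z) (x m z) (x (r k) z)))\<^sup>2))"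
      proof eventually_elim
        fix z assume z: "z \<in> G"
        let ?u = "hdiff (H z) (x m z)"
        have "(\<lambda>k. (hnorm (H z) (?u (x (r k) z)))\<^sup>2) \<longlonglongrightarrow> (hnorm (H z) (?u (l z)))\<^sup>2"
        proof -
          have lim: "(\<lambda>k. hnorm (H z) (?u (x (r k) z))) \<longlonglongrightarrow> hnorm (H z) (?u (l z))"
          proof (rule LIM_zero_cancel, rule Lim_null_comparison)
            show "(\<lambda>k. hnorm (H z) (hdiff (H z) (x (r k) z) (l z))) \<longlonglongrightarrow> 0" using l0(2)[OF z] z by (simp add: l_def)
            show "\<forall>\<^sub>F k in sequentially. norm (hnorm (H z) (?u (x (r k) z)) - hnorm (H z) (?u (l z))) \<le> hnorm (H z) (hdiff (H z) (x (r k) z) (l z))"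
            proof (intro always_eventually allI)
              fix k
              let ?a = "x m z" and ?b = "x (r k) z" and ?c = "l z"
              have c: "?a \<in> hcarrier (H z)" "?b \<in> hcarrier (H z)" "?c \<in> hcarrier (H z)" using xS lc by auto
              have "hdiff (H z) ?a ?b = hadd (H z) (hdiff (H z) ?a ?c) (hdiff (H z) ?c ?b)"
                "hdiff (H z) ?a ?c = hadd (H z) (hdiff (H z) ?a ?b) (hdiff (H z) ?b ?c)"
                using c by (auto intro!: fib.vector_eqI[of _ z] simp: fib.inner_simps)
              then have "hnorm (H z) (hdiff (H z) ?a ?b) \<le> hnorm (H z) (hdiff (H z) ?a ?c) + hnorm (H z) (hdiff (H z) ?c ?b)"
                "hnorm (H z) (hdiff (H z) ?a ?c) \<le> hnorm (H z) (hdiff (H z) ?a ?b) + hnorm (H z) (hdiff (H z) ?b ?c)"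
                using c by (metis fib.hnorm_triangle fib.diff_closed)+
              then show "norm (hnorm (H z) (hdiff (H z) ?a ?b) - hnorm (H z) (hdiff (H z) ?a ?c)) \<le> hnorm (H z) (hdiff (H z) ?b ?c)"
                using fib.hnorm_minus_commute[OF c(2,3)] unfolding real_norm_def by linarith
            qed
          qed
          then show ?thesis by (rule tendsto_power)
        qed
        then have "(\<lambda>k. ennreal ((hnorm (H z) (?u (x (r k) z)))\<^sup>2)) \<longlonglongrightarrow> ennreal ((hnorm (H z) (?u (l z)))\<^sup>2)"
          by (rule tendsto_ennrealI)
        from lim_imp_Liminf[OF _ this]
        show "ennreal ((hnorm (H z) (?u (l z)))\<^sup>2) \<le> liminf (\<lambda>k. ennreal ((hnorm (H z) (?u (x (r k) z)))\<^sup>2))" by simp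
      qed
    qed
    also have "\<dots> \<le> liminf (\<lambda>k. I (x m) (x (r k)))"
      unfolding I_def using norm_measurable[OF diff_field[OF xS xS]] by (intro nn_integral_liminf) measurable
    also have "\<dots> \<le> ennreal (e\<^sup>2)"
    proof (rule Liminf_le)
      show "\<forall>\<^sub>F k in sequentially. I (x m) (x (r k)) \<le> ennreal (e\<^sup>2)"
        using K m by (intro eventually_sequentiallyI[of K]) (meson order_trans r_k)
    qed simp
    finally show ?thesis .
  qed
  have lL2: "l \<in> L2"
  proof -
    obtain K where K: "\<forall>m\<ge>K. \<forall>n\<ge>K. I (x m) (x n) \<le> ennreal (1\<^sup>2)" using I_small[of 1] by auto
    let ?u = "\<lambda>z. hdiff (H z) (x K z) (l z)"
    have uS: "?u \<in> S" by (rule diff_field[OF xS lS])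
    have "I (x K) l < \<infinity>" using Fatou[OF order_refl K] by (auto simp: le_less_trans)
    then have "integrable M (\<lambda>z. (hnorm (H z) (?u z))\<^sup>2)"
      unfolding I_def using norm_measurable[OF uS] by (intro integrableI_bounded) auto
    then have uL2: "?u \<in> L2" using uS by (simp add: sq_integrable_fields_def)
    have "(\<lambda>z. hdiff (H z) (x K z) (?u z)) = l"
      using xS lc by (intro ext fib.vector_eqI) (auto simp: fib.inner_simps)
    then show ?thesis using diff_L2[OF x uL2, of K] by simp
  qed
  have "(\<lambda>n. hnorm DI (hdiff DI (s n) (cls l))) \<longlonglongrightarrow> 0"
  proof (rule LIMSEQ_I)
    fix e :: real assume e: "0 < e"
    obtain K where K: "\<forall>m\<ge>K. \<forall>n\<ge>K. I (x m) (x n) \<le> ennreal ((e/2)\<^sup>2)" using I_small[of "e/2"] e by auto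
    have "norm (hnorm DI (hdiff DI (s n) (cls l)) - 0) < e" if n: "n \<ge> K" for n
    proof -
      have "ennreal ((hnorm DI (hdiff DI (s n) (cls l)))\<^sup>2) \<le> ennreal ((e/2)\<^sup>2)"
        using Fatou[OF n K] unfolding I_L2[OF x lL2] sx .
      then have "(hnorm DI (hdiff DI (s n) (cls l)))\<^sup>2 \<le> (e/2)\<^sup>2" by (simp add: ennreal_le_iff)
      then have "hnorm DI (hdiff DI (s n) (cls l)) \<le> e/2" by (rule power2_le_imp_le) (use e in simp)
      moreover have "0 \<le> hnorm DI (hdiff DI (s n) (cls l))"
        unfolding sx DI_diff[OF x lL2] by (simp add: hnorm_def[of DI] DI_inner_self[OF diff_L2[OF x lL2]])
      ultimately show ?thesis using e by simp
    qed
    then show "\<exists>K. \<forall>n\<ge>K. norm (hnorm DI (hdiff DI (s n) (cls l)) - 0) < e" by blast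
  qed
  then show ?thesis using cls_closed[OF lL2] by blast
qed

lemma DI_cases: assumes "A \<in> hcarrier DI" obtains x where "x \<in> L2" "A = cls x"
  using assms by (auto simp: DI_carrier)

theorem direct_integral_hilbert_space: "hilbert_space DI"
proof
  show "hzero DI \<in> hcarrier DI" by (simp add: DI_zero cls_closed zero_L2)
  fix A assume "A \<in> hcarrier DI"
  then obtain x where x: "x \<in> L2" "A = cls x" by (rule DI_cases)
  have xc[simp]: "x z \<in> hcarrier (H z)" for z using L2D(1)[OF x(1)] by simp
  show "hadd DI A (hzero DI) = A"
    using x by (simp add: DI_zero DI_add zero_L2 fib.add_zero)
  show "hdiff DI A A = hzero DI"
    using x by (simp add: DI_zero DI_diff fib.add_minus)
  show "hscale DI 1 A = A"
    using x by (simp add: DI_scale fib.scale_one)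
  show "hscale DI c A \<in> hcarrier DI" for c
    using x by (simp add: DI_scale cls_closed scale_L2)
  show "hscale DI a (hscale DI b A) = hscale DI (a * b) A" for a b
    using x by (simp add: DI_scale scale_L2 fib.scale_scale)
  show "hscale DI (a + b) A = hadd DI (hscale DI a A) (hscale DI b A)" for a b
    using x by (simp add: DI_scale DI_add scale_L2 fib.scale_add_left)
  show "0 \<le> Re (hinner DI A A)"
    using x by (simp add: DI_inner_self)
  show "A = hzero DI" if "hinner DI A A = 0"
  proof -
    have "(\<integral>z. (hnorm (H z) (x z))\<^sup>2 \<partial>M) = 0" using that x by (simp add: DI_inner_self)
    then have "AE z in M. (hnorm (H z) (x z))\<^sup>2 = 0"
      using L2D(2)[OF x(1)] by (subst (asm) integral_nonneg_eq_0_iff_AE) auto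
    then have "AE z in M. x z = hzero (H z)"
      by eventually_elim (auto intro: fib.hnorm_eq_zero)
    then show ?thesis unfolding x(2) DI_zero by (rule cls_eqI[OF x(1) zero_L2])
  qed
  fix B assume "B \<in> hcarrier DI"
  then obtain y where y: "y \<in> L2" "B = cls y" by (rule DI_cases)
  have yc[simp]: "y z \<in> hcarrier (H z)" for z using L2D(1)[OF y(1)] by simp
  show "hadd DI A B \<in> hcarrier DI" using x y by (simp add: DI_add cls_closed add_L2)
  show "hadd DI A B = hadd DI B A" using x y by (simp add: DI_add fib.add_commute)
  show "hscale DI a (hadd DI A B) = hadd DI (hscale DI a A) (hscale DI a B)" for a
    using x y by (simp add: DI_scale DI_add scale_L2 add_L2 fib.scale_add_right)
  show "hinner DI B A = cnj (hinner DI A B)"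
  proof -
    have "(\<lambda>z. hinner (H z) (y z) (x z)) = (\<lambda>z. cnj (hinner (H z) (x z) (y z)))"
      by (auto simp: fun_eq_iff intro: fib.inner_commute)
    then show ?thesis using x y by (simp add: DI_inner)
  qed
  show "hinner DI (hscale DI c A) B = c * hinner DI A B" for c
    using x y by (simp add: DI_scale DI_inner scale_L2 fib.inner_simps)
  fix C assume "C \<in> hcarrier DI"
  then obtain w where w: "w \<in> L2" "C = cls w" by (rule DI_cases)
  have wc[simp]: "w z \<in> hcarrier (H z)" for z using L2D(1)[OF w(1)] by simp
  show "hadd DI (hadd DI A B) C = hadd DI A (hadd DI B C)"
    using x y w by (simp add: DI_add add_L2 fib.add_assoc)
  show "hinner DI (hadd DI A B) C = hinner DI A C + hinner DI B C"
    using x y w by (simp add: DI_add DI_inner add_L2 fib.inner_simps inner_integrable)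
qed (rule DI_complete)

end

section \<open>Functional calculus of decomposable normal operators\<close>

locale decomposable_normal = measurable_hilbert_field M H S
  for M :: "'z measure" and H :: "'z \<Rightarrow> 'h hspace" and S +
  fixes X :: "('z \<Rightarrow> 'h) set \<Rightarrow> ('z \<Rightarrow> 'h) set" and X' :: "'z \<Rightarrow> 'h \<Rightarrow> 'h"
  assumes decomposition: "is_direct_integral_op M H S X X'"
    and X_normal: "normal_op DI X"
    and fibre_normal: "normal_op (H z) (X' z)"
    and fibre_spectrum: "spectrum (H z) (X' z) \<subseteq> spectrum DI X"
begin

sublocale D: normal_operator DI X
  by (intro normal_operator.intro normal_operator_axioms.intro direct_integral_hilbert_space X_normal)

sublocale nf: normal_operator "H z" "X' z" for z
  by (intro normal_operator.intro normal_operator_axioms.intro fibre_hilbert fibre_normal)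

lemma X_ops: "X \<in> bounded_ops DI" and X'_ops: "X' z \<in> bounded_ops (H z)"
  using X_normal fibre_normal by (simp_all add: normal_op_def)

lemma X'_field: "x \<in> S \<Longrightarrow> (\<lambda>z. X' z (x z)) \<in> S"
  using decomposition by (simp add: is_direct_integral_op_def decomposable_field_def)

text \<open>Square integrability of \<open>z \<mapsto> X(z) x(z)\<close> is read off from the fact that \<open>X\<close> maps into the direct
  integral: otherwise the class of that field would be empty. Going through the operator norms of
  the fibres is thereby avoided.\<close>
lemma X_cls:
  assumes x: "x \<in> L2"
  shows "(\<lambda>z. X' z (x z)) \<in> L2" "X (cls x) = cls (\<lambda>z. X' z (x z))"
proof -
  let ?r = "representative (cls x)"
  have r: "?r \<in> L2" "AE z in M. x z = ?r z" using representative_cls[OF x] by auto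
  have Xr: "X (cls x) = cls (\<lambda>z. X' z (?r z))"
    using decomposition cls_closed[OF x] by (simp add: is_direct_integral_op_def direct_integral_op_def)
  have "X (cls x) \<in> hcarrier DI" using D.op_closed[OF X_ops cls_closed[OF x]] .
  then obtain y where "y \<in> L2" "cls (\<lambda>z. X' z (?r z)) = cls y" unfolding Xr by (rule DI_cases)
  then have "cls (\<lambda>z. X' z (?r z)) \<noteq> {}" using self_in_cls by blast
  then have r': "(\<lambda>z. X' z (?r z)) \<in> L2" using cls_empty by blast
  have ae: "AE z in M. X' z (?r z) = X' z (x z)" using r(2) by eventually_elim simp
  have xS: "(\<lambda>z. X' z (x z)) \<in> S" by (rule X'_field[OF L2D(1)[OF x]])
  have "integrable M (\<lambda>z. (hnorm (H z) (X' z (x z)))\<^sup>2)"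
  proof (rule integrable_cong_AE_imp[OF L2D(2)[OF r']])
    show "(\<lambda>z. (hnorm (H z) (X' z (x z)))\<^sup>2) \<in> borel_measurable M"
      using norm_measurable[OF xS] by measurable
    show "AE z in M. (hnorm (H z) (X' z (?r z)))\<^sup>2 = (hnorm (H z) (X' z (x z)))\<^sup>2"
      using ae by eventually_elim simp
  qed
  then show L: "(\<lambda>z. X' z (x z)) \<in> L2" using xS by (simp add: sq_integrable_fields_def)
  show "X (cls x) = cls (\<lambda>z. X' z (x z))" unfolding Xr by (rule cls_eqI[OF r' L ae])
qed

abbreviation \<Sigma> :: "complex set" where "\<Sigma> \<equiv> spectrum DI X"

abbreviation fib_calc :: "(complex \<Rightarrow> complex) \<Rightarrow> 'z \<Rightarrow> 'h \<Rightarrow> 'h" where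
  "fib_calc f z \<equiv> borel_calculus (H z) f (X' z)"

abbreviation calc_field :: "(complex \<Rightarrow> complex) \<Rightarrow> ('z \<Rightarrow> 'h) \<Rightarrow> 'z \<Rightarrow> 'h" where
  "calc_field f x \<equiv> \<lambda>z. fib_calc f z (x z)"

abbreviation field_inner :: "('z \<Rightarrow> 'h) \<Rightarrow> ('z \<Rightarrow> 'h) \<Rightarrow> 'z \<Rightarrow> complex" where
  "field_inner x y \<equiv> \<lambda>z. hinner (H z) (x z) (y z)"

abbreviation adm :: "(complex \<Rightarrow> complex) \<Rightarrow> bool" where "adm \<equiv> admissible borel \<Sigma>"

lemma D_adm: "adm f \<Longrightarrow> D.S.adm f" and nf_adm: "adm f \<Longrightarrow> nf.S.adm z f"
  by (rule D.admissible_restrict, assumption, rule order_refl)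
    (rule nf.admissible_restrict, assumption, rule fibre_spectrum)

lemma fib_calc_closed[simp]: "adm f \<Longrightarrow> u \<in> hcarrier (H z) \<Longrightarrow> fib_calc f z u \<in> hcarrier (H z)"
  by (rule fib.op_closed[OF nf.calc_ops[OF nf_adm]])

lemma fib_calc_bound:
  assumes f: "adm f" "\<And>l. l \<in> \<Sigma> \<Longrightarrow> cmod (f l) \<le> B" and B: "0 \<le> B" and u: "u \<in> hcarrier (H z)"
  shows "hnorm (H z) (fib_calc f z u) \<le> B * hnorm (H z) u"
  by (rule nf.calc_contraction[OF nf_adm[OF f(1)] B _ u]) (use f(2) fibre_spectrum in blast)

lemma calc_field_L2:
  assumes f: "adm f" and x: "x \<in> L2" and m: "calc_field f x \<in> S"
  shows "calc_field f x \<in> L2"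
proof -
  obtain B where B: "0 \<le> B" "\<And>l. l \<in> \<Sigma> \<Longrightarrow> cmod (f l) \<le> B" using admissible_bound[OF f] by blast
  show ?thesis
  proof (rule L2_bound[OF m])
    show "integrable M (\<lambda>z. B\<^sup>2 * (hnorm (H z) (x z))\<^sup>2)" using L2D(2)[OF x] by simp
    fix z
    have xz: "x z \<in> hcarrier (H z)" using L2D(1)[OF x] by simp
    have "(hnorm (H z) (fib_calc f z (x z)))\<^sup>2 \<le> (B * hnorm (H z) (x z))\<^sup>2"
      using f xz by (intro power_mono fib_calc_bound B) auto
    then show "(hnorm (H z) (fib_calc f z (x z)))\<^sup>2 \<le> B\<^sup>2 * (hnorm (H z) (x z))\<^sup>2"
      by (simp add: power_mult_distrib)
  qed
qed

text \<open>The equality of operators is tested by inner products, because that is the form in which bounded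
  limits of functions are preserved. Measurability is required for all fields in \<open>S\<close>, as for a
  measurable field of operators.\<close>

definition decomposes :: "(complex \<Rightarrow> complex) \<Rightarrow> bool" where
  "decomposes f \<longleftrightarrow> (\<forall>x\<in>S. calc_field f x \<in> S) \<and>
     (\<forall>x\<in>L2. \<forall>y\<in>L2. hinner DI (D.calc f (cls x)) (cls y) = (\<integral>z. field_inner (calc_field f x) y z \<partial>M))"

lemma decomposesI:
  assumes "\<And>x. x \<in> S \<Longrightarrow> calc_field f x \<in> S"
    and "\<And>x y. \<lbrakk>x \<in> L2; y \<in> L2; x \<in> S; y \<in> S; cls x \<in> hcarrier DI; cls y \<in> hcarrier DI\<rbrakk> \<Longrightarrow>
      hinner DI (D.calc f (cls x)) (cls y) = (\<integral>z. field_inner (calc_field f x) y z \<partial>M)"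
  shows "decomposes f"
  unfolding decomposes_def using assms cls_closed L2D(1) by blast

lemma decomposesD:
  "decomposes f \<Longrightarrow> x \<in> S \<Longrightarrow> calc_field f x \<in> S"
  "decomposes f \<Longrightarrow> x \<in> L2 \<Longrightarrow> y \<in> L2 \<Longrightarrow>
     hinner DI (D.calc f (cls x)) (cls y) = (\<integral>z. field_inner (calc_field f x) y z \<partial>M)"
  by (auto simp: decomposes_def)

lemma decomposes_one: "decomposes (\<lambda>l. 1)"
  by (rule decomposesI) (simp_all add: nf.calc_one D.calc_one DI_inner del: Image_singleton_iff)

lemma decomposes_mult_id:
  assumes f: "adm f" and d: "decomposes f"
  shows "decomposes (\<lambda>l. l * f l)"
proof -
  have *: "calc_field (\<lambda>l. l * f l) x = calc_field f (\<lambda>z. X' z (x z))" if "x \<in> S" for x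
    using that by (simp add: nf.calc_mult_id[OF nf_adm[OF f]])
  show ?thesis
  proof (rule decomposesI)
    show "calc_field (\<lambda>l. l * f l) x \<in> S" if "x \<in> S" for x
      unfolding *[OF that] by (rule decomposesD(1)[OF d X'_field[OF that]])
    fix x y assume x: "x \<in> L2" "x \<in> S" "cls x \<in> hcarrier DI" and y: "y \<in> L2"
    have "D.calc (\<lambda>l. l * f l) (cls x) = D.calc f (cls (\<lambda>z. X' z (x z)))"
      by (simp only: D.calc_mult_id[OF D_adm[OF f]] D.comp_op_apply[OF x(3)] X_cls(2)[OF x(1)])
    then show "hinner DI (D.calc (\<lambda>l. l * f l) (cls x)) (cls y) = (\<integral>z. field_inner (calc_field (\<lambda>l. l * f l) x) y z \<partial>M)"
      using decomposesD(2)[OF d X_cls(1)[OF x(1)] y] fun_cong[OF *[OF x(2)]] by simp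
  qed
qed

text \<open>Measurability of the field is tested against the fields \<open>y\<close>, where the adjoint becomes \<open>X(z)\<close> acting
  on \<open>y(z)\<close>.\<close>
lemma decomposes_mult_cnj:
  assumes f: "adm f" and d: "decomposes f"
  shows "decomposes (\<lambda>l. cnj l * f l)"
proof -
  have c: "fib_calc (\<lambda>l. cnj l * f l) z u \<in> hcarrier (H z)" if "u \<in> hcarrier (H z)" for z u
    using that f by (simp add: nf.calc_mult_cnj[OF nf_adm[OF f]] X'_ops)
  have *: "field_inner (calc_field (\<lambda>l. cnj l * f l) x) y = field_inner (calc_field f x) (\<lambda>z. X' z (y z))"
    if "x \<in> S" "y \<in> S" for x y
    using that f by (simp add: nf.calc_mult_cnj[OF nf_adm[OF f]] fib.adjoint_inner_left[OF X'_ops])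
  show ?thesis
  proof (rule decomposesI)
    show "calc_field (\<lambda>l. cnj l * f l) x \<in> S" if x: "x \<in> S" for x
    proof (rule fieldI)
      show "field_inner (calc_field (\<lambda>l. cnj l * f l) x) y \<in> borel_measurable M" if y: "y \<in> S" for y
        unfolding *[OF x y] by (rule inner_measurable[OF decomposesD(1)[OF d x] X'_field[OF y]])
    qed (use x c in auto)
    fix x y assume x: "x \<in> L2" "x \<in> S" "cls x \<in> hcarrier DI" and y: "y \<in> L2" "y \<in> S" "cls y \<in> hcarrier DI"
    have "hinner DI (D.calc (\<lambda>l. cnj l * f l) (cls x)) (cls y) = hinner DI (D.calc f (cls x)) (X (cls y))"
      using D.adjoint_inner_left[OF X_ops _ y(3), of "D.calc f (cls x)"] x(3) D.calc_ops[OF D_adm[OF f]]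
      by (simp add: D.calc_mult_cnj[OF D_adm[OF f]] del: Image_singleton_iff)
    then show "hinner DI (D.calc (\<lambda>l. cnj l * f l) (cls x)) (cls y) = (\<integral>z. field_inner (calc_field (\<lambda>l. cnj l * f l) x) y z \<partial>M)"
      unfolding X_cls(2)[OF y(1)] decomposesD(2)[OF d x(1) X_cls(1)[OF y(1)]] *[OF x(2) y(2)] .
  qed
qed

lemma decomposes_add:
  assumes f: "adm f" "decomposes f" and g: "adm g" "decomposes g"
  shows "decomposes (\<lambda>l. f l + g l)"
proof -
  have *: "calc_field (\<lambda>l. f l + g l) x = (\<lambda>z. hadd (H z) (calc_field f x z) (calc_field g x z))" if "x \<in> S" for x
    using that by (simp add: nf.calc_add[OF nf_adm[OF f(1)] nf_adm[OF g(1)]])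
  show ?thesis
  proof (rule decomposesI)
    show "calc_field (\<lambda>l. f l + g l) x \<in> S" if "x \<in> S" for x
      unfolding *[OF that] by (intro add_field decomposesD(1)[OF f(2)] decomposesD(1)[OF g(2)] that)
    fix x y assume x: "x \<in> L2" "x \<in> S" "cls x \<in> hcarrier DI" and y: "y \<in> L2" "y \<in> S" "cls y \<in> hcarrier DI"
    have fx: "calc_field f x \<in> L2" and gx: "calc_field g x \<in> L2"
      using calc_field_L2[OF f(1) x(1)] calc_field_L2[OF g(1) x(1)] decomposesD(1)[OF f(2) x(2)] decomposesD(1)[OF g(2) x(2)]
      by auto
    have "hinner DI (D.calc (\<lambda>l. f l + g l) (cls x)) (cls y) = hinner DI (D.calc f (cls x)) (cls y) + hinner DI (D.calc g (cls x)) (cls y)"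
      using D.calc_ops[OF D_adm[OF f(1)]] D.calc_ops[OF D_adm[OF g(1)]] x(3) y(3)
      by (simp add: D.calc_add[OF D_adm[OF f(1)] D_adm[OF g(1)]] D.inner_simps del: Image_singleton_iff)
    also have "\<dots> = (\<integral>z. field_inner (calc_field f x) y z + field_inner (calc_field g x) y z \<partial>M)"
      using inner_integrable[OF fx y(1)] inner_integrable[OF gx y(1)]
        decomposesD(2)[OF f(2) x(1) y(1)] decomposesD(2)[OF g(2) x(1) y(1)] by simp
    also have "\<dots> = (\<integral>z. field_inner (calc_field (\<lambda>l. f l + g l) x) y z \<partial>M)"
      using x y f g by (simp add: fun_cong[OF *[OF x(2)]] fib.inner_simps)
    finally show "hinner DI (D.calc (\<lambda>l. f l + g l) (cls x)) (cls y) = \<dots>" .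
  qed
qed

lemma decomposes_scale:
  assumes f: "adm f" "decomposes f"
  shows "decomposes (\<lambda>l. c * f l)"
proof -
  have *: "calc_field (\<lambda>l. c * f l) x = (\<lambda>z. hscale (H z) c (calc_field f x z))" if "x \<in> S" for x
    using that by (simp add: nf.calc_scale[OF nf_adm[OF f(1)]])
  show ?thesis
  proof (rule decomposesI)
    show "calc_field (\<lambda>l. c * f l) x \<in> S" if "x \<in> S" for x
      unfolding *[OF that] by (intro scale_field decomposesD(1)[OF f(2)] that)
    fix x y assume x: "x \<in> L2" "x \<in> S" "cls x \<in> hcarrier DI" and y: "y \<in> L2" "y \<in> S" "cls y \<in> hcarrier DI"
    have "hinner DI (D.calc (\<lambda>l. c * f l) (cls x)) (cls y) = c * hinner DI (D.calc f (cls x)) (cls y)"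
      using D.calc_ops[OF D_adm[OF f(1)]] x(3) y(3)
      by (simp add: D.calc_scale[OF D_adm[OF f(1)]] D.inner_simps del: Image_singleton_iff)
    then show "hinner DI (D.calc (\<lambda>l. c * f l) (cls x)) (cls y) = (\<integral>z. field_inner (calc_field (\<lambda>l. c * f l) x) y z \<partial>M)"
      using decomposesD(2)[OF f(2) x(1) y(1)] x y f by (simp add: fun_cong[OF *[OF x(2)]] fib.inner_simps)
  qed
qed

text \<open>In every fibre the inner products converge; this gives measurability of the limit field. They
  are dominated by \<open>B (\<parallel>x(z)\<parallel>\<^sup>2 + \<parallel>y(z)\<parallel>\<^sup>2)\<close>, which is integrable and independent of \<open>n\<close>, since all
  fibre spectra lie in the spectrum of \<open>X\<close>, where the functions are bounded by \<open>B\<close>.\<close>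
lemma decomposes_limit:
  assumes F: "bounded_limit borel \<Sigma> F f" "\<And>n. decomposes (F n)"
  shows "decomposes f"
proof -
  obtain B where B: "0 \<le> B" "\<And>n l. l \<in> \<Sigma> \<Longrightarrow> cmod (F n l) \<le> B" using bounded_limit_bound[OF F(1)] by blast
  have Fa: "adm (F n)" and fa: "adm f" for n by (rule bounded_limit_admissible[OF F(1)])+
  have lim: "(\<lambda>n. field_inner (calc_field (F n) x) y z) \<longlonglongrightarrow> field_inner (calc_field f x) y z" if "x \<in> S" "y \<in> S" for x y z
    using that by (intro nf.calc_limit[OF F(1) fibre_spectrum]) auto
  have meas: "calc_field f x \<in> S" if x: "x \<in> S" for x
  proof (rule fieldI)
    show "fib_calc f z (x z) \<in> hcarrier (H z)" for z using fa x by simp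
    show "field_inner (calc_field f x) y \<in> borel_measurable M" if y: "y \<in> S" for y
      by (rule borel_measurable_LIMSEQ_metric[OF inner_measurable[OF decomposesD(1)[OF F(2) x] y] lim[OF x y]])
  qed
  show ?thesis
  proof (rule decomposesI[OF meas])
    fix x y assume x: "x \<in> L2" "x \<in> S" "cls x \<in> hcarrier DI" and y: "y \<in> L2" "y \<in> S" "cls y \<in> hcarrier DI"
    have "(\<lambda>n. \<integral>z. field_inner (calc_field (F n) x) y z \<partial>M) \<longlonglongrightarrow> (\<integral>z. field_inner (calc_field f x) y z \<partial>M)"
    proof (rule integral_dominated_convergence[where w="\<lambda>z. B * ((hnorm (H z) (x z))\<^sup>2 + (hnorm (H z) (y z))\<^sup>2)"])
      show "field_inner (calc_field f x) y \<in> borel_measurable M"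
        by (rule inner_measurable[OF meas[OF x(2)] y(2)])
      show "field_inner (calc_field (F n) x) y \<in> borel_measurable M" for n
        by (rule inner_measurable[OF decomposesD(1)[OF F(2) x(2)] y(2)])
      show "integrable M (\<lambda>z. B * ((hnorm (H z) (x z))\<^sup>2 + (hnorm (H z) (y z))\<^sup>2))"
        using L2D(2)[OF x(1)] L2D(2)[OF y(1)] by simp
      show "AE z in M. (\<lambda>n. field_inner (calc_field (F n) x) y z) \<longlonglongrightarrow> field_inner (calc_field f x) y z"
        by (intro always_eventually allI lim x y)
      fix n
      show "AE z in M. cmod (field_inner (calc_field (F n) x) y z) \<le> B * ((hnorm (H z) (x z))\<^sup>2 + (hnorm (H z) (y z))\<^sup>2)"
      proof (intro always_eventually allI)
        fix z
        have c: "x z \<in> hcarrier (H z)" "y z \<in> hcarrier (H z)" using x y by auto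
        let ?a = "hnorm (H z) (x z)" and ?b = "hnorm (H z) (y z)"
        have "cmod (field_inner (calc_field (F n) x) y z) \<le> hnorm (H z) (fib_calc (F n) z (x z)) * ?b"
          using Fa c by (intro fib.Cauchy_Schwarz) auto
        also have "\<dots> \<le> (B * ?a) * ?b"
          using c by (intro mult_right_mono fib_calc_bound Fa B) auto
        also have "\<dots> \<le> B * (?a\<^sup>2 + ?b\<^sup>2)"
        proof -
          have "0 \<le> (?a - ?b)\<^sup>2" "0 \<le> ?a * ?b" using c by auto
          then have "?a * ?b \<le> ?a\<^sup>2 + ?b\<^sup>2" unfolding power2_diff by linarith
          then show ?thesis unfolding mult.assoc by (intro mult_left_mono B)
        qed
        finally show "cmod (field_inner (calc_field (F n) x) y z) \<le> B * (?a\<^sup>2 + ?b\<^sup>2)" .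
      qed
    qed
    then have "(\<lambda>n. hinner DI (D.calc (F n) (cls x)) (cls y)) \<longlonglongrightarrow> (\<integral>z. field_inner (calc_field f x) y z \<partial>M)"
      by (simp only: decomposesD(2)[OF F(2) x(1) y(1)])
    then show "hinner DI (D.calc f (cls x)) (cls y) = (\<integral>z. field_inner (calc_field f x) y z \<partial>M)"
      by (rule LIMSEQ_unique[OF D.calc_limit[OF F(1) order_refl x(3) y(3)]])
  qed
qed

lemma decomposes_bounded_borel: "adm f \<Longrightarrow> decomposes f"
proof (erule bounded_borel_induct[OF D.spectrum_bounded, where P=decomposes, rotated -1])
  show "decomposes f" if "bounded_limit borel \<Sigma> F f" "\<And>n. decomposes (F n)" for F f
    by (rule decomposes_limit[OF that])
qed (simp_all add: decomposes_one decomposes_mult_id decomposes_mult_cnj decomposes_add decomposes_scale)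

theorem calculus_decomposes_borel:
  assumes f: "adm f"
  shows "is_direct_integral_op M H S (borel_calculus DI f X) (fib_calc f)"
proof -
  have d: "decomposes f" by (rule decomposes_bounded_borel[OF f])
  obtain B where B: "0 \<le> B" "\<And>l. l \<in> \<Sigma> \<Longrightarrow> cmod (f l) \<le> B" using admissible_bound[OF f] by blast
  have "op_norm (H z) (fib_calc f z) \<le> B" for z
    unfolding op_norm_def
  proof (rule cSUP_least)
    have "hzero (H z) \<in> {x \<in> hcarrier (H z). hnorm (H z) x \<le> 1}" by (simp add: fib.hnorm_zero)
    then show "{x \<in> hcarrier (H z). hnorm (H z) x \<le> 1} \<noteq> {}" by blast
    fix u assume u: "u \<in> {x \<in> hcarrier (H z). hnorm (H z) x \<le> 1}"
    have "hnorm (H z) (fib_calc f z u) \<le> B * hnorm (H z) u"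
      using u by (intro fib_calc_bound f B) auto
    also have "\<dots> \<le> B * 1" using u B by (intro mult_left_mono) auto
    finally show "hnorm (H z) (fib_calc f z u) \<le> B" by simp
  qed
  moreover have "fib_calc f z \<in> bounded_ops (H z)" for z by (rule nf.calc_ops[OF nf_adm[OF f]])
  ultimately have "decomposable_field M H S (fib_calc f)"
    using decomposesD(1)[OF d] unfolding decomposable_field_def by (intro conjI) (auto intro!: exI[of _ B])
  moreover have "borel_calculus DI f X = direct_integral_op M H S (fib_calc f)"
  proof (rule extensionalityI)
    have ops: "D.calc f \<in> bounded_ops DI" by (rule D.calc_ops[OF D_adm[OF f]])
    then show "D.calc f \<in> extensional (hcarrier DI)" by (rule D.op_extensional)
    show "direct_integral_op M H S (fib_calc f) \<in> extensional (hcarrier DI)" by (simp add: direct_integral_op_def)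
    fix A assume A: "A \<in> hcarrier DI"
    define x where "x = representative A"
    have x: "x \<in> L2" "A = cls x" using representative_carrier[OF A] by (simp_all add: x_def)
    have fx: "calc_field f x \<in> L2"
      by (rule calc_field_L2[OF f x(1) decomposesD(1)[OF d L2D(1)[OF x(1)]]])
    have "D.calc f A = cls (calc_field f x)"
    proof (rule D.vector_eqI)
      show "D.calc f A \<in> hcarrier DI" by (rule D.op_closed[OF ops A])
      show "cls (calc_field f x) \<in> hcarrier DI" by (rule cls_closed[OF fx])
      fix C assume "C \<in> hcarrier DI"
      then obtain y where y: "y \<in> L2" "C = cls y" by (rule DI_cases)
      show "hinner DI (D.calc f A) C = hinner DI (cls (calc_field f x)) C"
        unfolding x(2) y(2) decomposesD(2)[OF d x(1) y(1)] DI_inner[OF fx y(1)] ..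
    qed
    then show "D.calc f A = direct_integral_op M H S (fib_calc f) A"
      using A by (simp add: direct_integral_op_def x_def)
  qed
  ultimately show ?thesis by (simp add: is_direct_integral_op_def)
qed

text \<open>A function that is Borel on the spectrum is extended by zero to the plane. As the spectrum is closed
  the extension is Borel, and it changes neither calculus.\<close>
theorem calculus_decomposes:
  assumes f: "f \<in> borel_measurable (restrict_space borel \<Sigma>)" "bounded (f ` \<Sigma>)"
  shows "is_direct_integral_op M H S (borel_calculus DI f X) (fib_calc f)"
proof -
  define g where "g l = (if l \<in> \<Sigma> then f l else 0)" for l
  have g: "adm g"
    using f D.spectrum_measurable unfolding g_def admissible_def
    by (simp add: measurable_restrict_space_iff[of \<Sigma> borel 0 borel f] cong: image_cong)
  have fa: "D.S.adm f" using f by (simp add: admissible_def)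
  have fz: "nf.S.adm z f" for z
  proof -
    have "f \<in> borel_measurable (restrict_space (restrict_space borel \<Sigma>) (spectrum (H z) (X' z)))"
      using f(1) by (rule measurable_restrict_space1)
    also have "restrict_space (restrict_space borel \<Sigma>) (spectrum (H z) (X' z)) = spectrum_borel (H z) (X' z)"
      using fibre_spectrum[of z] D.spectrum_measurable nf.spectrum_measurable[of z]
      by (subst restrict_restrict_space) (simp_all add: Int_absorb1)
    finally show ?thesis
      using bounded_subset[OF f(2) image_mono[OF fibre_spectrum]] by (simp add: admissible_def)
  qed
  have "borel_calculus DI f X = borel_calculus DI g X"
    by (rule D.calc_cong[OF fa D_adm[OF g]]) (simp add: g_def)
  moreover have "fib_calc f = fib_calc g"
  proof
    fix z show "fib_calc f z = fib_calc g z"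
      by (rule nf.calc_cong[OF fz nf_adm[OF g]]) (use fibre_spectrum in \<open>auto simp: g_def\<close>)
  qed
  ultimately show ?thesis using calculus_decomposes_borel[OF g] by simp
qed

end

theorem proposition3p5:
  fixes \<omega> :: "'z::polish_space measure"
    and H :: "'z \<Rightarrow> 'h hspace"
    and S :: "('z \<Rightarrow> 'h) set"
    and X :: "('z \<Rightarrow> 'h) set \<Rightarrow> ('z \<Rightarrow> 'h) set"
    and X' :: "'z \<Rightarrow> 'h \<Rightarrow> 'h"
    and f :: "complex \<Rightarrow> complex"
  assumes "sets \<omega> = sets borel"
    and "sigma_finite_measure \<omega>"
    and "measurable_hilbert_field \<omega> H S"
    and "is_direct_integral_op \<omega> H S X X'"
    and "normal_op (direct_integral \<omega> H S) X"
    and "\<And>\<zeta>. normal_op (H \<zeta>) (X' \<zeta>)"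
    and "\<And>\<zeta>. spectrum (H \<zeta>) (X' \<zeta>) \<subseteq> spectrum (direct_integral \<omega> H S) X"
    and "f \<in> borel_measurable (restrict_space borel (spectrum (direct_integral \<omega> H S) X))"
    and "bounded (f ` spectrum (direct_integral \<omega> H S) X)"
  shows "is_direct_integral_op \<omega> H S
           (borel_calculus (direct_integral \<omega> H S) f X)
           (\<lambda>\<zeta>. borel_calculus (H \<zeta>) f (X' \<zeta>))"
proof -
  interpret decomposable_normal \<omega> H S X X'
    by (intro decomposable_normal.intro decomposable_normal_axioms.intro assms(3-7))
  show ?thesis by (rule calculus_decomposes[OF assms(8,9)])
qed

end
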